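(* For every fixed $d\geq 1$ and every $N\geq 1$, the numbers $$|\mathrm{Av}_0(\beta_d)|,\ |\mathrm{Av}_1(\beta_d)|,\ \ldots,\ |\mathrm{Av}_N(\beta_d)|$$ can be computed using $O_d(N^{3d+2})$ integer arithmetic operations and $O_d(N^{2d+1})$ stored integers. All integers involved have $O_d(N\log N)$ bits. Therefore the bit complexity is polynomial; more precisely, it is $O_d\!\left(N^{3d+2}\,M(N\log N)\right)$, and the bit storage is $O_d(N^{2d+2}\log N)$.
   Context: Write $[n]=\{1,\ldots,n\}$. A permutation $\pi=\pi_1\cdots\pi_n$ of $[n]$ contains a permutation $\tau$ of $[k]$ if there are indices $1\leq i_1<\cdots<i_k\leq n$ such that $\pi_{i_1},\ldots,\pi_{i_k}$ has the same relative order as $\tau$; otherwise $\pi$ avoids $\tau$. $\mathrm{Av}_n(\tau)$ is the set of permutations of $[n]$ that avoid $\tau$. For $d\ge1$, $\beta_d=12\cdots d\,(d+2)(d+3)(d+1)$, a permutation of $[d+3]$ (the direct sum of the increasing permutation $12\cdots d$ and $231$); thus $\beta_1=1342$, $\beta_2=12453$. The notation $O_d(\cdot)$ allows the hidden constant to depend on $d$. The operation count treats each integer addition or multiplication as one step; the bit complexity counts operations on single bits. $M(b)$ denotes the cost of multiplying two $b$-bit integers. *)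

theory Defs
  imports
    "HOL-Combinatorics.Multiset_Permutations"
    "HOL-Library.Landau_Symbols"
    "HOL-Library.Log_Nat"
begin

section \<open>Pattern avoidance\<close>

text \<open>Permutations of \<open>[n]\<close> are written in one-line notation, as lists of length \<open>n\<close>.\<close>

definition contains_pattern :: "nat list \<Rightarrow> nat list \<Rightarrow> bool" where
  "contains_pattern \<pi> \<tau> \<longleftrightarrow>
     (\<exists>f. strict_mono_on {..<length \<tau>} f \<and> f ` {..<length \<tau>} \<subseteq> {..<length \<pi>} \<and>
          (\<forall>i<length \<tau>. \<forall>j<length \<tau>. \<pi> ! f i < \<pi> ! f j \<longleftrightarrow> \<tau> ! i < \<tau> ! j))"

definition Av :: "nat \<Rightarrow> nat list \<Rightarrow> nat list set" where
  "Av n \<tau> = {\<pi> \<in> permutations_of_set {1..n}. \<not> contains_pattern \<pi> \<tau>}"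

definition beta :: "nat \<Rightarrow> nat list" where
  "beta d = [1..<d + 1] @ [d + 2, d + 3, d + 1]"


section \<open>A random access machine over the integers\<close>

text \<open>
  Programs are structured programs for a random access machine. The store consists of registers
  \<open>Reg i\<close>, which a program addresses directly, and of memory cells \<open>Cell a\<close>, which it can address
  only through the content of a register (the memory is infinite in both directions, so that every
  integer is an address). Each of these locations holds one integer of arbitrary size.
\<close>

datatype loc = Reg nat | Cell int

type_synonym state = "loc \<Rightarrow> int"

datatype instr =
    Const nat int      \<comment> \<open>\<open>R\<^sub>i := c\<close>\<close>
  | Add nat nat nat    \<comment> \<open>\<open>R\<^sub>i := R\<^sub>j + R\<^sub>k\<close>\<close>
  | Sub nat nat nat    \<comment> \<open>\<open>R\<^sub>i := R\<^sub>j - R\<^sub>k\<close>\<close>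
  | Mult nat nat nat   \<comment> \<open>\<open>R\<^sub>i := R\<^sub>j * R\<^sub>k\<close>\<close>
  | Load nat nat       \<comment> \<open>\<open>R\<^sub>i := Cell (R\<^sub>j)\<close>\<close>
  | Store nat nat      \<comment> \<open>\<open>Cell (R\<^sub>i) := R\<^sub>j\<close>\<close>
  | Test nat           \<comment> \<open>compare \<open>R\<^sub>i\<close> with 0; emitted by the control structures below\<close>

datatype com =
    Skip
  | Do instr
  | Seq com com
  | Cond nat com com   \<comment> \<open>branch on \<open>R\<^sub>i > 0\<close>\<close>
  | While nat com      \<comment> \<open>loop while \<open>R\<^sub>i > 0\<close>\<close>

fun effect :: "instr \<Rightarrow> state \<Rightarrow> state" where
  "effect (Const i c) s = s(Reg i := c)"
| "effect (Add i j k) s = s(Reg i := s (Reg j) + s (Reg k))"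
| "effect (Sub i j k) s = s(Reg i := s (Reg j) - s (Reg k))"
| "effect (Mult i j k) s = s(Reg i := s (Reg j) * s (Reg k))"
| "effect (Load i j) s = s(Reg i := s (Cell (s (Reg j))))"
| "effect (Store i j) s = s(Cell (s (Reg i)) := s (Reg j))"
| "effect (Test i) s = s"

text \<open>
  A trace is the sequence of the instructions executed, each paired with the state in which it is
  executed. \<open>exec c s tr t\<close> means that \<open>c\<close>, started in \<open>s\<close>, terminates in \<open>t\<close> with trace \<open>tr\<close>.
\<close>

type_synonym trace = "(instr \<times> state) list"

inductive exec :: "com \<Rightarrow> state \<Rightarrow> trace \<Rightarrow> state \<Rightarrow> bool" where
  Skip: "exec Skip s [] s"
| Do: "exec (Do i) s [(i, s)] (effect i s)"
| Seq: "exec c1 s tr1 s' \<Longrightarrow> exec c2 s' tr2 t \<Longrightarrow> exec (Seq c1 c2) s (tr1 @ tr2) t"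
| CondTrue: "s (Reg i) > 0 \<Longrightarrow> exec c1 s tr t \<Longrightarrow> exec (Cond i c1 c2) s ((Test i, s) # tr) t"
| CondFalse: "s (Reg i) \<le> 0 \<Longrightarrow> exec c2 s tr t \<Longrightarrow> exec (Cond i c1 c2) s ((Test i, s) # tr) t"
| WhileTrue: "s (Reg i) > 0 \<Longrightarrow> exec c s tr1 s' \<Longrightarrow> exec (While i c) s' tr2 t \<Longrightarrow>
    exec (While i c) s ((Test i, s) # tr1 @ tr2) t"
| WhileFalse: "s (Reg i) \<le> 0 \<Longrightarrow> exec (While i c) s [(Test i, s)] s"

lemma exec_deterministic:
  "exec c s tr t \<Longrightarrow> exec c s tr' t' \<Longrightarrow> tr' = tr \<and> t' = t"
proof (induction arbitrary: tr' t' rule: exec.induct)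
  case (Skip s)
  then show ?case by cases auto
next
  case (Do i s)
  then show ?case by cases auto
next
  case (Seq c1 s tr1 s' c2 tr2 t)
  note IH = Seq.IH
  from Seq.prems show ?case
  proof cases
    case (Seq tr1' s'' tr2')
    with IH(1) have "tr1' = tr1" "s'' = s'" by blast+
    with Seq IH(2) show ?thesis by blast
  qed
next
  case (CondTrue s i c1 tr t c2)
  note pos = CondTrue.hyps(1) and IH = CondTrue.IH
  from CondTrue.prems show ?case
  proof cases
    case (CondTrue tr'')
    with IH show ?thesis by blast
  next
    case (CondFalse tr'')
    with pos show ?thesis by simp
  qed
next
  case (CondFalse s i c2 tr t c1)
  note pos = CondFalse.hyps(1) and IH = CondFalse.IH
  from CondFalse.prems show ?case
  proof cases
    case (CondFalse tr'')
    with IH show ?thesis by blast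
  next
    case (CondTrue tr'')
    with pos show ?thesis by simp
  qed
next
  case (WhileTrue s i c tr1 s' tr2 t)
  note pos = WhileTrue.hyps(1) and IH = WhileTrue.IH
  from WhileTrue.prems show ?case
  proof cases
    case (WhileTrue tr1' s'' tr2')
    with IH(1) have "tr1' = tr1" "s'' = s'" by blast+
    with WhileTrue IH(2) show ?thesis by blast
  next
    case WhileFalse
    with pos show ?thesis by simp
  qed
next
  case (WhileFalse s i c)
  from WhileFalse.prems show ?case
    by cases (use WhileFalse.hyps in auto)
qed

definition initial_state :: "nat \<Rightarrow> state" where
  "initial_state N = (\<lambda>_. 0)(Reg 0 := int N)"


section \<open>Cost of a terminating run\<close>

text \<open>
  The following measures are attached to the run with trace \<open>tr\<close> and final state \<open>t\<close>.

  The operation count is the unit-cost one. It charges every executed instruction, hence not only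
  the additions, subtractions and multiplications (also those used for computing addresses and loop
  counters), but also constants, copies from and to memory, and tests.
\<close>

definition op_count :: "trace \<Rightarrow> nat" where
  "op_count tr = length tr"

fun instr_locs :: "instr \<Rightarrow> state \<Rightarrow> loc set" where
  "instr_locs (Const i c) s = {Reg i}"
| "instr_locs (Add i j k) s = {Reg i, Reg j, Reg k}"
| "instr_locs (Sub i j k) s = {Reg i, Reg j, Reg k}"
| "instr_locs (Mult i j k) s = {Reg i, Reg j, Reg k}"
| "instr_locs (Load i j) s = {Reg i, Reg j, Cell (s (Reg j))}"
| "instr_locs (Store i j) s = {Reg i, Reg j, Cell (s (Reg i))}"
| "instr_locs (Test i) s = {Reg i}"

definition used_locs :: "trace \<Rightarrow> loc set" where
  "used_locs tr = (\<Union>(i, s) \<in> set tr. instr_locs i s)"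

definition stored_integers :: "trace \<Rightarrow> nat" where
  "stored_integers tr = card (used_locs tr)"

definition visited_states :: "trace \<Rightarrow> state \<Rightarrow> state set" where
  "visited_states tr t = insert t (snd ` set tr)"

text \<open>The binary digits of the absolute value, and one bit for the sign.\<close>

definition bit_size :: "int \<Rightarrow> nat" where
  "bit_size x = Suc (floorlog 2 (nat \<bar>x\<bar>))"

text \<open>
  Operands, results and addresses of instructions are all contents of used locations.
\<close>

definition max_bit_size :: "trace \<Rightarrow> state \<Rightarrow> nat" where
  "max_bit_size tr t =
     Max ((\<lambda>(s, l). bit_size (s l)) ` (visited_states tr t \<times> used_locs tr))"

text \<open>The peak number of bits held by the locations that the run uses.\<close>

definition bit_storage :: "trace \<Rightarrow> state \<Rightarrow> nat" where
  "bit_storage tr t = Max ((\<lambda>s. \<Sum>l\<in>used_locs tr. bit_size (s l)) ` visited_states tr t)"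

text \<open>
  Bit complexity with respect to a cost function \<open>M\<close> for the multiplication of two \<open>b\<close>-bit integers.
  All other instructions cost as many bit operations as the integers that they read have bits.
\<close>

fun instr_bit_cost :: "(nat \<Rightarrow> real) \<Rightarrow> instr \<Rightarrow> state \<Rightarrow> real" where
  "instr_bit_cost M (Const i c) s = real (bit_size c)"
| "instr_bit_cost M (Add i j k) s = real (bit_size (s (Reg j)) + bit_size (s (Reg k)))"
| "instr_bit_cost M (Sub i j k) s = real (bit_size (s (Reg j)) + bit_size (s (Reg k)))"
| "instr_bit_cost M (Mult i j k) s = M (max (bit_size (s (Reg j))) (bit_size (s (Reg k))))"
| "instr_bit_cost M (Load i j) s =
     real (bit_size (s (Reg j)) + bit_size (s (Cell (s (Reg j)))))"
| "instr_bit_cost M (Store i j) s = real (bit_size (s (Reg i)) + bit_size (s (Reg j)))"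
| "instr_bit_cost M (Test i) s = real (bit_size (s (Reg i)))"

definition bit_complexity :: "(nat \<Rightarrow> real) \<Rightarrow> trace \<Rightarrow> real" where
  "bit_complexity M tr = (\<Sum>(i, s)\<leftarrow>tr. instr_bit_cost M i s)"

text \<open>
  The usual regularity conventions on \<open>M\<close>: it is monotone, at least linear (the operands have to be
  read), and a doubling of the length costs at most a constant factor, so that \<open>M(O(b)) = O(M(b))\<close>.
\<close>

definition multiplication_cost :: "(nat \<Rightarrow> real) \<Rightarrow> bool" where
  "multiplication_cost M \<longleftrightarrow>
     mono M \<and> (\<exists>c>0. \<forall>b. c * real b \<le> M b) \<and> (\<exists>K. \<forall>b. M (2 * b) \<le> K * M b)"

end

theory Submission
  imports Defs "HOL-Library.Sublist"
begin

text \<open>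
  Read a permutation from left to right and let \<open>g\<^sub>k\<close> be the smallest last entry of an increasing
  subsequence of length \<open>k\<close> of the part read so far (patience sorting). After an entry \<open>v > g\<^sub>d\<close>,
  avoiding \<open>\<beta>\<^sub>d\<close> means that all unread values in \<open>(g\<^sub>d, v)\<close> come before all unread values above \<open>v\<close>.
  The largest of these values, when it is read, imposes the same constraint on everything
  below it that is still above \<open>g\<^sub>d\<close>. Hence the constraint of \<open>v\<close> ends exactly when no unread value is
  left between the current \<open>g\<^sub>d\<close> and \<open>v\<close>, so the pending constraints form a stack, and only the
  numbers \<open>a\<^sub>1, \<dots>, a\<^sub>d, h\<close> of unread values in the gaps below \<open>g\<^sub>1, \<dots>, g\<^sub>d\<close> and below the innermost
  constraint matter. The number of ways to use up the \<open>h\<close> topmost values, starting with gaps \<open>a\<close> and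
  ending with gaps \<open>b\<close>, has \<open>2d + 1\<close> parameters and satisfies a recursion of convolution type: the
  first entry above \<open>g\<^sub>d\<close> splits \<open>h\<close>, and the intermediate gaps are summed over. These are \<open>d + 1\<close>
  summation indices, whence the exponents \<open>2d + 1\<close> and \<open>3d + 2\<close>.
\<close>

section \<open>Reading a permutation: the recursion\<close>

text \<open>\<open>paths\<close> describes a single level of the stack, so it is not compared with
  sets of words directly: the number of admissible continuations under several pending constraints
  is matched with \<open>stack_paths\<close>, because both obey the same recursion on the next
  entry. The reading starts with fictitious thresholds above all values, so that there are exactly
  \<open>d\<close> gaps at any time. For the machine, the gaps are digits in base
  \<open>N + 1\<close>, the first gap being the most significant one: then every step that
  contributes to the recursion lowers the number. The table covers all digit lists, also those of
  sum above \<open>N\<close>; for fixed \<open>d\<close> this costs a constant factor and makes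
  addresses arithmetical. Most entries of the table are not identified with cardinalities, so their
  size is bounded from the recursion itself, with weights that stand for the entries still to come.
  All cost claims reduce to one invariant: every executed instruction touches a fixed finite set of
  locations, and all integers in it stay below one bound.\<close>

definition bounded_lists :: "nat \<Rightarrow> nat \<Rightarrow> nat list set" where
  "bounded_lists d s = {b. length b = d \<and> sum_list b \<le> s}"

text \<open>
  Reading a value of gap \<open>i\<close> (counted from 0) with \<open>y\<close> unread values of that gap above it turns the
  value into the new threshold of gap \<open>i\<close>; the \<open>y\<close> values above it pass to the next gap.
\<close>

definition move :: "nat list \<Rightarrow> nat \<Rightarrow> nat \<Rightarrow> nat list" where
  "move xs i y = xs[i := xs ! i - Suc y, Suc i := xs ! Suc i + y]"

lemma finite_bounded_lists [simp]: "finite (bounded_lists d s)"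
proof (rule finite_subset)
  show "bounded_lists d s \<subseteq> {xs. set xs \<subseteq> {..s} \<and> length xs = d}"
    using member_le_sum_list by (fastforce simp: bounded_lists_def)
qed (simp add: finite_lists_length_eq)

lemma length_move [simp]: "length (move xs i y) = length xs"
  by (simp add: move_def)

lemma move_0: "move (x # z # xs) 0 y = (x - Suc y) # (z + y) # xs"
  by (simp add: move_def)

lemma move_Suc: "move (x # xs) (Suc i) y = x # move xs i y"
  by (simp add: move_def)

lemma sum_list_move:
  "Suc i < length xs \<Longrightarrow> y < xs ! i \<Longrightarrow> Suc (sum_list (move xs i y)) = sum_list xs"
proof (induction xs arbitrary: i)
  case (Cons x xs)
  then show ?case
    by (cases i; cases xs) (auto simp: move_0 move_Suc)
qed simp

lemma sum_list_butlast_last: "xs \<noteq> [] \<Longrightarrow> sum_list (butlast xs) + last xs = (sum_list xs :: nat)"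
  by (metis append_butlast_last_id sum_list.Nil sum_list.Cons sum_list_append add_0_right)

text \<open>
  \<open>paths (Some b) a h\<close> counts the ways to read on from gaps \<open>a\<close> with \<open>h\<close> unread values above them until
  those \<open>h\<close> values and all values that joined them are used up, leaving gaps \<open>b\<close>.
  \<open>paths None a h\<close> counts the ways to read everything.
\<close>

function paths :: "nat list option \<Rightarrow> nat list \<Rightarrow> nat \<Rightarrow> nat" where
  "paths t a h =
    (if h = 0 \<and> t \<noteq> None then (if t = Some a then 1 else 0)
     else (if h = 0 \<and> sum_list a = 0 then 1 else 0)
        + (\<Sum>i<length a. \<Sum>y<a ! i. paths t (butlast (move (a @ [h]) i y)) (last (move (a @ [h]) i y)))
        + (\<Sum>k<h. \<Sum>b\<in>bounded_lists (length a) (sum_list a).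
             paths (Some b) a k * paths t b (h - Suc k)))"
  by auto
termination
\<comment> \<open>A move uses up one value. In the convolution the first factor has
  \<open>k < h\<close>, and the second starts from gaps of no larger sum, which is what the range of
  \<open>b\<close> guarantees.\<close>
proof (relation "measure (\<lambda>(t, a, h). sum_list a + h)", goal_cases)
  case (2 t a h i y)
  have "move (a @ [h]) i y \<noteq> []"
    by (metis length_move length_0_conv snoc_eq_iff_butlast)
  moreover have "Suc (sum_list (move (a @ [h]) i y)) = sum_list (a @ [h])"
    using 2 by (intro sum_list_move) (auto simp: nth_append)
  ultimately show ?case
    by (simp add: sum_list_butlast_last)
qed (auto simp: bounded_lists_def)

declare paths.simps [simp del]

lemma paths_0_Some: "paths (Some b) a 0 = (if b = a then 1 else 0)"
  by (subst paths.simps) auto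

lemma sum_list_move_split:
  assumes "i < length a" "y < a ! i"
  shows "Suc (sum_list (butlast (move (a @ [h]) i y)) + last (move (a @ [h]) i y)) = sum_list a + h"
proof -
  have "move (a @ [h]) i y \<noteq> []"
    by (metis length_move length_0_conv snoc_eq_iff_butlast)
  moreover have "Suc (sum_list (move (a @ [h]) i y)) = sum_list (a @ [h])"
    using assms by (intro sum_list_move) (auto simp: nth_append)
  ultimately show ?thesis by (simp add: sum_list_butlast_last)
qed

lemma sum_list_butlast_move_le:
  assumes "i < length a" "y < a ! i"
  shows "sum_list (butlast (move (a @ [h]) i y)) \<le> sum_list a"
proof -
  have "h \<le> last (move (a @ [h]) i y)"
    using assms(1) by (auto simp: last_conv_nth move_def nth_append nth_list_update)
  with sum_list_move_split[OF assms, of h] show ?thesis by linarith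
qed

text \<open>Values pass only upwards through the gaps, so the gaps never gain in total: a target of
  another length or of larger sum cannot be reached. Hence ranges of summation over targets may be
  enlarged.\<close>

lemma paths_eq_0:
  "b \<notin> bounded_lists (length a) (sum_list a) \<Longrightarrow> paths (Some b) a h = 0"
proof (induction "sum_list a + h" arbitrary: a h rule: less_induct)
  case less
  show ?case
  proof (cases "h = 0")
    case True
    with less.prems show ?thesis by (auto simp: paths_0_Some bounded_lists_def)
  next
    case False
    have 1: "paths (Some b) (butlast (move (a @ [h]) i y)) (last (move (a @ [h]) i y)) = 0"
      if "i < length a" "y < a ! i" for i y
      using sum_list_move_split[OF that, of h] sum_list_butlast_move_le[OF that, of h] less.prems
      by (intro less.hyps) (auto simp: bounded_lists_def)
    have 2: "paths (Some b) c (h - Suc k) = 0"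
      if "k < h" "c \<in> bounded_lists (length a) (sum_list a)" for k c
      using that less.prems by (intro less.hyps) (auto simp: bounded_lists_def)
    show ?thesis using False 1 2 by (subst paths.simps) simp
  qed
qed

text \<open>With a range of summation that no longer depends on \<open>a\<close>, the sums over the
  targets of neighbouring levels can be interchanged.\<close>

lemma paths_eq:
  assumes "sum_list a \<le> s"
  shows "paths t a h =
    (if h = 0 \<and> t \<noteq> None then (if t = Some a then 1 else 0)
     else (if h = 0 \<and> sum_list a = 0 then 1 else 0)
        + (\<Sum>i<length a. \<Sum>y<a ! i. paths t (butlast (move (a @ [h]) i y)) (last (move (a @ [h]) i y)))
        + (\<Sum>k<h. \<Sum>b\<in>bounded_lists (length a) s. paths (Some b) a k * paths t b (h - Suc k)))"
proof -
  have "(\<Sum>b\<in>bounded_lists (length a) (sum_list a). paths (Some b) a k * paths t b (h - Suc k))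
      = (\<Sum>b\<in>bounded_lists (length a) s. paths (Some b) a k * paths t b (h - Suc k))" for k
    using assms by (intro sum.mono_neutral_left) (auto simp: paths_eq_0, auto simp: bounded_lists_def)
  then show ?thesis by (subst paths.simps) (simp only:)
qed

text \<open>The list collects the numbers of unread values between consecutive pending constraints.\<close>

fun stack_paths :: "nat \<Rightarrow> nat list \<Rightarrow> nat list \<Rightarrow> nat" where
  "stack_paths s a [] = 0"
| "stack_paths s a [h] = paths None a h"
| "stack_paths s a (h # h' # hs) =
     (\<Sum>b\<in>bounded_lists (length a) s. paths (Some b) a h * stack_paths s b (h' # hs))"

lemma stack_paths_pop:
  assumes "sum_list a \<le> s" "hs \<noteq> []"
  shows "stack_paths s a (0 # hs) = stack_paths s a hs"
proof -
  obtain h' hs' where hs: "hs = h' # hs'" using assms(2) by (cases hs) auto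
  have a: "a \<in> bounded_lists (length a) s"
    using assms by (simp add: bounded_lists_def)
  have "(\<Sum>b\<in>bounded_lists (length a) s. paths (Some b) a 0 * stack_paths s b (h' # hs'))
      = (\<Sum>b\<in>bounded_lists (length a) s. if b = a then stack_paths s b (h' # hs') else 0)"
    by (rule sum.cong) (auto simp: paths_0_Some)
  also have "\<dots> = stack_paths s a (h' # hs')"
    using a by simp
  finally show ?thesis by (simp add: hs)
qed

text \<open>Multiplying the recursion of the top level by the rest of the stack and interchanging
  sums leaves a recursion on the next entry alone; the product in the convolution becomes a stack
  with one more level. The second assumption excludes an exhausted top level above others, which is
  popped instead.\<close>

lemma stack_paths_step:
  assumes "sum_list a \<le> s" "h > 0 \<or> hs = []"
  shows "stack_paths s a (h # hs) = (if h = 0 \<and> sum_list a = 0 then 1 else 0)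
     + (\<Sum>i<length a. \<Sum>y<a ! i. stack_paths s (butlast (move (a @ [h]) i y)) (last (move (a @ [h]) i y) # hs))
     + (\<Sum>k<h. stack_paths s a (k # (h - Suc k) # hs))"
proof (cases hs)
  case Nil
  then show ?thesis using assms by (simp add: paths_eq[of a s None h])
next
  case (Cons h' hs')
  let ?S = "bounded_lists (length a) s" and ?K = "\<lambda>b. stack_paths s b (h' # hs')"
  have h: "h > 0" using assms Cons by simp
  have len: "length b = length a" if "b \<in> ?S" for b
    using that by (simp add: bounded_lists_def)
  have "stack_paths s a (h # hs) =
     (\<Sum>b\<in>?S. (\<Sum>i<length a. \<Sum>y<a ! i. paths (Some b) (butlast (move (a @ [h]) i y)) (last (move (a @ [h]) i y)) * ?K b))
     + (\<Sum>b\<in>?S. (\<Sum>k<h. \<Sum>c\<in>?S. paths (Some c) a k * paths (Some b) c (h - Suc k) * ?K b))"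
    using h by (simp add: Cons paths_eq[OF assms(1), of "Some _"] distrib_right sum.distrib sum_distrib_right)
  also have "(\<Sum>b\<in>?S. (\<Sum>i<length a. \<Sum>y<a ! i. paths (Some b) (butlast (move (a @ [h]) i y)) (last (move (a @ [h]) i y)) * ?K b))
    = (\<Sum>i<length a. \<Sum>b\<in>?S. \<Sum>y<a ! i. paths (Some b) (butlast (move (a @ [h]) i y)) (last (move (a @ [h]) i y)) * ?K b)"
    by (rule sum.swap)
  also have "\<dots> = (\<Sum>i<length a. \<Sum>y<a ! i. \<Sum>b\<in>?S. paths (Some b) (butlast (move (a @ [h]) i y)) (last (move (a @ [h]) i y)) * ?K b)"
    by (intro sum.cong refl sum.swap)
  also have "\<dots> = (\<Sum>i<length a. \<Sum>y<a ! i. stack_paths s (butlast (move (a @ [h]) i y)) (last (move (a @ [h]) i y) # hs))"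
    by (simp add: Cons)
  also have "(\<Sum>b\<in>?S. (\<Sum>k<h. \<Sum>c\<in>?S. paths (Some c) a k * paths (Some b) c (h - Suc k) * ?K b))
     = (\<Sum>k<h. \<Sum>b\<in>?S. \<Sum>c\<in>?S. paths (Some c) a k * paths (Some b) c (h - Suc k) * ?K b)"
    by (rule sum.swap)
  also have "\<dots> = (\<Sum>k<h. \<Sum>c\<in>?S. \<Sum>b\<in>?S. paths (Some c) a k * paths (Some b) c (h - Suc k) * ?K b)"
    by (intro sum.cong refl sum.swap)
  also have "\<dots> = (\<Sum>k<h. stack_paths s a (k # (h - Suc k) # hs))"
    by (simp add: Cons sum_distrib_left mult.assoc len)
  finally show ?thesis using h by simp
qed

subsection \<open>Profiles of sets of unread values\<close>

text \<open>In the application the cut points are the thresholds followed by the pending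
  constraints, in increasing order; the counts are then the gaps \<open>a\<close>, the top level
  \<open>h\<close> and the lower levels of the stack.\<close>

fun profile :: "nat list \<Rightarrow> nat set \<Rightarrow> nat list" where
  "profile [] U = [card U]"
| "profile (c # cs) U = card {u \<in> U. u < c} # profile cs {u \<in> U. c < u}"

text \<open>Effect of reading \<open>v\<close> on the cut points: it replaces the smallest threshold
  above it or, if it lies above all thresholds, becomes the innermost constraint.\<close>

fun cut :: "nat \<Rightarrow> nat list \<Rightarrow> nat list \<Rightarrow> nat list" where
  "cut v [] ms = v # ms"
| "cut v (g # gs) ms = (if v < g then v # gs @ ms else g # cut v gs ms)"

lemma length_profile [simp]: "length (profile cs U) = Suc (length cs)"
  by (induction cs arbitrary: U) auto

lemma sum_profile: "finite U \<Longrightarrow> set cs \<inter> U = {} \<Longrightarrow> sum_list (profile cs U) = card U"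
proof (induction cs arbitrary: U)
  case (Cons c cs)
  have "sum_list (profile cs {u \<in> U. c < u}) = card {u \<in> U. c < u}"
    using Cons.prems by (intro Cons.IH) auto
  moreover have "card {u \<in> U. u < c} + card {u \<in> U. c < u} = card ({u \<in> U. u < c} \<union> {u \<in> U. c < u})"
    using Cons.prems by (subst card_Un_disjoint) auto
  moreover have "{u \<in> U. u < c} \<union> {u \<in> U. c < u} = U"
    using Cons.prems by auto
  ultimately show ?case by simp
qed simp

text \<open>The pair (number of smaller elements, number of larger elements) takes each value
  \<open>(k, card S - Suc k)\<close> once. The induction splits off the maximum, which counts only
  in the second component of the other elements.\<close>

lemma sum_rank:
  fixes S :: "nat set" and f :: "nat \<Rightarrow> nat \<Rightarrow> nat"
  assumes "finite S"
  shows "(\<Sum>v\<in>S. f (card {u \<in> S. u < v}) (card {u \<in> S. v < u})) = (\<Sum>k<card S. f k (card S - Suc k))"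
  using assms
proof (induction "card S" arbitrary: S f)
  case (Suc n)
  define m where "m = Max S"
  have m: "m \<in> S" "\<And>u. u \<in> S \<Longrightarrow> u \<le> m"
    using Suc by (auto simp: m_def simp del: Max_less_iff intro!: Max_in)
  define T where "T = S - {m}"
  have T: "card T = n" "finite T" "S = insert m T" "m \<notin> T"
    using Suc m by (auto simp: T_def)
  have lt: "u < m" if "u \<in> T" for u
    using m(2)[of u] that T by (auto simp: nat_less_le)
  have e1: "{u \<in> S. u < m} = T" using lt T by auto
  have e2: "{u \<in> S. m < u} = {}" using m by (auto simp: leD)
  have e3: "{u \<in> S. u < v} = {u \<in> T. u < v}" if "v \<in> T" for v
    using lt[OF that] T by auto
  have e4: "card {u \<in> S. v < u} = Suc (card {u \<in> T. v < u})" if "v \<in> T" for v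
  proof -
    have "{u \<in> S. v < u} = insert m {u \<in> T. v < u}" using lt[OF that] T by auto
    then show ?thesis using T by simp
  qed
  have "(\<Sum>v\<in>S. f (card {u \<in> S. u < v}) (card {u \<in> S. v < u}))
      = f n 0 + (\<Sum>v\<in>T. f (card {u \<in> T. u < v}) (Suc (card {u \<in> T. v < u})))"
  proof -
    have "(\<Sum>v\<in>S. g v) = g m + (\<Sum>v\<in>T. g v)" for g :: "nat \<Rightarrow> nat"
      using T by simp
    then show ?thesis using T(1) by (simp only: e1 e2 card.empty) (simp add: e3 e4)
  qed
  also have "(\<Sum>v\<in>T. f (card {u \<in> T. u < v}) (Suc (card {u \<in> T. v < u})))
      = (\<Sum>k<n. f k (Suc (n - Suc k)))"
    using Suc(1)[of T "\<lambda>x y. f x (Suc y)"] T by simp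
  also have "f n 0 + \<dots> = (\<Sum>k<card S. f k (card S - Suc k))"
    using Suc(2)[symmetric] by (simp add: Suc_diff_Suc)
  finally show ?case .
qed simp

text \<open>The values between a newly read one and the threshold that it replaces pass to the next
  gap; seen from there, they lie below all remaining cut points.\<close>

lemma profile_Un:
  assumes "finite A" "finite B" "A \<inter> B = {}" "\<And>b c. b \<in> B \<Longrightarrow> c \<in> set cs \<Longrightarrow> b < c"
  shows "profile cs (A \<union> B) = (hd (profile cs A) + card B) # tl (profile cs A)"
proof (cases cs)
  case Nil
  then show ?thesis using assms by (simp add: card_Un_disjoint)
next
  case (Cons c cs')
  have "{u \<in> A \<union> B. u < c} = {u \<in> A. u < c} \<union> B" "{u \<in> A \<union> B. c < u} = {u \<in> A. c < u}"
    using assms(4)[of _ c] Cons by (auto dest: order.asym)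
  moreover have "card ({u \<in> A. u < c} \<union> B) = card {u \<in> A. u < c} + card B"
    using assms by (intro card_Un_disjoint) auto
  ultimately show ?thesis using Cons by simp
qed

lemma sum_profile_cut_Nil:
  fixes F :: "nat list \<Rightarrow> nat"
  assumes "finite U" "sorted_wrt (<) ms" "set ms \<inter> U = {}" "profile ms U = h # hs"
  shows "(\<Sum>v | v \<in> U \<and> (\<forall>m\<in>set ms. v < m). F (profile (v # ms) (U - {v})))
      = (\<Sum>k<h. F (k # (h - Suc k) # hs))"
proof -
  define S where "S = {v \<in> U. \<forall>m\<in>set ms. v < m}"
  have S: "finite S" using assms by (simp add: S_def)
  have h: "h = card S"
    using assms(2,4) by (cases ms) (auto simp: S_def intro!: arg_cong[of _ _ card])
  have "profile (v # ms) (U - {v}) = card {u \<in> S. u < v} # card {u \<in> S. v < u} # hs" if "v \<in> S" for v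
  proof -
    have 1: "{u \<in> U - {v}. u < v} = {u \<in> S. u < v}" using that by (auto simp: S_def)
    have 2: "profile ms {u \<in> U - {v}. v < u} = card {u \<in> S. v < u} # hs"
    proof (cases ms)
      case Nil
      with assms(4) that show ?thesis by (auto simp: S_def intro!: arg_cong[of _ _ card])
    next
      case (Cons m ms')
      have "{u \<in> U. u \<noteq> v \<and> v < u \<and> m < u} = {u \<in> U. m < u}"
        using that Cons by (auto simp: S_def)
      moreover have "{u \<in> U. u \<noteq> v \<and> v < u \<and> u < m} = {u \<in> S. v < u}"
        using assms(2) Cons by (auto simp: S_def)
      ultimately show ?thesis using Cons assms(4) by simp
    qed
    show ?thesis using 1 2 by simp
  qed
  then show ?thesis
    using sum_rank[OF S, of "\<lambda>x y. F (x # y # hs)"] by (simp add: h S_def)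
qed

text \<open>Sorting the admissible values by the gap that contains them turns the sum over values
  into the index sums of the recursion: below a threshold the profile undergoes a
  \<open>move\<close>, above all thresholds the level \<open>h\<close> is split. The induction peels
  off the lowest threshold.\<close>

lemma sum_profile_cut:
  fixes F :: "nat list \<Rightarrow> nat"
  assumes "finite U" "sorted_wrt (<) (gs @ ms)" "set (gs @ ms) \<inter> U = {}"
     "profile (gs @ ms) U = a @ h # hs" "length a = length gs"
  shows "(\<Sum>v | v \<in> U \<and> (\<forall>m\<in>set ms. v < m). F (profile (cut v gs ms) (U - {v})))
      = (\<Sum>i<length a. \<Sum>y<a ! i. F (move (a @ h # hs) i y)) + (\<Sum>k<h. F (a @ k # (h - Suc k) # hs))"
  using assms
proof (induction gs arbitrary: a U F)
  case Nil
  then show ?case using sum_profile_cut_Nil[of U ms h hs F] by simp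
next
  case (Cons g gs)
  then obtain x a' where a: "a = x # a'" by (cases a) auto
  define L where "L = {u \<in> U. u < g}"
  define H where "H = {u \<in> U. g < u}"
  have x: "x = card L" and prof: "profile (gs @ ms) H = a' @ h # hs"
    using Cons.prems by (auto simp: a L_def H_def)
  have fin: "finite L" "finite H" using Cons.prems by (auto simp: L_def H_def)
  obtain z zs where z: "a' @ h # hs = z # zs" by (cases "a' @ h # hs") auto
  have split: "{v \<in> U. \<forall>m\<in>set ms. v < m} = L \<union> {v \<in> H. \<forall>m\<in>set ms. v < m}"
  proof -
    have "g < m" if "m \<in> set ms" for m using Cons.prems(2) that by simp
    moreover have "u < g \<or> g < u" if "u \<in> U" for u
      using Cons.prems(3) that by (cases u g rule: linorder_cases) auto
    ultimately show ?thesis unfolding L_def H_def by (blast intro: less_trans)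
  qed
  have "(\<Sum>v | v \<in> U \<and> (\<forall>m\<in>set ms. v < m). F (profile (cut v (g # gs) ms) (U - {v})))
     = (\<Sum>v\<in>L. F (profile (cut v (g # gs) ms) (U - {v})))
     + (\<Sum>v | v \<in> H \<and> (\<forall>m\<in>set ms. v < m). F (profile (cut v (g # gs) ms) (U - {v})))"
    unfolding split using fin Cons.prems(1) by (subst sum.union_disjoint) (auto simp: L_def H_def)
  also have "(\<Sum>v\<in>L. F (profile (cut v (g # gs) ms) (U - {v})))
     = (\<Sum>v\<in>L. (\<lambda>p q. F (p # (z + q) # zs)) (card {u \<in> L. u < v}) (card {u \<in> L. v < u}))"
  proof (intro sum.cong refl)
    fix v assume v: "v \<in> L"
    have "{u \<in> U - {v}. v < u} = H \<union> {u \<in> L. v < u}"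
    proof -
      have "u < g \<or> g < u" if "u \<in> U" for u
        using Cons.prems(3) that by (cases u g rule: linorder_cases) auto
      moreover have "v < g" using v by (simp add: L_def)
      ultimately show ?thesis
        unfolding L_def H_def by (auto intro: less_trans)
    qed
    moreover have "profile (gs @ ms) (H \<union> {u \<in> L. v < u})
       = (hd (profile (gs @ ms) H) + card {u \<in> L. v < u}) # tl (profile (gs @ ms) H)"
    proof (intro profile_Un)
      fix b c assume b: "b \<in> {u \<in> L. v < u}" and "c \<in> set (gs @ ms)"
      then have "g < c" using Cons.prems(2) by simp
      with b show "b < c" by (simp add: L_def)
    qed (use fin in \<open>auto simp: L_def H_def\<close>)
    moreover have "{u \<in> U - {v}. u < v} = {u \<in> L. u < v}"
      using v by (auto simp: L_def)
    ultimately show "F (profile (cut v (g # gs) ms) (U - {v})) = (\<lambda>p q. F (p # (z + q) # zs)) (card {u \<in> L. u < v}) (card {u \<in> L. v < u})"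
      using v by (simp add: L_def[symmetric] prof z) (simp add: L_def)
  qed
  also have "\<dots> = (\<Sum>k<x. F (k # (z + (x - Suc k)) # zs))"
    using sum_rank[OF fin(1), of "\<lambda>p q. F (p # (z + q) # zs)"] by (simp add: x)
  \<comment> \<open>The sum over the number of smaller values is reversed, since \<open>move\<close>
    is parametrised by the number \<open>y\<close> of larger ones.\<close>
  also have "\<dots> = (\<Sum>y<x. F (move (a @ h # hs) 0 y))"
    by (subst sum.nat_diff_reindex[symmetric]) (simp add: a z move_0)
  also have "(\<Sum>v | v \<in> H \<and> (\<forall>m\<in>set ms. v < m). F (profile (cut v (g # gs) ms) (U - {v})))
     = (\<Sum>v | v \<in> H \<and> (\<forall>m\<in>set ms. v < m). F (x # profile (cut v gs ms) (H - {v})))"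
  proof (intro sum.cong refl)
    fix v assume v: "v \<in> {v. v \<in> H \<and> (\<forall>m\<in>set ms. v < m)}"
    have "{u \<in> U - {v}. u < g} = L" "{u \<in> U - {v}. g < u} = H - {v}"
      using v by (auto simp: L_def H_def)
    then show "F (profile (cut v (g # gs) ms) (U - {v})) = F (x # profile (cut v gs ms) (H - {v}))"
      using v by (auto simp: H_def x)
  qed
  also have "\<dots> = (\<Sum>i<length a'. \<Sum>y<a' ! i. F (x # move (a' @ h # hs) i y))
       + (\<Sum>k<h. F (x # a' @ k # (h - Suc k) # hs))"
    using Cons.prems fin prof a by (intro Cons.IH) (auto simp: H_def)
  also have "(\<Sum>y<x. F (move (a @ h # hs) 0 y)) + \<dots> =
     (\<Sum>i<length a. \<Sum>y<a ! i. F (move (a @ h # hs) i y)) + (\<Sum>k<h. F (a @ k # (h - Suc k) # hs))"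
    unfolding a by (simp add: sum.lessThan_Suc_shift move_Suc del: sum.lessThan_Suc)
  finally show ?case .
qed

section \<open>From pattern avoidance to the recursion\<close>

definition hi :: "nat list \<Rightarrow> nat \<Rightarrow> bool" where
  "hi gs a \<longleftrightarrow> (\<forall>g\<in>set gs. g < a)"

text \<open>The patience sorting step, truncated: no pile is opened to the right of the existing ones.\<close>

fun ins :: "nat \<Rightarrow> nat list \<Rightarrow> nat list" where
  "ins v [] = []"
| "ins v (g # gs) = (if v < g then v # gs else g # ins v gs)"

text \<open>With \<open>m\<close> in the role of \<open>d + 2\<close>, the entries \<open>c\<close>
  and \<open>a\<close> complete an occurrence of the pattern as \<open>d + 3\<close> and
  \<open>d + 1\<close>; \<open>Q a\<close> stands for an increasing sequence of length
  \<open>d\<close> below \<open>a\<close> that precedes \<open>m\<close>.\<close>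

fun straddle :: "(nat \<Rightarrow> bool) \<Rightarrow> nat \<Rightarrow> nat list \<Rightarrow> bool" where
  "straddle Q m [] \<longleftrightarrow> False"
| "straddle Q m (c # w) \<longleftrightarrow> (m < c \<and> (\<exists>a\<in>set w. Q a \<and> a < m)) \<or> straddle Q m w"

text \<open>
  \<open>good\<close> imposes the constraint of \<open>v\<close> on the values above the thresholds at the time when \<open>v\<close> is read;
  \<open>capped\<close> is the variant with the current thresholds, which only depends on the state of the reading.
\<close>

fun good :: "nat list \<Rightarrow> nat list \<Rightarrow> bool" where
  "good gs [] \<longleftrightarrow> True"
| "good gs (v # w) \<longleftrightarrow> \<not> straddle (hi gs) v w \<and> good (ins v gs) w"

fun capped :: "nat list \<Rightarrow> nat \<Rightarrow> nat list \<Rightarrow> bool" where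
  "capped gs m [] \<longleftrightarrow> True"
| "capped gs m (v # w) \<longleftrightarrow>
     ((\<exists>u\<in>set (v # w). hi gs u \<and> u < m) \<longrightarrow> v < m \<and> capped (ins v gs) m w)"

text \<open>The cap of \<open>v\<close> starts from \<open>ins v gs\<close>, the thresholds after
  \<open>v\<close> has been read; if \<open>v\<close> has become a threshold itself, its cap is
  void.\<close>

fun good_capped :: "nat list \<Rightarrow> nat list \<Rightarrow> bool" where
  "good_capped gs [] \<longleftrightarrow> True"
| "good_capped gs (v # w) \<longleftrightarrow> capped (ins v gs) v w \<and> good_capped (ins v gs) w"

lemma ins_hi: "hi gs v \<Longrightarrow> ins v gs = gs"
  by (induction gs) (auto simp: hi_def)

lemma hi_ins: "hi gs a \<Longrightarrow> hi (ins v gs) a"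
  by (induction gs) (auto simp: hi_def split: if_splits)

lemma hi_mono: "hi gs a \<Longrightarrow> a \<le> b \<Longrightarrow> hi gs b"
  by (auto simp: hi_def)

lemma ins_not_hi: "sorted_wrt (<) gs \<Longrightarrow> v \<notin> set gs \<Longrightarrow> \<not> hi gs v \<Longrightarrow> v \<in> set (ins v gs)"
  by (induction gs) (auto simp: hi_def)

lemma length_ins [simp]: "length (ins v gs) = length gs"
  by (induction gs) auto

lemma set_ins: "set (ins v gs) \<subseteq> insert v (set gs)"
  by (induction gs) auto

lemma sorted_ins: "sorted_wrt (<) gs \<Longrightarrow> v \<notin> set gs \<Longrightarrow> sorted_wrt (<) (ins v gs)"
proof (induction gs)
  case (Cons g gs)
  then show ?case using set_ins[of v gs] by (auto dest: less_trans)
qed simp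

lemma straddleI_set: "straddle Q m w \<Longrightarrow> \<exists>a\<in>set w. Q a \<and> a < m"
  by (induction w) auto

lemma straddle_shift:
  "straddle Q m w \<Longrightarrow> (\<And>c. c \<in> set w \<Longrightarrow> m < c \<Longrightarrow> v < c) \<Longrightarrow> (\<And>a. a \<in> set w \<Longrightarrow> a < m \<Longrightarrow> a < v)
   \<Longrightarrow> straddle Q v w"
  by (induction w) auto

lemma capped_trivial: "\<not> (\<exists>u\<in>set w. hi gs u \<and> u < m) \<Longrightarrow> capped gs m w"
  by (cases w) auto

text \<open>
  As long as a value of \<open>Q\<close> below \<open>m\<close> is unread, both sides forbid values above \<open>m\<close>. When the last of
  them is read, its own constraint takes over, with \<open>hi gs\<close> in place of \<open>Q\<close>.
\<close>

lemma not_straddle_iff_capped: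
  assumes "\<And>a b. Q a \<Longrightarrow> a \<le> b \<Longrightarrow> Q b" "\<And>a. Q a \<Longrightarrow> hi gs a"
    "good gs w" "distinct w" "m \<notin> set w"
    "(\<exists>u\<in>set w. hi gs u \<and> u < m) \<Longrightarrow> \<exists>u\<in>set w. Q u \<and> u < m"
  shows "\<not> straddle Q m w \<longleftrightarrow> capped gs m w"
  using assms
proof (induction w arbitrary: gs Q)
  case (Cons v w)
  show ?case
  proof (cases "\<exists>u\<in>set (v # w). hi gs u \<and> u < m")
    case False
    then have "\<not> straddle Q m (v # w)"
      using Cons.prems(2) straddleI_set[of Q m "v # w"] by blast
    with capped_trivial[OF False] show ?thesis by simp
  next
    case True
    have iff: "capped gs m (v # w) \<longleftrightarrow> v < m \<and> capped (ins v gs) m w"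
      using True by auto
    obtain u where u: "u \<in> set (v # w)" "Q u" "u < m"
      using Cons.prems(6)[OF True] by blast
    show ?thesis
    proof (cases "v < m")
      case False
      with Cons.prems(5) have "m < v" by auto
      with u have "straddle Q m (v # w)" by auto
      with False show ?thesis by (simp only: iff) simp
    next
      case vm: True
      then have iff': "straddle Q m (v # w) \<longleftrightarrow> straddle Q m w"
        by auto
      show ?thesis
      \<comment> \<open>Either the last assumption survives the reading of \<open>v\<close>, so that
        the induction hypothesis applies with the same \<open>Q\<close>, or \<open>v\<close> was the
        last unread \<open>Q\<close>-value below \<open>m\<close>.\<close>
      proof (cases "(\<exists>u\<in>set w. hi (ins v gs) u \<and> u < m) \<longrightarrow> (\<exists>u\<in>set w. Q u \<and> u < m)")
        case True
        have "\<not> straddle Q m w \<longleftrightarrow> capped (ins v gs) m w"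
          using Cons.prems True by (intro Cons.IH) (blast intro: hi_ins | simp)+
        then show ?thesis using vm by (simp only: iff iff' simp_thms)
      next
        case False
        then have noQ: "\<not> (\<exists>u\<in>set w. Q u \<and> u < m)" by blast
        with u have Qv: "Q v" by auto
        then have hv: "hi gs v" using Cons.prems(2) by blast
        have "\<not> straddle (hi gs) v w" using Cons.prems(3) by simp
        \<comment> \<open>\<open>Q\<close> is closed upwards, so no unread value is left between
          \<open>v\<close> and \<open>m\<close>; a straddle of \<open>m\<close> would therefore be
          one of \<open>v\<close> as well.\<close>
        have beyond: "\<not> (v \<le> c \<and> c < m)" if "c \<in> set w" for c
          using noQ that Cons.prems(1)[OF Qv] by blast
        have "straddle (hi gs) v w" if "straddle (hi gs) m w"
          using that
        proof (rule straddle_shift)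
          show "c \<in> set w \<Longrightarrow> m < c \<Longrightarrow> v < c" for c using vm by simp
          show "a \<in> set w \<Longrightarrow> a < m \<Longrightarrow> a < v" for a using beyond[of a] by auto
        qed
        with \<open>\<not> straddle (hi gs) v w\<close> have "\<not> straddle (hi gs) m w" by blast
        moreover have "\<not> straddle (hi gs) m w \<longleftrightarrow> capped gs m w"
          using Cons.prems(3-5) by (intro Cons.IH) (auto simp: ins_hi[OF hv] intro: hi_mono)
        moreover have "\<not> straddle Q m w" using noQ straddleI_set by blast
        ultimately show ?thesis using vm by (simp only: iff iff' ins_hi[OF hv] simp_thms)
      qed
    qed
  qed
qed simp

text \<open>For \<open>v\<close> above all thresholds the previous lemma applies with
  \<open>hi gs\<close> as \<open>Q\<close>. Otherwise both conditions are vacuous: whatever lies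
  above the old thresholds exceeds \<open>v\<close>, and \<open>v\<close> is one of the new
  thresholds.\<close>

lemma good_iff_good_capped:
  assumes "sorted_wrt (<) gs" "distinct w" "set gs \<inter> set w = {}"
  shows "good gs w \<longleftrightarrow> good_capped gs w"
  using assms
proof (induction w arbitrary: gs)
  case (Cons v w)
  have IH: "good (ins v gs) w \<longleftrightarrow> good_capped (ins v gs) w"
    using Cons.prems set_ins[of v gs] by (intro Cons.IH sorted_ins) auto
  have "\<not> straddle (hi gs) v w \<longleftrightarrow> capped (ins v gs) v w" if "good (ins v gs) w"
  proof (cases "hi gs v")
    case True
    then show ?thesis using that Cons.prems
      by (intro not_straddle_iff_capped) (auto simp: ins_hi intro: hi_mono)
  next
    case False
    have "\<not> straddle (hi gs) v w"
      using straddleI_set[of "hi gs" v w] False hi_mono[of gs _ v] by (meson less_imp_le)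
    moreover have "capped (ins v gs) v w"
    proof (rule capped_trivial)
      have "v \<in> set (ins v gs)" using ins_not_hi[of gs v] Cons.prems False by simp
      then have "v < u" if "hi (ins v gs) u" for u using that by (simp add: hi_def)
      then show "\<not> (\<exists>u\<in>set w. hi (ins v gs) u \<and> u < v)" using less_asym by blast
    qed
    ultimately show ?thesis by simp
  qed
  with IH show ?case by auto
qed simp

subsection \<open>Counting the good words\<close>

definition good_words :: "nat list \<Rightarrow> nat list \<Rightarrow> nat set \<Rightarrow> nat list set" where
  "good_words gs ms U = {w \<in> permutations_of_set U. good_capped gs w \<and> (\<forall>m\<in>set ms. capped gs m w)}"

lemma good_words_drop:
  "\<not> (\<exists>u\<in>U. hi gs u \<and> u < m) \<Longrightarrow> good_words gs (m # ms) U = good_words gs ms U"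
  by (auto simp: good_words_def permutations_of_set_def intro!: capped_trivial)

text \<open>As long as every constraint is active, \<open>capped\<close> forces the first entry
  below all of them, and this entry joins the constraints. An exhausted constraint would say nothing
  about the first entry, hence the third assumption.\<close>

lemma card_good_words_step:
  assumes "finite U" "U \<noteq> {}" "\<And>m. m \<in> set ms \<Longrightarrow> \<exists>u\<in>U. hi gs u \<and> u < m"
  shows "card (good_words gs ms U) =
     (\<Sum>v | v \<in> U \<and> (\<forall>m\<in>set ms. v < m). card (good_words (ins v gs) (v # ms) (U - {v})))"
proof -
  let ?V = "{v \<in> U. \<forall>m\<in>set ms. v < m}"
  have "good_words gs ms U = (\<Union>v\<in>?V. (#) v ` good_words (ins v gs) (v # ms) (U - {v}))"
  proof (intro set_eqI)
    fix w
    show "w \<in> good_words gs ms U \<longleftrightarrow> w \<in> (\<Union>v\<in>?V. (#) v ` good_words (ins v gs) (v # ms) (U - {v}))"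
    proof (cases w)
      case Nil
      with assms(2) show ?thesis by (auto simp: good_words_def permutations_of_set_def)
    next
      case (Cons v w')
      have perm: "v # w' \<in> permutations_of_set U \<longleftrightarrow> v \<in> U \<and> w' \<in> permutations_of_set (U - {v})"
        by (auto simp: permutations_of_set_def)
      have cap: "capped gs m (v # w') \<longleftrightarrow> v < m \<and> capped (ins v gs) m w'"
        if "m \<in> set ms" "set (v # w') = U" for m
        using assms(3)[OF that(1)] by (simp add: that(2)[symmetric])
      have "v # w' \<in> good_words gs ms U \<longleftrightarrow>
          v \<in> ?V \<and> w' \<in> good_words (ins v gs) (v # ms) (U - {v})"
      proof (cases "v # w' \<in> permutations_of_set U")
        case True
        then have "set (v # w') = U" by (simp add: permutations_of_set_def)
        then show ?thesis
          using cap True unfolding good_words_def mem_Collect_eq perm by auto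
      next
        case False
        then show ?thesis unfolding good_words_def mem_Collect_eq perm by blast
      qed
      then show ?thesis using Cons by auto
    qed
  qed
  also have "card \<dots> = (\<Sum>v\<in>?V. card ((#) v ` good_words (ins v gs) (v # ms) (U - {v})))"
    using assms(1) by (intro card_UN_disjoint) (auto simp: good_words_def)
  also have "\<dots> = (\<Sum>v\<in>?V. card (good_words (ins v gs) (v # ms) (U - {v})))"
    by (intro sum.cong refl card_image) auto
  finally show ?thesis .
qed

lemma profile_append_nth:
  assumes "length gs = d"
  shows "profile (gs @ ms) U ! d = card {u \<in> U. hi gs u \<and> (ms \<noteq> [] \<longrightarrow> u < hd ms)}"
  using assms
proof (induction gs arbitrary: U d)
  case Nil
  then show ?case by (cases ms) (auto simp: hi_def)
next
  case (Cons g gs)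
  then show ?case
    by (auto simp: hi_def intro!: arg_cong[of _ _ card])
qed

text \<open>An exhausted innermost constraint shows as a level 0 on top of the stack, and deleting
  it deletes just this 0; \<open>stack_paths_pop\<close> is the counterpart for the numbers.\<close>

lemma profile_drop:
  assumes "\<not> (\<exists>u\<in>U. hi gs u \<and> u < m)" "set (gs @ m # ms) \<inter> U = {}" "finite U"
    "sorted_wrt (<) (gs @ m # ms)"
  shows "\<exists>a hs. length a = length gs \<and> profile (gs @ m # ms) U = a @ 0 # hs \<and> profile (gs @ ms) U = a @ hs"
  using assms
proof (induction gs arbitrary: U)
  case Nil
  then have "m < u" if "u \<in> U" for u
    using that by (cases u m rule: linorder_cases) (auto simp: hi_def)
  then have "{u \<in> U. m < u} = U" "{u \<in> U. u < m} = {}"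
    using less_asym by blast+
  then show ?case by simp
next
  case (Cons g gs)
  have "\<exists>a hs. length a = length gs \<and> profile (gs @ m # ms) {u \<in> U. g < u} = a @ 0 # hs
      \<and> profile (gs @ ms) {u \<in> U. g < u} = a @ hs"
    using Cons.prems by (intro Cons.IH) (auto simp: hi_def)
  then obtain a hs where "length a = length gs" "profile (gs @ m # ms) {u \<in> U. g < u} = a @ 0 # hs"
      "profile (gs @ ms) {u \<in> U. g < u} = a @ hs" by blast
  then show ?case
    by (intro exI[of _ "card {u \<in> U. u < g} # a"] exI[of _ hs]) simp
qed

lemma cut_hi: "hi gs v \<Longrightarrow> cut v gs ms = gs @ v # ms"
  by (induction gs) (auto simp: hi_def)

lemma cut_not_hi: "\<not> hi gs v \<Longrightarrow> v \<notin> set gs \<Longrightarrow> cut v gs ms = ins v gs @ ms"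
  by (induction gs) (auto simp: hi_def)

lemma set_cut: "set (cut v gs ms) \<subseteq> insert v (set gs \<union> set ms)"
  by (induction gs) auto

lemma sorted_cut:
  "sorted_wrt (<) (gs @ ms) \<Longrightarrow> v \<notin> set gs \<Longrightarrow> \<forall>m\<in>set ms. v < m \<Longrightarrow> sorted_wrt (<) (cut v gs ms)"
proof (induction gs)
  case (Cons g gs)
  then show ?case using set_cut[of v gs ms] by (auto dest: less_trans)
qed simp

lemma profile_eq_replicate: "profile cs {} = replicate (Suc (length cs)) 0"
  by (induction cs) auto

lemma stack_paths_replicate: "stack_paths s (replicate d 0) (replicate (Suc n) 0) = 1"
proof (induction n)
  case 0
  have "paths None (replicate d 0) 0 = 1" by (subst paths.simps) simp
  then show ?case by simp
next
  case (Suc n)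
  then show ?case using stack_paths_pop[of "replicate d 0" s "replicate (Suc n) 0"]
    by (simp add: sum_list_replicate)
qed

lemma move_append: "Suc i < length xs \<Longrightarrow> move (xs @ ys) i y = move xs i y @ ys"
  by (simp add: move_def nth_append list_update_append)

lemma card_good_words_Cons_step:
  assumes "finite U" "U \<noteq> {}" "sorted_wrt (<) (gs @ ms)" "set (gs @ ms) \<inter> U = {}" "length gs = d"
    and active: "\<And>m. m \<in> set ms \<Longrightarrow> \<exists>u\<in>U. hi gs u \<and> u < m" and s: "card U \<le> s"
    and IH: "\<And>gs' ms' v. v \<in> U \<Longrightarrow> sorted_wrt (<) (gs' @ ms') \<Longrightarrow> set (gs' @ ms') \<inter> (U - {v}) = {} \<Longrightarrow>
      length gs' = d \<Longrightarrow> card (good_words gs' ms' (U - {v})) =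
        stack_paths s (take d (profile (gs' @ ms') (U - {v}))) (drop d (profile (gs' @ ms') (U - {v})))"
  shows "card (good_words gs ms U) =
    stack_paths s (take d (profile (gs @ ms) U)) (drop d (profile (gs @ ms) U))"
proof -
  define F where "F = (\<lambda>xs. stack_paths s (take d xs) (drop d xs))"
  define a where "a = take d (profile (gs @ ms) U)"
  define h where "h = profile (gs @ ms) U ! d"
  define hs where "hs = drop (Suc d) (profile (gs @ ms) U)"
  have prof: "profile (gs @ ms) U = a @ h # hs" and a: "length a = d"
    using assms(5) by (auto simp: a_def h_def hs_def Cons_nth_drop_Suc)
  have "length (a @ h # hs) = Suc (length (gs @ ms))" using prof length_profile by metis
  then have hs: "hs = [] \<longleftrightarrow> ms = []" using a assms(5) by auto
  have sum: "sum_list (a @ h # hs) = card U"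
    unfolding prof[symmetric] using assms by (intro sum_profile) auto
  have h: "h > 0 \<or> hs = []"
  proof (cases ms)
    case (Cons m ms')
    then obtain u where "u \<in> U" "hi gs u" "u < m" using active[of m] by auto
    then have "{u \<in> U. hi gs u \<and> (ms \<noteq> [] \<longrightarrow> u < hd ms)} \<noteq> {}" using Cons by auto
    then show ?thesis
      using assms(1) by (auto simp: h_def profile_append_nth[OF assms(5)] card_gt_0_iff)
  qed (use hs in simp)
  have "card (good_words gs ms U) =
     (\<Sum>v | v \<in> U \<and> (\<forall>m\<in>set ms. v < m). card (good_words (ins v gs) (v # ms) (U - {v})))"
    using assms by (intro card_good_words_step) auto
  also have "\<dots> = (\<Sum>v | v \<in> U \<and> (\<forall>m\<in>set ms. v < m). F (profile (cut v gs ms) (U - {v})))"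
  proof (intro sum.cong refl)
    fix v assume v: "v \<in> {v. v \<in> U \<and> (\<forall>m\<in>set ms. v < m)}"
    then have vgs: "v \<notin> set gs" using assms(4) by auto
    have cut: "sorted_wrt (<) (cut v gs ms)" "set (cut v gs ms) \<inter> (U - {v}) = {}"
      using v vgs assms(3,4) set_cut[of v gs ms] by (auto intro: sorted_cut)
    show "card (good_words (ins v gs) (v # ms) (U - {v})) = F (profile (cut v gs ms) (U - {v}))"
    proof (cases "hi gs v")
      case True
      then show ?thesis
        using IH[of v gs "v # ms"] cut v assms(5) by (simp add: F_def cut_hi ins_hi)
    next
      case False
      have "v \<in> set (ins v gs)" using ins_not_hi False vgs assms(3) by (simp add: sorted_wrt_append)
      then have "v < u" if "hi (ins v gs) u" for u using that by (simp add: hi_def)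
      then have "good_words (ins v gs) (v # ms) (U - {v}) = good_words (ins v gs) ms (U - {v})"
        using less_asym by (intro good_words_drop) blast
      then show ?thesis
        using IH[of v "ins v gs" ms] cut v assms(5) by (simp add: F_def cut_not_hi[OF False vgs])
    qed
  qed
  also have "\<dots> = (\<Sum>i<length a. \<Sum>y<a ! i. F (move (a @ h # hs) i y)) + (\<Sum>k<h. F (a @ k # (h - Suc k) # hs))"
    using assms a by (intro sum_profile_cut[OF _ _ _ prof]) auto
  also have "(\<Sum>i<length a. \<Sum>y<a ! i. F (move (a @ h # hs) i y)) =
     (\<Sum>i<length a. \<Sum>y<a ! i. stack_paths s (butlast (move (a @ [h]) i y)) (last (move (a @ [h]) i y) # hs))"
  proof (intro sum.cong refl)
    fix i y assume "i \<in> {..<length a}"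
    then have "move (a @ h # hs) i y = move (a @ [h]) i y @ hs"
      using move_append[of i "a @ [h]" hs] by simp
    also have "\<dots> = butlast (move (a @ [h]) i y) @ last (move (a @ [h]) i y) # hs"
      by (subst append_butlast_last_id[symmetric]) (auto simp flip: length_greater_0_conv)
    finally show "F (move (a @ h # hs) i y) =
      stack_paths s (butlast (move (a @ [h]) i y)) (last (move (a @ [h]) i y) # hs)"
      using a by (simp add: F_def)
  qed
  also have "\<dots> + (\<Sum>k<h. F (a @ k # (h - Suc k) # hs)) = stack_paths s a (h # hs)"
  proof -
    \<comment> \<open>Unread values remain, so the summand for the completed reading must vanish;
      for \<open>h = 0\<close> there are no lower levels, hence the remaining values lie in the
      gaps.\<close>
    have "card U \<noteq> 0" using assms(1,2) by simp
    moreover have "sum_list a + (h + sum_list hs) = card U" using sum by simp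
    moreover have "sum_list hs = 0" if "h = 0" using h that by simp
    ultimately have "\<not> (h = 0 \<and> sum_list a = 0)" by linarith
    then show ?thesis
      using stack_paths_step[of a s h hs] h sum s a by (simp add: F_def)
  qed
  also have "\<dots> = stack_paths s (take d (profile (gs @ ms) U)) (drop d (profile (gs @ ms) U))"
    using a by (simp add: prof)
  finally show ?thesis .
qed

text \<open>Outer induction on the number of unread values, inner induction on the pending
  constraints: exhausted constraints are popped until the innermost one is active. As the
  constraints increase, all of them are active then.\<close>

lemma card_good_words:
  assumes "finite U" "sorted_wrt (<) (gs @ ms)" "set (gs @ ms) \<inter> U = {}" "length gs = d" "card U \<le> s"
  shows "card (good_words gs ms U) =
    stack_paths s (take d (profile (gs @ ms) U)) (drop d (profile (gs @ ms) U))"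
  using assms
proof (induction "card U" arbitrary: U gs ms rule: less_induct)
  case outer: less
  have IH: "card (good_words gs' ms' (U - {v})) =
        stack_paths s (take d (profile (gs' @ ms') (U - {v}))) (drop d (profile (gs' @ ms') (U - {v})))"
    if "v \<in> U" "sorted_wrt (<) (gs' @ ms')" "set (gs' @ ms') \<inter> (U - {v}) = {}" "length gs' = d" for gs' ms' v
  proof -
    have "card (U - {v}) < card U" using that outer.prems by (meson card_Diff1_less)
    with that outer.prems show ?thesis by (intro outer.hyps) auto
  qed
  from outer.prems IH show ?case
  proof (induction ms)
    case inner: (Cons m ms)
    show ?case
    proof (cases "\<exists>u\<in>U. hi gs u \<and> u < m")
      case False
      obtain a hs where a: "length a = length gs" "profile (gs @ m # ms) U = a @ 0 # hs"
         "profile (gs @ ms) U = a @ hs"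
        using profile_drop[OF False] inner.prems by blast
      have "length (a @ hs) = Suc (length (gs @ ms))" using a(3) length_profile by metis
      with a(1) have hs: "hs \<noteq> []" by auto
      have "sum_list (profile (gs @ ms) U) = card U"
        using inner.prems by (intro sum_profile) auto
      then have "sum_list a \<le> s" using a inner.prems(5) by simp
      have "card (good_words gs (m # ms) U) = card (good_words gs ms U)"
        using good_words_drop[OF False] by simp
      also have "\<dots> = stack_paths s (take d (profile (gs @ ms) U)) (drop d (profile (gs @ ms) U))"
        using inner.prems by (intro inner.IH) (auto simp: sorted_wrt_append)
      also have "\<dots> = stack_paths s a hs" using a inner.prems(4) by simp
      also have "\<dots> = stack_paths s a (0 # hs)"
        using stack_paths_pop[OF \<open>sum_list a \<le> s\<close> hs] by simp
      finally show ?thesis using a inner.prems(4) by simp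
    next
      case True
      have active: "\<exists>u\<in>U. hi gs u \<and> u < m'" if "m' \<in> set (m # ms)" for m'
        using True that inner.prems(2) by (auto simp: sorted_wrt_append dest: less_trans)
      have "U \<noteq> {}" using True by blast
      show ?thesis
        by (rule card_good_words_Cons_step[OF inner.prems(1) \<open>U \<noteq> {}\<close> inner.prems(2-4) active inner.prems(5,6)])
    qed
  next
    case Nil
    show ?case
    proof (cases "U = {}")
      case True
      then have "good_words gs [] U = {[]}" by (auto simp: good_words_def)
      then show ?thesis
        using True Nil.prems(4) stack_paths_replicate[of s d 0]
        by (simp add: profile_eq_replicate min_def Suc_diff_le del: replicate_Suc)
    next
      case False
      then show ?thesis using Nil.prems(1-5)
        by (intro card_good_words_Cons_step[OF _ _ _ _ _ _ _ Nil.prems(6)]) simp_all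
    qed
  qed
qed

subsection \<open>Increasing subsequences\<close>

definition has_inc :: "nat \<Rightarrow> nat list \<Rightarrow> nat \<Rightarrow> bool" where
  "has_inc k w z \<longleftrightarrow> (\<exists>xs. subseq xs w \<and> sorted_wrt (<) xs \<and> length xs = k \<and> (\<forall>x\<in>set xs. x < z))"

lemma has_inc_0 [simp]: "has_inc 0 w z"
  by (auto simp: has_inc_def)

lemma has_inc_Nil: "has_inc k [] z \<longleftrightarrow> k = 0"
  by (auto simp: has_inc_def)

lemma has_inc_SucD: "has_inc (Suc k) w z \<Longrightarrow> has_inc k w z"
proof -
  assume "has_inc (Suc k) w z"
  then obtain xs where xs: "subseq xs w" "sorted_wrt (<) xs" "length xs = Suc k" "\<forall>x\<in>set xs. x < z"
    by (auto simp: has_inc_def)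
  then obtain y ys where "xs = y # ys" by (cases xs) auto
  with xs show ?thesis
    unfolding has_inc_def by (intro exI[of _ ys]) (auto dest: subseq_Cons')
qed

lemma has_inc_antimono: "has_inc k w z \<Longrightarrow> j \<le> k \<Longrightarrow> has_inc j w z"
  by (induction k) (auto simp: le_Suc_eq dest: has_inc_SucD)

text \<open>The last entry of the subsequence either is the new \<open>v\<close> or lies in
  \<open>w\<close>; this is the recurrence that a patience sorting step records.\<close>

lemma has_inc_snoc:
  "has_inc (Suc k) (w @ [v]) z \<longleftrightarrow> has_inc (Suc k) w z \<or> v < z \<and> has_inc k w v"
proof
  assume "has_inc (Suc k) (w @ [v]) z"
  then obtain xs where xs: "subseq xs (w @ [v])" "sorted_wrt (<) xs" "length xs = Suc k" "\<forall>x\<in>set xs. x < z"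
    by (auto simp: has_inc_def)
  then obtain ys y where ys: "xs = ys @ [y]" by (metis length_Suc_conv_rev)
  from xs(1) have "y = v \<and> subseq ys w \<or> subseq xs w"
  proof -
    obtain p q where pq: "xs = p @ q" "subseq p w" "subseq q [v]"
      using xs(1) by (auto simp: subseq_append_iff)
    from pq(3) have "q = [] \<or> q = [v]"
      by (cases q) (auto simp: subseq_Cons2_iff split: if_splits)
    with pq ys show ?thesis by auto
  qed
  then show "has_inc (Suc k) w z \<or> v < z \<and> has_inc k w v"
  proof
    assume "y = v \<and> subseq ys w"
    then have "v < z \<and> has_inc k w v"
      using xs ys unfolding has_inc_def by (auto simp: sorted_wrt_append intro!: exI[of _ ys])
    then show ?thesis by blast
  next
    assume "subseq xs w"
    then have "has_inc (Suc k) w z"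
      using xs unfolding has_inc_def by blast
    then show ?thesis by blast
  qed
next
  assume "has_inc (Suc k) w z \<or> v < z \<and> has_inc k w v"
  then show "has_inc (Suc k) (w @ [v]) z"
  proof
    assume "has_inc (Suc k) w z"
    then show ?thesis unfolding has_inc_def by (blast intro: subseq_rev_drop_many)
  next
    assume "v < z \<and> has_inc k w v"
    then obtain xs where xs: "v < z" "subseq xs w" "sorted_wrt (<) xs" "length xs = k" "\<forall>x\<in>set xs. x < v"
      by (auto simp: has_inc_def)
    then show ?thesis unfolding has_inc_def
      by (intro exI[of _ "xs @ [v]"]) (auto simp: sorted_wrt_append list_emb_append_mono)
  qed
qed

text \<open>Each \<open>g\<close> is the least last entry of an increasing subsequence of its
  length, expressed through the values \<open>z\<close> above it. Only \<open>z \<le> n\<close> are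
  tested, so that a threshold above \<open>n\<close> can stand for a subsequence that does not exist
  yet.\<close>

fun tops :: "nat \<Rightarrow> nat \<Rightarrow> nat list \<Rightarrow> nat list \<Rightarrow> bool" where
  "tops n k [] u \<longleftrightarrow> True"
| "tops n k (g # gs) u \<longleftrightarrow> (\<forall>z\<le>n. has_inc (Suc k) u z \<longleftrightarrow> g < z) \<and> tops n (Suc k) gs u"

lemma tops_snoc_unchanged:
  "tops n k gs u \<Longrightarrow> \<not> has_inc k u v \<Longrightarrow> tops n k gs (u @ [v])"
  by (induction gs arbitrary: k) (auto simp: has_inc_snoc dest: has_inc_SucD)

text \<open>If \<open>v < g\<close>, no increasing subsequence of length \<open>k + 1\<close> lies
  below \<open>v\<close>, so \<open>v\<close> improves this threshold and none of the later ones; if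
  \<open>g < v\<close>, the argument passes on to the next length.\<close>

lemma tops_snoc:
  "tops n k gs u \<Longrightarrow> has_inc k u v \<Longrightarrow> v \<le> n \<Longrightarrow> v \<notin> set gs \<Longrightarrow> tops n k (ins v gs) (u @ [v])"
proof (induction gs arbitrary: k)
  case (Cons g gs)
  show ?case
  proof (cases "v < g")
    case True
    then have "\<not> has_inc (Suc k) u v" using Cons.prems by auto
    then show ?thesis
      using Cons.prems True by (auto simp: has_inc_snoc intro!: tops_snoc_unchanged)
  next
    case False
    with Cons.prems have "g < v" by auto
    then have "has_inc (Suc k) u v" using Cons.prems by auto
    then show ?thesis
      using Cons.prems \<open>g < v\<close> by (auto simp: has_inc_snoc intro!: Cons.IH)
  qed
qed simp

lemma tops_hi: "tops n k gs u \<Longrightarrow> has_inc k u a \<Longrightarrow> a \<le> n \<Longrightarrow> hi gs a \<longleftrightarrow> has_inc (k + length gs) u a"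
proof (induction gs arbitrary: k)
  case (Cons g gs)
  then have g: "has_inc (Suc k) u a \<longleftrightarrow> g < a" by auto
  show ?case
  proof (cases "g < a")
    case True
    with Cons.prems g have "hi gs a \<longleftrightarrow> has_inc (Suc k + length gs) u a"
      by (intro Cons.IH) auto
    with True show ?thesis by (simp add: hi_def)
  next
    case False
    with Cons.prems g show ?thesis
      using has_inc_antimono[of "k + length (g # gs)" u a "Suc k"] by (auto simp: hi_def)
  qed
qed (simp add: hi_def)

text \<open>The thresholds are replaced by their meaning: \<open>hi\<close>, at the moment when
  \<open>b\<close> is read, says that some increasing sequence of length \<open>d\<close> lies
  before \<open>b\<close> and below the entry in question.\<close>

lemma good_iff:
  assumes "tops n 0 gs u" "length gs = d" "distinct w" "set w \<subseteq> {..n}" "set gs \<inter> set w = {}"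
  shows "good gs w \<longleftrightarrow> (\<forall>u' b w'. w = u' @ b # w' \<longrightarrow> \<not> straddle (has_inc d (u @ u')) b w')"
  using assms
proof (induction w arbitrary: gs u)
  case (Cons v w)
  have "hi gs a \<longleftrightarrow> has_inc d u a" if "a \<in> set w" for a
    using tops_hi[OF Cons.prems(1), of a] Cons.prems that by auto
  then have "straddle (hi gs) m w' \<longleftrightarrow> straddle (has_inc d u) m w'" if "set w' \<subseteq> set w" for m w'
    using that by (induction w') auto
  then have 1: "straddle (hi gs) v w \<longleftrightarrow> straddle (has_inc d u) v w"
    by simp
  have 2: "good (ins v gs) w \<longleftrightarrow>
     (\<forall>u' b w'. w = u' @ b # w' \<longrightarrow> \<not> straddle (has_inc d ((u @ [v]) @ u')) b w')"
    using Cons.prems set_ins[of v gs] by (intro Cons.IH tops_snoc) auto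
  show ?case
    unfolding good.simps 1 2
    by (auto simp: Cons_eq_append_conv)
qed simp

section \<open>Occurrences of the pattern as straddled entries\<close>

lemma straddle_iff_nth:
  "straddle Q m w \<longleftrightarrow> (\<exists>i j. i < j \<and> j < length w \<and> Q (w ! j) \<and> w ! j < m \<and> m < w ! i)"
proof (induction w)
  case (Cons c w)
  have set: "(\<exists>a\<in>set w. Q a \<and> a < m) \<longleftrightarrow> (\<exists>j<length w. Q (w ! j) \<and> w ! j < m)"
    by (metis in_set_conv_nth)
  let ?R = "\<lambda>w i j. i < j \<and> j < length w \<and> Q (w ! j) \<and> w ! j < m \<and> m < w ! i"
  have "(\<exists>i j. ?R (c # w) i j) \<longleftrightarrow> (\<exists>j. ?R (c # w) 0 (Suc j)) \<or> (\<exists>i j. ?R (c # w) (Suc i) (Suc j))"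
    (is "?lhs \<longleftrightarrow> ?rhs")
  proof
    assume ?lhs
    then obtain i j where ij: "?R (c # w) i j" by blast
    then obtain j' where "j = Suc j'" by (cases j) auto
    with ij show ?rhs by (cases i) blast+
  qed blast
  also have "(\<exists>j. ?R (c # w) 0 (Suc j)) \<longleftrightarrow> m < c \<and> (\<exists>a\<in>set w. Q a \<and> a < m)"
    unfolding set by auto
  also have "(\<exists>i j. ?R (c # w) (Suc i) (Suc j)) \<longleftrightarrow> straddle Q m w"
    unfolding Cons by simp
  finally show ?case by simp
qed simp

text \<open>The bound \<open>m\<close> places the chosen entries inside a prefix: the first
  \<open>d\<close> entries of an occurrence have to precede the one that plays
  \<open>d + 2\<close>.\<close>

lemma subseq_map_nth:
  assumes "strict_mono_on {..<k} f" "\<And>i. i < k \<Longrightarrow> f i < m" "m \<le> length w"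
  shows "subseq (map (\<lambda>i. w ! f i) [0..<k]) (take m w)"
  using assms
proof (induction k arbitrary: m)
  case (Suc k)
  have "strict_mono_on {..<k} f" using Suc.prems(1) by (auto simp: strict_mono_on_def)
  moreover have "f i < f k" if "i < k" for i
    using Suc.prems(1) that by (auto simp: strict_mono_on_def)
  moreover have "f k < m" using Suc.prems(2) by simp
  ultimately have "subseq (map (\<lambda>i. w ! f i) [0..<k]) (take (f k) w)"
    using Suc.prems(3) by (intro Suc.IH) auto
  then have "subseq (map (\<lambda>i. w ! f i) [0..<k] @ [w ! f k]) (take (f k) w @ [w ! f k])"
    by (intro list_emb_append_mono) auto
  also have "take (f k) w @ [w ! f k] = take (Suc (f k)) w"
    using \<open>f k < m\<close> Suc.prems(3) by (simp add: take_Suc_conv_app_nth)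
  also have "subseq (take (Suc (f k)) w) (take m w)"
  proof (intro prefix_imp_subseq)
    have "take (Suc (f k)) w = take (Suc (f k)) (take m w)"
      using \<open>f k < m\<close> by (simp add: min_def)
    then show "prefix (take (Suc (f k)) w) (take m w)" by (metis take_is_prefix)
  qed
  finally show ?case by simp
qed simp

lemma subseq_nth:
  assumes "subseq xs w"
  shows "\<exists>f. strict_mono_on {..<length xs} f \<and> f ` {..<length xs} \<subseteq> {..<length w} \<and>
     (\<forall>i<length xs. w ! f i = xs ! i)"
  using assms
proof (induction rule: list_emb.induct)
  case (list_emb_Cons xs w v)
  then obtain f where "strict_mono_on {..<length xs} f" "f ` {..<length xs} \<subseteq> {..<length w}"
     "\<forall>i<length xs. w ! f i = xs ! i" by blast
  then show ?case
    by (intro exI[of _ "\<lambda>i. Suc (f i)"]) (auto simp: strict_mono_on_def)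
next
  case (list_emb_Cons2 x y xs w)
  then obtain f where "strict_mono_on {..<length xs} f" "f ` {..<length xs} \<subseteq> {..<length w}"
     "\<forall>i<length xs. w ! f i = xs ! i" by blast
  moreover from this have "f i < length w" if "i < length xs" for i using that by auto
  ultimately show ?case using list_emb_Cons2(1)
    by (intro exI[of _ "\<lambda>i. case i of 0 \<Rightarrow> 0 | Suc j \<Rightarrow> Suc (f j)"])
       (auto simp: strict_mono_on_def less_Suc_eq_0_disj split: nat.splits)
qed (simp add: strict_mono_on_def)

lemma beta_nth:
  "i < d \<Longrightarrow> beta d ! i = Suc i" "beta d ! d = d + 2" "beta d ! Suc d = d + 3" "beta d ! Suc (Suc d) = d + 1"
  by (auto simp: beta_def nth_append)

lemma length_beta [simp]: "length (beta d) = d + 3"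
  by (simp add: beta_def)

text \<open>In an occurrence, \<open>b\<close> plays \<open>d + 2\<close>, the straddling pair plays
  \<open>d + 3\<close> and \<open>d + 1\<close>, and the increasing sequence below the latter plays
  \<open>1, ..., d\<close>.\<close>

lemma contains_beta_iff:
  "contains_pattern w (beta d) \<longleftrightarrow> (\<exists>u b w'. w = u @ b # w' \<and> straddle (has_inc d u) b w')"
proof
  assume "contains_pattern w (beta d)"
  then obtain f where f: "strict_mono_on {..<d + 3} f" "f ` {..<d + 3} \<subseteq> {..<length w}"
      and iff: "\<And>i j. i < d + 3 \<Longrightarrow> j < d + 3 \<Longrightarrow> w ! f i < w ! f j \<longleftrightarrow> beta d ! i < beta d ! j"
    unfolding contains_pattern_def by auto
  have mono: "f i < f j" if "i < j" "j < d + 3" for i j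
    using f(1) that by (auto simp: strict_mono_on_def)
  have len: "f i < length w" if "i < d + 3" for i using f(2) that by auto
  define u b w' where "u = take (f d) w" and "b = w ! f d" and "w' = drop (Suc (f d)) w"
  have w: "w = u @ b # w'"
    using len[of d] by (simp add: u_def b_def w'_def id_take_nth_drop)
  have "subseq (map (\<lambda>i. w ! f i) [0..<d]) u"
    unfolding u_def using f(1) mono len[of d]
    by (intro subseq_map_nth) (auto simp: strict_mono_on_def)
  moreover have "sorted_wrt (<) (map (\<lambda>i. w ! f i) [0..<d])"
    by (auto simp: sorted_wrt_iff_nth_less iff beta_nth)
  ultimately have inc: "has_inc d u (w ! f (d + 2))"
    unfolding has_inc_def by (intro exI[of _ "map (\<lambda>i. w ! f i) [0..<d]"]) (auto simp: iff beta_nth)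
  have "w' ! (f (d + k) - Suc (f d)) = w ! f (d + k)" "f (d + k) - Suc (f d) < length w'" if "k \<in> {1, 2}" for k
    using that mono[of d "d + k"] len[of "d + k"] by (auto simp: w'_def)
  note nth = this[of 1] this[of 2]
  have "straddle (has_inc d u) b w'"
    unfolding straddle_iff_nth
    by (rule exI[of _ "f (d + 1) - Suc (f d)"], rule exI[of _ "f (d + 2) - Suc (f d)"])
       (use nth mono[of d "d + 1"] mono[of "d + 1" "d + 2"] inc in \<open>auto simp: iff b_def beta_nth\<close>)
  with w show "\<exists>u b w'. w = u @ b # w' \<and> straddle (has_inc d u) b w'" by blast
next
  assume "\<exists>u b w'. w = u @ b # w' \<and> straddle (has_inc d u) b w'"
  then obtain u b w' i j where w: "w = u @ b # w'" and ij: "i < j" "j < length w'"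
    and a: "has_inc d u (w' ! j)" "w' ! j < b" "b < w' ! i"
    by (auto simp: straddle_iff_nth)
  then obtain xs where xs: "subseq xs u" "sorted_wrt (<) xs" "length xs = d" "\<forall>x\<in>set xs. x < w' ! j"
    by (auto simp: has_inc_def)
  then obtain f where f: "strict_mono_on {..<d} f" "f ` {..<d} \<subseteq> {..<length u}" "\<forall>i<d. u ! f i = xs ! i"
    using subseq_nth[of xs u] by auto
  define g where "g = (\<lambda>k. if k < d then f k else if k = d then length u
     else if k = Suc d then Suc (length u + i) else Suc (length u + j))"
  have ltu: "f k < length u" if "k < d" for k using f(2) that by auto
  have ltu': "f k < Suc (length u + l)" if "k < d" for k l using ltu[OF that] by simp
  have val: "w ! g k = (if k < d then xs ! k else if k = d then b else if k = Suc d then w' ! i else w' ! j)"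
     if "k < d + 3" for k
    using that ltu f(3) by (auto simp: g_def w nth_append)
  have xsj: "xs ! k < w' ! j" if "k < d" for k using xs that by auto
  have xs_iff: "xs ! k < xs ! l \<longleftrightarrow> k < l" if "k < d" "l < d" for k l
    using that xs(2,3) by (metis sorted_wrt_nth_less linorder_neqE_nat less_asym less_irrefl)
  have split: "k < d \<or> k = d \<or> k = Suc d \<or> k = Suc (Suc d)" if "k < d + 3" for k
    using that by auto
  show "contains_pattern w (beta d)"
    unfolding contains_pattern_def length_beta
  proof (intro exI[of _ g] conjI allI impI)
    show "strict_mono_on {..<d + 3} g"
      using f(1) ltu ltu' ij by (auto simp: strict_mono_on_def g_def)
    show "g ` {..<d + 3} \<subseteq> {..<length w}"
      using ltu'[of _ "length w'"] ij by (auto simp: g_def w)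
    fix k l assume kl: "k < d + 3" "l < d + 3"
    show "w ! g k < w ! g l \<longleftrightarrow> beta d ! k < beta d ! l"
      using split[OF kl(1)] split[OF kl(2)] a xsj[of k] xsj[of l] xs_iff
      by (auto simp: val beta_nth)
  qed
qed

text \<open>The reading starts with the thresholds \<open>n + 1, ..., n + d\<close>, which lie above
  all values: for \<open>d \<ge> 1\<close> the first gap holds all \<open>n\<close> values and
  everything else is empty. Treating the gaps and \<open>h\<close> as one list covers
  \<open>d = 0\<close> as well.\<close>

lemma card_Av_beta: "card (Av n (beta d)) = paths None (butlast (n # replicate d 0)) (last (n # replicate d 0))"
proof -
  define gs where "gs = map (\<lambda>i. Suc (n + i)) [0..<d]"
  have gs: "length gs = d" "sorted_wrt (<) gs"
    by (simp_all add: gs_def sorted_wrt_iff_nth_less)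
  have tops: "tops n k (map (\<lambda>i. Suc (n + i)) [l..<m]) []" for k l m
    by (induction "m - l" arbitrary: k l) (auto simp: upt_rec has_inc_Nil)
  then have tops: "tops n 0 gs []" by (simp add: gs_def)
  have "Av n (beta d) = good_words gs [] {1..n}"
  proof -
    have "\<not> contains_pattern w (beta d) \<longleftrightarrow> good_capped gs w" if "w \<in> permutations_of_set {1..n}" for w
    proof -
      have w: "distinct w" "set w = {1..n}" using that by (auto simp: permutations_of_set_def)
      have disj: "set gs \<inter> set w = {}" unfolding w by (auto simp: gs_def)
      have "\<not> contains_pattern w (beta d) \<longleftrightarrow> good gs w"
        using good_iff[OF tops gs(1) w(1) _ disj] w by (auto simp: contains_beta_iff)
      also have "\<dots> \<longleftrightarrow> good_capped gs w" using gs w disj by (intro good_iff_good_capped)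
      finally show ?thesis .
    qed
    then show ?thesis by (auto simp: Av_def good_words_def)
  qed
  also have "card \<dots> = stack_paths n (take d (profile gs {1..n})) (drop d (profile gs {1..n}))"
  proof -
    have "set gs \<inter> {1..n} = {}" by (auto simp: gs_def)
    then show ?thesis using card_good_words[of "{1..n}" gs "[]" d n] gs by simp
  qed
  also have "profile gs {1..n} = n # replicate d 0"
  proof (cases gs)
    case (Cons g gs')
    then have "g = Suc n" by (simp add: gs_def upt_rec split: if_splits)
    then have "{u \<in> {1..n}. u < g} = {1..n}" "{u \<in> {1..n}. g < u} = {}" by auto
    then have "profile gs {1..n} = n # profile gs' {}" using Cons by (simp only: profile.simps) simp
    then show ?thesis using Cons gs(1)[symmetric] by (simp add: profile_eq_replicate)
  qed (use gs in simp)
  also have "stack_paths n (take d (n # replicate d 0)) (drop d (n # replicate d 0)) =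
     paths None (butlast (n # replicate d 0)) (last (n # replicate d 0))"
  proof -
    have "take d xs = butlast xs \<and> drop d xs = [last xs]" if "length xs = Suc d" for xs :: "nat list"
      using that by (cases xs rule: rev_cases) auto
    then show ?thesis by (simp only: length_Cons length_replicate) simp
  qed
  finally show ?thesis .
qed

section \<open>The table\<close>

text \<open>The first entry is the most significant digit. A move lowers one digit and raises only
  the next one, so this order makes it decrease the code.\<close>

fun code :: "nat \<Rightarrow> nat list \<Rightarrow> nat" where
  "code b [] = 0"
| "code b (x # xs) = x * b ^ length xs + code b xs"

definition digits :: "nat \<Rightarrow> nat \<Rightarrow> nat \<Rightarrow> nat list" where
  "digits b k m = map (\<lambda>j. m div b ^ (k - Suc j) mod b) [0..<k]"

lemma code_snoc: "code b (xs @ [x]) = code b xs * b + x"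
  by (induction xs) (auto simp: algebra_simps)

lemma length_digits [simp]: "length (digits b k m) = k"
  by (simp add: digits_def)

lemma digits_Suc: "digits b (Suc k) m = digits b k (m div b) @ [m mod b]"
proof (rule nth_equalityI)
  fix i assume "i < length (digits b (Suc k) m)"
  then show "digits b (Suc k) m ! i = (digits b k (m div b) @ [m mod b]) ! i"
  proof (cases "i < k")
    case True
    then have "b ^ (k - i) = b * b ^ (k - Suc i)"
      by (metis Suc_diff_Suc power_Suc)
    with True show ?thesis by (simp add: digits_def nth_append div_mult2_eq del: upt_Suc)
  qed (simp add: digits_def nth_append del: upt_Suc)
qed simp

lemma code_digits: "m < b ^ k \<Longrightarrow> code b (digits b k m) = m"
proof (induction k arbitrary: m)
  case (Suc k)
  then have "m div b < b ^ k"
    by (metis less_mult_imp_div_less power_Suc2)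
  with Suc show ?case by (simp add: digits_Suc code_snoc)
qed (simp add: digits_def)

lemma digits_code: "set xs \<subseteq> {..<b} \<Longrightarrow> digits b (length xs) (code b xs) = xs"
  by (induction xs rule: rev_induct) (simp_all add: code_snoc digits_Suc, simp add: digits_def)

lemma code_less: "set xs \<subseteq> {..<b} \<Longrightarrow> code b xs < b ^ length xs"
proof (induction xs)
  case (Cons x xs)
  then have "Suc x * b ^ length xs \<le> b * b ^ length xs" by (intro mult_le_mono1) auto
  with Cons show ?case by auto
qed simp

lemma set_digits: "b > 0 \<Longrightarrow> set (digits b k m) \<subseteq> {..<b}"
  by (auto simp: digits_def)

lemma bij_digits: "b > 0 \<Longrightarrow> bij_betw (digits b k) {..<b ^ k} {xs. length xs = k \<and> set xs \<subseteq> {..<b}}"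
  by (rule bij_betwI[where g = "code b"])
     (auto simp: code_digits digits_code code_less intro: set_digits[THEN subsetD, simplified])

lemma set_subset_of_sum: "sum_list xs < b \<Longrightarrow> set xs \<subseteq> {..<(b :: nat)}"
  by (auto dest!: member_le_sum_list)

section \<open>Decrease of the code along the recursion\<close>

lemma code_move:
  "Suc i < length xs \<Longrightarrow> y < xs ! i \<Longrightarrow>
    code b (move xs i y) + Suc y * b ^ (length xs - Suc i) = code b xs + y * b ^ (length xs - Suc (Suc i))"
proof (induction xs arbitrary: i)
  case (Cons x xs)
  show ?case
  proof (cases i)
    case 0
    with Cons.prems obtain z zs where xs: "xs = z # zs" by (cases xs) auto
    from 0 Cons.prems have "(x - Suc y) + Suc y = x" by simp
    then have "(x - Suc y) * b ^ length xs + Suc y * b ^ length xs = x * b ^ length xs"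
      by (metis distrib_right)
    then show ?thesis using 0 xs by (simp add: move_0 algebra_simps)
  next
    case (Suc j)
    then have "code b (move xs j y) + Suc y * b ^ (length xs - Suc j) = code b xs + y * b ^ (length xs - Suc (Suc j))"
      using Cons.prems by (intro Cons.IH) auto
    then show ?thesis using Suc by (simp add: move_Suc)
  qed
qed simp

text \<open>A unit at position \<open>i\<close> weighs at least as much as one at the next position,
  so the \<open>y\<close> units passed on cannot outweigh the \<open>y + 1\<close> units
  removed.\<close>

lemma code_move_less:
  assumes "Suc i < length xs" "y < xs ! i" "b > 0"
  shows "code b (move xs i y) < code b xs"
proof -
  have "y * b ^ (length xs - Suc (Suc i)) \<le> y * b ^ (length xs - Suc i)"
    using assms by (intro mult_le_mono2 power_increasing) auto
  also have "\<dots> < Suc y * b ^ (length xs - Suc i)" using assms by simp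
  finally show ?thesis using code_move[OF assms(1,2), of b] by linarith
qed

lemma code_butlast_last: "xs \<noteq> [] \<Longrightarrow> code b (butlast xs) * b + last xs = code b xs"
  by (metis append_butlast_last_id code_snoc)

text \<open>Moves lower the code of \<open>a @ [h]\<close>, so the gaps that are reached have at
  most the code of \<open>a\<close>. In the convolution this excludes the intermediate gaps whose
  row has not been computed yet.\<close>

lemma paths_eq_0_code:
  assumes "sum_list a + h < b" "code b a < code b c"
  shows "paths (Some c) a h = 0"
  using assms
proof (induction "sum_list a + h" arbitrary: a h c rule: less_induct)
  case less
  show ?case
  proof (cases "h = 0")
    case True
    with less.prems show ?thesis by (auto simp: paths_0_Some)
  next
    case False
    have 1: "paths (Some c) (butlast (move (a @ [h]) i y)) (last (move (a @ [h]) i y)) = 0"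
      if iy: "i < length a" "y < a ! i" for i y
    proof (rule less.hyps)
      let ?xs = "move (a @ [h]) i y"
      show "sum_list (butlast ?xs) + last ?xs < sum_list a + h" "sum_list (butlast ?xs) + last ?xs < b"
        using sum_list_move_split[OF iy, of h] less.prems by linarith+
      have ne: "?xs \<noteq> []" by (metis length_move length_0_conv snoc_eq_iff_butlast)
      have "code b ?xs < code b (a @ [h])"
        using iy less.prems by (intro code_move_less) (auto simp: nth_append)
      then have "code b (butlast ?xs) * b < code b a * b + h"
        unfolding code_butlast_last[OF ne, symmetric] code_snoc by linarith
      \<comment> \<open>Here \<open>h < b\<close> enters: the last digit cannot carry into the code
        of \<open>a\<close>.\<close>
      also have "\<dots> < Suc (code b a) * b" using less.prems by simp
      finally have "code b (butlast ?xs) \<le> code b a" using mult_less_cancel2 by (metis less_Suc_eq_le)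
      then show "code b (butlast ?xs) < code b c" using less.prems by simp
    qed
    have 2: "paths (Some e) a k * paths (Some c) e (h - Suc k) = 0"
      if "k < h" "e \<in> bounded_lists (length a) (sum_list a)" for k e
    proof (cases "code b e \<le> code b a")
      case True
      have "paths (Some c) e (h - Suc k) = 0"
        using that less.prems True by (intro less.hyps) (auto simp: bounded_lists_def)
      then show ?thesis by simp
    next
      case False
      have "paths (Some e) a k = 0"
        using that less.prems False by (intro less.hyps) (auto simp: bounded_lists_def)
      then show ?thesis by simp
    qed
    show ?thesis using False 1 2 by (subst paths.simps) simp
  qed
qed

text \<open>The column \<open>Suc N ^ d\<close> stands for the target \<open>None\<close>.\<close>

definition table :: "nat \<Rightarrow> nat \<Rightarrow> nat \<Rightarrow> nat \<Rightarrow> nat" where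
  "table N d m c = (let a = digits (Suc N) d (m div Suc N); h = m mod Suc N in
     if sum_list a + h \<le> N
     then paths (if c < Suc N ^ d then Some (digits (Suc N) d c) else None) a h else 0)"

lemma table_code:
  assumes "length a = d" "sum_list a + h \<le> N"
  shows "table N d (code (Suc N) (a @ [h])) c =
    paths (if c < Suc N ^ d then Some (digits (Suc N) d c) else None) a h"
proof -
  have "code (Suc N) (a @ [h]) div Suc N = code (Suc N) a" "code (Suc N) (a @ [h]) mod Suc N = h"
    unfolding code_snoc using assms(2) by (simp_all only: div_mult_self3 mod_mult_self3, simp_all)
  moreover have "digits (Suc N) d (code (Suc N) a) = a"
    using digits_code[of a "Suc N"] set_subset_of_sum[of a "Suc N"] assms by simp
  ultimately show ?thesis using assms unfolding table_def by (simp only: Let_def if_True)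
qed

lemma table_mult_add:
  assumes "e < Suc N"
  shows "table N d (c * Suc N + e) c' = (if sum_list (digits (Suc N) d c) + e \<le> N
     then paths (if c' < Suc N ^ d then Some (digits (Suc N) d c') else None) (digits (Suc N) d c) e else 0)"
proof -
  have "(c * Suc N + e) div Suc N = c" "(c * Suc N + e) mod Suc N = e"
    using assms by (simp_all only: div_mult_self3 mod_mult_self3, simp_all)
  then show ?thesis unfolding table_def by (simp only: Let_def)
qed

text \<open>
  The row index encodes \<open>a @ [h]\<close> in base \<open>N + 1\<close>. Every step decreases the code, so the rows can be
  filled in increasing order; a factor \<open>f (e * b + (h - Suc k)) c\<close> from a later row is multiplied by 0.
\<close>

lemma table_rec:
  fixes N d m c :: nat
  defines "b \<equiv> Suc N"
  defines "a \<equiv> digits b d (m div b)" and "h \<equiv> m mod b"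
  assumes m: "m < b ^ Suc d" and c: "c \<le> b ^ d"
    and f: "\<And>m' c'. m' < m \<Longrightarrow> c' \<le> b ^ d \<Longrightarrow> f m' c' = table N d m' c'"
  shows "table N d m c =
    (if sum_list a + h \<le> N then
      if h = 0 \<and> c < b ^ d then (if m = c * b then 1 else 0)
      else (if m = 0 then 1 else 0)
        + (\<Sum>i<d. \<Sum>y<a ! i. f (m - Suc y * b ^ (d - i) + y * b ^ (d - Suc i)) c)
        + (\<Sum>k<h. \<Sum>e<b ^ d. f (m - h + k) e * f (e * b + (h - Suc k)) c)
     else 0)"
proof (cases "sum_list a + h \<le> N")
  case False
  then show ?thesis by (simp add: table_def a_def b_def h_def)
next
  case True
  note True_sum = True
  define t where "t = (if c < b ^ d then Some (digits b d c) else None)"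
  have b: "b > 0" by (simp add: b_def)
  have len: "length a = d" by (simp add: a_def)
  have hb: "h < b" by (simp add: h_def b_def)
  have div_less: "m div b < b ^ d" using m by (metis less_mult_imp_div_less power_Suc2)
  have code_a: "code b a = m div b" using div_less by (simp add: a_def code_digits)
  have m_eq: "m = code b (a @ [h])" by (simp add: code_snoc code_a h_def)
  have T: "table N d m c = paths t a h"
    using table_code[OF len True, of c] by (simp add: m_eq b_def t_def)
  have zero: "m = 0 \<longleftrightarrow> h = 0 \<and> sum_list a = 0"
  proof
    assume "m = 0" then show "h = 0 \<and> sum_list a = 0"
      by (simp add: h_def a_def digits_def sum_list_eq_0_iff)
  next
    assume *: "h = 0 \<and> sum_list a = 0"
    then have "a = replicate d 0" using len by (simp add: replicate_eqI)
    moreover have "code b (replicate k 0) = 0" for k by (induction k) auto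
    ultimately show "m = 0" using * by (simp add: m_eq code_snoc)
  qed
  have same: "t = Some a \<longleftrightarrow> m = c * b" if "h = 0" "c < b ^ d"
  proof -
    have "t = Some a \<longleftrightarrow> digits b d c = a" using that by (simp add: t_def)
    also have "\<dots> \<longleftrightarrow> c = m div b"
    proof
      assume "digits b d c = a"
      then have "code b (digits b d c) = code b a" by simp
      then show "c = m div b" by (simp only: code_digits[OF that(2)] code_a)
    qed (simp only: a_def)
    also have "\<dots> \<longleftrightarrow> m = c * b"
    proof
      show "m = c * b" if "c = m div b"
        using that \<open>h = 0\<close> div_mult_mod_eq[of m b] by (simp add: h_def)
      show "c = m div b" if "m = c * b" using that b by simp
    qed
    finally show ?thesis .
  qed
  have low: "paths t (butlast (move (a @ [h]) i y)) (last (move (a @ [h]) i y))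
     = f (m - Suc y * b ^ (d - i) + y * b ^ (d - Suc i)) c" if iy: "i < d" "y < a ! i" for i y
  proof -
    let ?xs = "move (a @ [h]) i y"
    have ne: "?xs \<noteq> []" by (metis length_move length_0_conv snoc_eq_iff_butlast)
    have i: "Suc i < length (a @ [h])" "y < (a @ [h]) ! i" using iy len by (auto simp: nth_append)
    have "code b ?xs + Suc y * b ^ (d - i) = m + y * b ^ (d - Suc i)"
      using code_move[OF i, of b] len by (simp add: m_eq)
    \<comment> \<open>Subtraction of natural numbers truncates, so the index formula yields the
      intended row only if the part taken away does not exceed \<open>m\<close>.\<close>
    moreover have "Suc y * b ^ (d - i) \<le> m"
    proof -
      have "y * b ^ (d - Suc i) \<le> y * b ^ (d - i)"
        using b by (intro mult_le_mono2 power_increasing) auto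
      have "Suc y \<le> m div b div b ^ (d - Suc i) mod b" using iy by (simp add: a_def digits_def)
      also have "\<dots> \<le> m div b div b ^ (d - Suc i)" by simp
      also have "\<dots> = m div b ^ (d - i)"
        using iy by (metis Suc_diff_Suc div_mult2_eq power_Suc)
      finally show ?thesis
        using b by (metis less_eq_div_iff_mult_less_eq zero_less_power)
    qed
    ultimately have code: "m - Suc y * b ^ (d - i) + y * b ^ (d - Suc i) = code b ?xs" by linarith
    have "f (code b ?xs) c = table N d (code b (butlast ?xs @ [last ?xs])) c"
      using f[of "code b ?xs" c] code_move_less[OF i b] c by (simp add: m_eq ne)
    also have "\<dots> = paths t (butlast ?xs) (last ?xs)"
      using table_code[of "butlast ?xs" d "last ?xs" N c] len sum_list_move_split[of i a y h] iy True
      by (simp add: b_def t_def)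
    finally show ?thesis by (simp only: code)
  qed
  have high: "(\<Sum>e\<in>bounded_lists d (sum_list a). paths (Some e) a k * paths t e (h - Suc k))
     = (\<Sum>e<b ^ d. f (m - h + k) e * f (e * b + (h - Suc k)) c)" if k: "k < h" for k
  proof -
    let ?D = "{xs. length xs = d \<and> set xs \<subseteq> {..<b}}"
    have f1: "f (m - h + k) e = paths (Some (digits b d e)) a k" if "e < b ^ d" for e
    proof -
      have "h \<le> m" by (simp add: h_def)
      then have "m - h + k < m" using k by linarith
      then have "f (m - h + k) e = table N d (m - h + k) e" using that by (intro f) auto
      moreover have "m - h + k = code b (a @ [k])" by (simp add: m_eq code_snoc)
      ultimately show ?thesis using table_code[OF len, of k N e] k True that by (simp add: b_def)
    qed
    have "(\<Sum>e<b ^ d. f (m - h + k) e * f (e * b + (h - Suc k)) c)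
       = (\<Sum>e<b ^ d. paths (Some (digits b d e)) a k * paths t (digits b d e) (h - Suc k))"
    proof (intro sum.cong refl)
      fix e assume e: "e \<in> {..<b ^ d}"
      show "f (m - h + k) e * f (e * b + (h - Suc k)) c =
        paths (Some (digits b d e)) a k * paths t (digits b d e) (h - Suc k)"
      \<comment> \<open>If the first factor is nonzero, the intermediate gaps have at most the code
        of \<open>a\<close>, and \<open>h - Suc k < h\<close> makes their row an earlier one.
        Otherwise the product vanishes, whatever \<open>f\<close> returns for the other
        cell.\<close>
      proof (cases "paths (Some (digits b d e)) a k = 0")
        case True
        then show ?thesis using f1 e by simp
      next
        case False
        have "sum_list a + k < b" using True_sum k by (simp add: b_def)
        then have "\<not> m div b < code b (digits b d e)"
          using paths_eq_0_code[of a k b "digits b d e"] False code_a by auto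
        then have ea: "e \<le> m div b" using e by (simp add: code_digits)
        have "digits b d e \<in> bounded_lists (length a) (sum_list a)"
          using paths_eq_0[of "digits b d e" a k] False by blast
        then have sum: "sum_list (digits b d e) \<le> sum_list a"
          by (simp add: bounded_lists_def len)
        have "e * b + (h - Suc k) < m"
        proof -
          have "e * b \<le> m div b * b" using ea by simp
          moreover have "m div b * b + h = m" by (simp add: h_def)
          ultimately show ?thesis using k by linarith
        qed
        then have "f (e * b + (h - Suc k)) c = table N d (e * b + (h - Suc k)) c"
          using c by (intro f)
        also have "\<dots> = paths t (digits b d e) (h - Suc k)"
        proof -
          have "h - Suc k < Suc N" using hb by (simp add: b_def)
          note * = table_mult_add[OF this, of d e c]
          have "sum_list (digits b d e) + (h - Suc k) \<le> N" using sum True_sum by linarith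
          then show ?thesis unfolding b_def t_def by (simp only: * if_True)
        qed
        finally show ?thesis using f1 e by simp
      qed
    qed
    also have "\<dots> = (\<Sum>e\<in>?D. paths (Some e) a k * paths t e (h - Suc k))"
      using sum.reindex_bij_betw[OF bij_digits[OF b, of d], of "\<lambda>e. paths (Some e) a k * paths t e (h - Suc k)"] .
    \<comment> \<open>Digit lists outside the range of the recursion are unreachable from
      \<open>a\<close> and contribute 0.\<close>
    also have "\<dots> = (\<Sum>e\<in>bounded_lists d (sum_list a). paths (Some e) a k * paths t e (h - Suc k))"
    proof (intro sum.mono_neutral_right ballI)
      show "finite ?D" using finite_lists_length_eq[of "{..<b}" d] by (simp add: conj_commute)
      show "bounded_lists d (sum_list a) \<subseteq> ?D"
      proof
        fix e assume e: "e \<in> bounded_lists d (sum_list a)"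
        then have "sum_list e < b" using True by (simp add: bounded_lists_def b_def)
        with e show "e \<in> ?D" using set_subset_of_sum by (simp add: bounded_lists_def)
      qed
    qed (use paths_eq_0[of _ a k] len in auto)
    finally show ?thesis by simp
  qed
  have tN: "t \<noteq> None \<longleftrightarrow> c < b ^ d" by (simp add: t_def)
  have lows: "(\<Sum>i<d. \<Sum>y<a ! i. paths t (butlast (move (a @ [h]) i y)) (last (move (a @ [h]) i y)))
     = (\<Sum>i<d. \<Sum>y<a ! i. f (m - Suc y * b ^ (d - i) + y * b ^ (d - Suc i)) c)"
    by (intro sum.cong refl low) auto
  have highs: "(\<Sum>k<h. \<Sum>e\<in>bounded_lists d (sum_list a). paths (Some e) a k * paths t e (h - Suc k))
     = (\<Sum>k<h. \<Sum>e<b ^ d. f (m - h + k) e * f (e * b + (h - Suc k)) c)"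
    by (intro sum.cong refl high) auto
  show ?thesis
    unfolding T paths.simps[of t a h] tN len lows highs zero[symmetric]
    using True same by (cases "h = 0 \<and> c < b ^ d") (simp_all only: if_True if_False simp_thms add_0)
qed

section \<open>Size of the numbers\<close>

text \<open>Each term belongs to one choice of the next value, and there are
  \<open>sum_list a + h \<le> B\<close> choices.\<close>

lemma sum_moves_le:
  fixes B :: nat
  assumes low: "\<And>i y. i < length a \<Longrightarrow> y < a ! i \<Longrightarrow> X i y \<le> B ^ n"
    and high: "\<And>k. k < h \<Longrightarrow> Y k \<le> B ^ n"
    and B: "sum_list a + h \<le> B" "B \<ge> 1"
  shows "(\<Sum>i<length a. \<Sum>y<a ! i. X i y) + (\<Sum>k<h. Y k) \<le> B ^ Suc n"
proof -
  have "(\<Sum>i<length a. \<Sum>y<a ! i. X i y) \<le> (\<Sum>i<length a. \<Sum>y<a ! i. B ^ n)"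
    using low by (intro sum_mono) auto
  also have "\<dots> = sum_list a * B ^ n"
    by (simp add: sum_list_sum_nth atLeast0LessThan sum_distrib_right)
  finally have "(\<Sum>i<length a. \<Sum>y<a ! i. X i y) + (\<Sum>k<h. Y k) \<le> sum_list a * B ^ n + h * B ^ n"
    using sum_bounded_above[of "{..<h}" Y "B ^ n"] high by simp
  also have "\<dots> = (sum_list a + h) * B ^ n" by (simp add: distrib_right)
  also have "\<dots> \<le> B * B ^ n" using B(1) by (rule mult_le_mono1)
  finally show ?thesis by simp
qed

text \<open>The weight \<open>B ^ sum_list c\<close> stands for the reading of the values left in
  the gaps \<open>c\<close>. With it the bound is multiplicative along the convolution; bounding
  single entries would lose the number of intermediate gaps at every split.\<close>

lemma sum_paths_Some_le:
  fixes B :: nat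
  assumes "sum_list a + h \<le> B" "B \<ge> 1" "sum_list a \<le> s"
  shows "(\<Sum>c\<in>bounded_lists (length a) s. paths (Some c) a h * B ^ sum_list c) \<le> B ^ (sum_list a + h)"
  using assms
proof (induction "sum_list a + h" arbitrary: a h rule: less_induct)
  case less
  let ?S = "bounded_lists (length a) s"
  define X where "X = (\<lambda>a h. \<Sum>c\<in>?S. paths (Some c) a h * B ^ sum_list c)"
  show ?case
  proof (cases h)
    case 0
    have "X a 0 = (\<Sum>c\<in>?S. if c = a then B ^ sum_list c else 0)"
      unfolding X_def by (intro sum.cong) (auto simp: paths_0_Some)
    also have "\<dots> \<le> B ^ sum_list a" by simp
    finally show ?thesis using 0 by (simp add: X_def)
  next
    case (Suc h')
    let ?a = "\<lambda>i y. butlast (move (a @ [h]) i y)" and ?h = "\<lambda>i y. last (move (a @ [h]) i y)"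
    define n where "n = sum_list a + h'"
    have "X a h = (\<Sum>c\<in>?S. \<Sum>i<length a. \<Sum>y<a ! i. paths (Some c) (?a i y) (?h i y) * B ^ sum_list c)
      + (\<Sum>c\<in>?S. \<Sum>k<h. \<Sum>b\<in>?S. paths (Some b) a k * paths (Some c) b (h - Suc k) * B ^ sum_list c)"
      unfolding X_def paths_eq[OF less.prems(3), of "Some _" h]
      by (simp add: Suc distrib_right sum.distrib sum_distrib_right)
    also have "(\<Sum>c\<in>?S. \<Sum>i<length a. \<Sum>y<a ! i. paths (Some c) (?a i y) (?h i y) * B ^ sum_list c)
      = (\<Sum>i<length a. \<Sum>c\<in>?S. \<Sum>y<a ! i. paths (Some c) (?a i y) (?h i y) * B ^ sum_list c)"
      by (rule sum.swap)
    also have "\<dots> = (\<Sum>i<length a. \<Sum>y<a ! i. X (?a i y) (?h i y))"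
      unfolding X_def by (intro sum.cong refl sum.swap)
    also have "(\<Sum>c\<in>?S. \<Sum>k<h. \<Sum>b\<in>?S. paths (Some b) a k * paths (Some c) b (h - Suc k) * B ^ sum_list c)
      = (\<Sum>k<h. \<Sum>c\<in>?S. \<Sum>b\<in>?S. paths (Some b) a k * paths (Some c) b (h - Suc k) * B ^ sum_list c)"
      by (rule sum.swap)
    also have "\<dots> = (\<Sum>k<h. \<Sum>b\<in>?S. \<Sum>c\<in>?S. paths (Some b) a k * paths (Some c) b (h - Suc k) * B ^ sum_list c)"
      by (intro sum.cong refl sum.swap)
    also have "\<dots> = (\<Sum>k<h. \<Sum>b\<in>?S. paths (Some b) a k * X b (h - Suc k))"
      unfolding X_def by (simp add: sum_distrib_left mult.assoc)
    also have "(\<Sum>i<length a. \<Sum>y<a ! i. X (?a i y) (?h i y)) + \<dots> \<le> B ^ Suc n"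
    proof (rule sum_moves_le[OF _ _ less.prems(1,2)])
      fix i y assume iy: "i < length a" "y < a ! i"
      have "sum_list (?a i y) + ?h i y = n" using sum_list_move_split[OF iy, of h] Suc by (simp add: n_def)
      then show "X (?a i y) (?h i y) \<le> B ^ n"
        using less.hyps[of "?a i y" "?h i y"] less.prems sum_list_butlast_move_le[OF iy, of h] Suc
        by (simp add: X_def n_def)
    next
      fix k assume k: "k < h"
      have "(\<Sum>b\<in>?S. paths (Some b) a k * X b (h - Suc k))
        \<le> (\<Sum>b\<in>?S. paths (Some b) a k * (B ^ sum_list b * B ^ (h - Suc k)))"
      proof (rule sum_mono)
        fix b assume b: "b \<in> ?S"
        show "paths (Some b) a k * X b (h - Suc k) \<le> paths (Some b) a k * (B ^ sum_list b * B ^ (h - Suc k))"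
        proof (cases "paths (Some b) a k = 0")
          case False
          then have "b \<in> bounded_lists (length a) (sum_list a)"
            using paths_eq_0[of b a k] by metis
          then have len: "length b = length a" and le: "sum_list b \<le> sum_list a"
            by (auto simp: bounded_lists_def)
          have "X b (h - Suc k) \<le> B ^ (sum_list b + (h - Suc k))"
            unfolding X_def len[symmetric] using less.prems k le by (intro less.hyps) auto
          then show ?thesis unfolding power_add by (rule mult_le_mono2)
        qed simp
      qed
      also have "\<dots> = (\<Sum>b\<in>?S. paths (Some b) a k * B ^ sum_list b) * B ^ (h - Suc k)"
        by (simp add: sum_distrib_right mult.assoc)
      also have "\<dots> \<le> B ^ (sum_list a + k) * B ^ (h - Suc k)"
        using less.hyps[of a k] less.prems k by (intro mult_le_mono1) simp
      also have "\<dots> = B ^ n" using k Suc by (simp add: n_def flip: power_add)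
      finally show "(\<Sum>b\<in>?S. paths (Some b) a k * X b (h - Suc k)) \<le> B ^ n" .
    qed
    finally show ?thesis using Suc by (simp add: X_def n_def)
  qed
qed

lemma paths_Some_le:
  fixes B :: nat
  assumes "sum_list a + h \<le> B" "B \<ge> 1"
  shows "paths (Some c) a h \<le> B ^ (sum_list a + h)"
proof (cases "c \<in> bounded_lists (length a) (sum_list a)")
  case True
  have "paths (Some c) a h \<le> paths (Some c) a h * B ^ sum_list c" using assms(2) by simp
  also have "\<dots> \<le> (\<Sum>c\<in>bounded_lists (length a) (sum_list a). paths (Some c) a h * B ^ sum_list c)"
    using True by (intro member_le_sum) auto
  also have "\<dots> \<le> B ^ (sum_list a + h)" using assms by (intro sum_paths_Some_le) auto
  finally show ?thesis .
qed (simp add: paths_eq_0)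

text \<open>In the convolution the second factor is bounded by the weight
  \<open>B ^ sum_list b\<close> times a power for the values left in \<open>h\<close>, so the
  weighted sum absorbs the intermediate gaps.\<close>

lemma paths_None_le:
  fixes B :: nat
  assumes "sum_list a + h \<le> B" "B \<ge> 1"
  shows "paths None a h \<le> B ^ (sum_list a + h)"
  using assms
proof (induction "sum_list a + h" arbitrary: a h rule: less_induct)
  case less
  let ?S = "bounded_lists (length a) (sum_list a)"
  let ?a = "\<lambda>i y. butlast (move (a @ [h]) i y)" and ?h = "\<lambda>i y. last (move (a @ [h]) i y)"
  show ?case
  proof (cases "sum_list a + h")
    case 0
    have "a ! i = 0" if "i < length a" for i using that 0 by (simp add: sum_list_eq_0_iff)
    then have *: "(\<Sum>i<length a. \<Sum>y<a ! i. X i y) = 0" for X :: "nat \<Rightarrow> nat \<Rightarrow> nat"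
      by simp
    show ?thesis using 0 less.prems(2) unfolding paths.simps[of None a h] * by simp
  next
    case (Suc n)
    have "paths None a h = (\<Sum>i<length a. \<Sum>y<a ! i. paths None (?a i y) (?h i y))
      + (\<Sum>k<h. \<Sum>b\<in>?S. paths (Some b) a k * paths None b (h - Suc k))"
    proof -
      have "\<not> (h = 0 \<and> sum_list a = 0)" using Suc by linarith
      then show ?thesis by (subst paths.simps) auto
    qed
    also have "\<dots> \<le> B ^ Suc n"
    proof (rule sum_moves_le[OF _ _ less.prems])
      fix i y assume iy: "i < length a" "y < a ! i"
      have "sum_list (?a i y) + ?h i y = n" using sum_list_move_split[OF iy, of h] Suc by simp
      then show "paths None (?a i y) (?h i y) \<le> B ^ n"
        using less.hyps[of "?a i y" "?h i y"] less.prems Suc by simp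
    next
      fix k assume k: "k < h"
      have "(\<Sum>b\<in>?S. paths (Some b) a k * paths None b (h - Suc k))
        \<le> (\<Sum>b\<in>?S. paths (Some b) a k * (B ^ sum_list b * B ^ (h - Suc k)))"
        using less.hyps[of _ "h - Suc k"] less.prems k
        by (intro sum_mono mult_le_mono2) (auto simp: bounded_lists_def simp flip: power_add)
      also have "\<dots> = (\<Sum>b\<in>?S. paths (Some b) a k * B ^ sum_list b) * B ^ (h - Suc k)"
        by (simp add: sum_distrib_right mult.assoc)
      also have "\<dots> \<le> B ^ (sum_list a + k) * B ^ (h - Suc k)"
        using less.prems k by (intro mult_le_mono1 sum_paths_Some_le) auto
      also have "\<dots> = B ^ n"
      proof -
        have "sum_list a + k + (h - Suc k) = n" using k Suc by linarith
        then show ?thesis by (simp flip: power_add)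
      qed
      finally show "(\<Sum>b\<in>?S. paths (Some b) a k * paths None b (h - Suc k)) \<le> B ^ n" .
    qed
    finally show ?thesis using Suc by simp
  qed
qed

lemma table_le: "table N d r c \<le> Suc N ^ N"
proof -
  define a where "a = digits (Suc N) d (r div Suc N)"
  define h where "h = r mod Suc N"
  have "paths t a h \<le> Suc N ^ N" if "sum_list a + h \<le> N" for t
  proof -
    have "paths t a h \<le> Suc N ^ (sum_list a + h)"
      using that paths_Some_le[of a h "Suc N"] paths_None_le[of a h "Suc N"] by (cases t) auto
    also have "\<dots> \<le> Suc N ^ N" using that by (intro power_increasing) auto
    finally show ?thesis .
  qed
  then show ?thesis unfolding table_def a_def h_def by (simp add: Let_def)
qed

text \<open>The row number is the code of \<open>n\<close> followed by \<open>d\<close> zeros, and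
  the column is the one of the target \<open>None\<close>.\<close>

lemma card_Av_beta_table:
  assumes "n \<le> N"
  shows "card (Av n (beta d)) = table N d (n * Suc N ^ d) (Suc N ^ d)"
proof -
  define xs where "xs = n # replicate d 0"
  have "code (Suc N) (replicate k 0) = 0" for k by (induction k) auto
  then have "n * Suc N ^ d = code (Suc N) xs" by (simp add: xs_def)
  also have "xs = butlast xs @ [last xs]" by (simp add: xs_def del: butlast.simps last.simps)
  finally have code: "n * Suc N ^ d = code (Suc N) (butlast xs @ [last xs])" .
  have "length (butlast xs) = d" by (simp add: xs_def del: butlast.simps)
  moreover have "sum_list (butlast xs) + last xs \<le> N"
    using assms sum_list_butlast_last[of xs] by (simp add: xs_def sum_list_replicate del: butlast.simps last.simps)
  ultimately show ?thesis
    unfolding code card_Av_beta xs_def[symmetric] by (subst table_code) auto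
qed

section \<open>Hoare logic with costs\<close>

fun block :: "instr list \<Rightarrow> com" where
  "block [] = Skip"
| "block (i # is) = Seq (Do i) (block is)"

text \<open>The integer that an instruction writes, with 0 for a test; bounding it keeps a bounded
  state bounded.\<close>

fun computed :: "instr \<Rightarrow> state \<Rightarrow> int" where
  "computed (Const i c) s = c"
| "computed (Add i j k) s = s (Reg j) + s (Reg k)"
| "computed (Sub i j k) s = s (Reg j) - s (Reg k)"
| "computed (Mult i j k) s = s (Reg j) * s (Reg k)"
| "computed (Load i j) s = s (Cell (s (Reg j)))"
| "computed (Store i j) s = s (Reg j)"
| "computed (Test i) s = 0"

text \<open>\<open>L\<close> is the set of locations that a run may touch, \<open>V\<close> a bound
  for the absolute values of their contents. With both inside the logic, one proof of the program
  yields storage, size of integers and bit costs together.\<close>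

locale bounded_machine =
  fixes L :: "loc set" and V :: int
begin

definition bounded :: "state \<Rightarrow> bool" where
  "bounded s \<longleftrightarrow> (\<forall>l\<in>L. \<bar>s l\<bar> \<le> V)"

definition admissible :: "instr \<times> state \<Rightarrow> bool" where
  "admissible = (\<lambda>(i, s). bounded s \<and> instr_locs i s \<subseteq> L \<and> \<bar>computed i s\<bar> \<le> V)"

definition triple :: "(state \<Rightarrow> bool) \<Rightarrow> com \<Rightarrow> nat \<Rightarrow> (state \<Rightarrow> bool) \<Rightarrow> bool" where
  "triple P c n Q \<longleftrightarrow> (\<forall>s. bounded s \<and> P s \<longrightarrow>
     (\<exists>tr t. exec c s tr t \<and> length tr \<le> n \<and> (\<forall>x\<in>set tr. admissible x) \<and> bounded t \<and> Q t))"

text \<open>Weakest precondition of straight-line code, in a form that the simplifier evaluates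
  instruction by instruction.\<close>

fun run_block :: "instr list \<Rightarrow> (state \<Rightarrow> bool) \<Rightarrow> state \<Rightarrow> bool" where
  "run_block [] Q s \<longleftrightarrow> Q s"
| "run_block (i # is) Q s \<longleftrightarrow>
     instr_locs i s \<subseteq> L \<and> \<bar>computed i s\<bar> \<le> V \<and> run_block is Q (effect i s)"

lemma tripleD:
  assumes "triple P c n Q" "bounded s" "P s"
  obtains tr t where "exec c s tr t" "length tr \<le> n" "\<forall>x\<in>set tr. admissible x" "bounded t" "Q t"
  using assms unfolding triple_def by blast

lemma bounded_effect: "bounded s \<Longrightarrow> \<bar>computed i s\<bar> \<le> V \<Longrightarrow> bounded (effect i s)"
  by (cases i) (auto simp: bounded_def)

lemma triple_block:
  assumes "\<And>s. P s \<Longrightarrow> bounded s \<Longrightarrow> run_block is Q s" "length is \<le> n"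
  shows "triple P (block is) n Q"
proof -
  have "\<exists>tr t. exec (block is) s tr t \<and> length tr = length is \<and> (\<forall>x\<in>set tr. admissible x) \<and> bounded t \<and> Q t"
    if "bounded s" "run_block is Q s" for s
    using that
  proof (induction "is" arbitrary: s)
    case Nil
    then show ?case by (auto intro: exec.Skip)
  next
    case (Cons i "is")
    then have "bounded (effect i s)" by (auto intro: bounded_effect)
    with Cons.prems Cons.IH[of "effect i s"] obtain tr t where
      "exec (block is) (effect i s) tr t" "length tr = length is" "\<forall>x\<in>set tr. admissible x" "bounded t" "Q t"
      by auto
    moreover have "exec (block (i # is)) s ([(i, s)] @ tr) t"
      unfolding block.simps using exec.Seq[OF exec.Do[of i s] calculation(1)] .
    moreover have "admissible (i, s)" using Cons.prems by (simp add: admissible_def)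
    ultimately show ?case by (intro exI[of _ "[(i, s)] @ tr"] exI[of _ t]) simp
  qed
  note run = this
  show ?thesis unfolding triple_def
  proof (intro allI impI)
    fix s assume "bounded s \<and> P s"
    then show "\<exists>tr t. exec (block is) s tr t \<and> length tr \<le> n \<and> (\<forall>x\<in>set tr. admissible x) \<and> bounded t \<and> Q t"
      using run[of s] assms by (metis order_refl order_trans)
  qed
qed

lemma triple_Skip: "(\<And>s. P s \<Longrightarrow> Q s) \<Longrightarrow> triple P Skip n Q"
  unfolding triple_def by (intro allI impI exI[of _ "[]"], rule_tac x=s in exI) (auto intro: exec.Skip)

lemma triple_weaken:
  assumes "triple P c n Q" "\<And>s. P' s \<Longrightarrow> P s" "\<And>s. Q s \<Longrightarrow> Q' s" "n \<le> n'"
  shows "triple P' c n' Q'"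
  unfolding triple_def
proof (intro allI impI)
  fix s assume "bounded s \<and> P' s"
  then obtain tr t where "exec c s tr t" "length tr \<le> n" "\<forall>x\<in>set tr. admissible x" "bounded t" "Q t"
    using tripleD[OF assms(1), of s] assms(2) by blast
  with assms(3,4) show "\<exists>tr t. exec c s tr t \<and> length tr \<le> n' \<and> (\<forall>x\<in>set tr. admissible x) \<and> bounded t \<and> Q' t"
    by (meson order_trans)
qed

lemma triple_Seq:
  assumes "triple P c1 n1 Q" "triple Q c2 n2 R" "n1 + n2 \<le> n"
  shows "triple P (Seq c1 c2) n R"
  unfolding triple_def
proof (intro allI impI)
  fix s assume "bounded s \<and> P s"
  then obtain tr1 s' where 1: "exec c1 s tr1 s'" "length tr1 \<le> n1" "\<forall>x\<in>set tr1. admissible x" "bounded s'" "Q s'"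
    using tripleD[OF assms(1), of s] by blast
  then obtain tr2 t where 2: "exec c2 s' tr2 t" "length tr2 \<le> n2" "\<forall>x\<in>set tr2. admissible x" "bounded t" "R t"
    using tripleD[OF assms(2), of s'] by blast
  show "\<exists>tr t. exec (Seq c1 c2) s tr t \<and> length tr \<le> n \<and> (\<forall>x\<in>set tr. admissible x) \<and> bounded t \<and> R t"
    using 1 2 assms(3) by (intro exI[of _ "tr1 @ tr2"] exI[of _ t]) (auto intro: exec.Seq)
qed

lemma triple_Cond:
  assumes "Reg i \<in> L" "0 \<le> V"
    "triple (\<lambda>s. P s \<and> s (Reg i) > 0) c1 n Q" "triple (\<lambda>s. P s \<and> s (Reg i) \<le> 0) c2 n Q" "Suc n \<le> n'"
  shows "triple P (Cond i c1 c2) n' Q"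
  unfolding triple_def
proof (intro allI impI)
  fix s assume s: "bounded s \<and> P s"
  then have adm: "admissible (Test i, s)" using assms(1,2) by (simp add: admissible_def)
  show "\<exists>tr t. exec (Cond i c1 c2) s tr t \<and> length tr \<le> n' \<and> (\<forall>x\<in>set tr. admissible x) \<and> bounded t \<and> Q t"
  proof (cases "s (Reg i) > 0")
    case True
    then obtain tr t where "exec c1 s tr t" "length tr \<le> n" "\<forall>x\<in>set tr. admissible x" "bounded t" "Q t"
      using s tripleD[OF assms(3), of s] by blast
    then show ?thesis using adm True assms(5)
      by (intro exI[of _ "(Test i, s) # tr"] exI[of _ t]) (auto intro: exec.CondTrue)
  next
    case False
    then obtain tr t where "exec c2 s tr t" "length tr \<le> n" "\<forall>x\<in>set tr. admissible x" "bounded t" "Q t"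
      using s tripleD[OF assms(4), of s] by (auto simp: not_less)
    then show ?thesis using adm False assms(5)
      by (intro exI[of _ "(Test i, s) # tr"] exI[of _ t]) (auto intro: exec.CondFalse)
  qed
qed

text \<open>The number \<open>m\<close> of rounds is fixed in advance. Each round costs one test
  besides its body; the failing test at the end is the \<open>+ 1\<close>.\<close>

lemma triple_While:
  assumes "Reg i \<in> L" "0 \<le> V"
    and step: "\<And>k. k < m \<Longrightarrow> triple (I k) c n (I (Suc k))"
    and guard: "\<And>k s. k \<le> m \<Longrightarrow> I k s \<Longrightarrow> s (Reg i) > 0 \<longleftrightarrow> k < m"
    and n': "m * Suc n + 1 \<le> n'"
  shows "triple (I 0) (While i c) n' (I m)"
proof -
  have *: "\<exists>tr t. exec (While i c) s tr t \<and> length tr \<le> (m - k) * Suc n + 1 \<and>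
      (\<forall>x\<in>set tr. admissible x) \<and> bounded t \<and> I m t"
    if "bounded s" "I k s" "k \<le> m" for k s
    using that
  proof (induction "m - k" arbitrary: k s)
    case 0
    then have "k = m" by simp
    moreover have "admissible (Test i, s)" using assms(1,2) 0 by (simp add: admissible_def)
    ultimately show ?case
      using guard[of m s] 0 by (intro exI[of _ "[(Test i, s)]"] exI[of _ s]) (auto intro: exec.WhileFalse)
  next
    case (Suc j)
    then have k: "k < m" by simp
    have adm: "admissible (Test i, s)" using assms(1,2) Suc by (simp add: admissible_def)
    obtain tr1 s' where 1: "exec c s tr1 s'" "length tr1 \<le> n" "\<forall>x\<in>set tr1. admissible x" "bounded s'" "I (Suc k) s'"
      using tripleD[OF step[OF k] Suc.prems(1,2)] by blast
    have "j = m - Suc k" using Suc.hyps(2) by simp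
    then obtain tr2 t where 2: "exec (While i c) s' tr2 t" "length tr2 \<le> (m - Suc k) * Suc n + 1"
      "\<forall>x\<in>set tr2. admissible x" "bounded t" "I m t"
      using Suc.hyps(1)[OF _ 1(4,5)] k by auto
    have "(m - k) * Suc n = (m - Suc k) * Suc n + Suc n"
      using k by (simp flip: Suc_diff_Suc)
    then have "length ((Test i, s) # tr1 @ tr2) \<le> (m - k) * Suc n + 1"
      using 1 2 by simp
    moreover have "exec (While i c) s ((Test i, s) # tr1 @ tr2) t"
      using 1 2 guard[of k s] Suc.prems k by (intro exec.WhileTrue) auto
    ultimately show ?case using 1 2 adm
      by (intro exI[of _ "(Test i, s) # tr1 @ tr2"] exI[of _ t]) auto
  qed
  show ?thesis unfolding triple_def
  proof (intro allI impI)
    fix s assume "bounded s \<and> I 0 s"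
    then obtain tr t where t: "exec (While i c) s tr t" "length tr \<le> (m - 0) * Suc n + 1"
        "\<forall>x\<in>set tr. admissible x" "bounded t" "I m t"
      using *[of s 0] by blast
    then have "length tr \<le> n'" using n' by simp
    with t show "\<exists>tr t. exec (While i c) s tr t \<and> length tr \<le> n' \<and> (\<forall>x\<in>set tr. admissible x) \<and> bounded t \<and> I m t"
      by blast
  qed
qed

end

section \<open>The program\<close>

definition weight_reg :: "nat \<Rightarrow> nat" where
  "weight_reg j = 30 + j"

lemma weight_reg_neq [simp]: "k < 30 \<Longrightarrow> weight_reg j \<noteq> k" "k < 30 \<Longrightarrow> k \<noteq> weight_reg j"
  by (auto simp: weight_reg_def)

lemma weight_reg_inj [simp]: "weight_reg i = weight_reg j \<longleftrightarrow> i = j"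
  by (simp add: weight_reg_def)

abbreviation (input) "rN \<equiv> 0 :: nat"
abbreviation (input) "rBase \<equiv> 2 :: nat"
abbreviation (input) "rWidth \<equiv> 3 :: nat"
abbreviation (input) "rZero \<equiv> 4 :: nat"
abbreviation (input) "rOne \<equiv> 29 :: nat"
abbreviation (input) "rRow \<equiv> 5 :: nat"
abbreviation (input) "rRows \<equiv> 6 :: nat"
abbreviation (input) "rCol \<equiv> 7 :: nat"
abbreviation (input) "rCols \<equiv> 8 :: nat"
abbreviation (input) "rAcc \<equiv> 9 :: nat"
abbreviation (input) "rRem \<equiv> 10 :: nat"
abbreviation (input) "rSum \<equiv> 11 :: nat"
abbreviation (input) "rPos \<equiv> 12 :: nat"
abbreviation (input) "rGuard \<equiv> 13 :: nat"
abbreviation (input) "rA \<equiv> 14 :: nat"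
abbreviation (input) "rX \<equiv> 15 :: nat"
abbreviation (input) "rY \<equiv> 16 :: nat"
abbreviation (input) "rK \<equiv> 17 :: nat"
abbreviation (input) "rE \<equiv> 18 :: nat"
abbreviation (input) "rFst \<equiv> 19 :: nat"
abbreviation (input) "rQ \<equiv> 20 :: nat"
abbreviation (input) "rTop \<equiv> 21 :: nat"

text \<open>
  The entry in row \<open>r\<close> and column \<open>c\<close> of the table is stored in cell \<open>r * W + c + b\<close>, where \<open>b = N + 1\<close>
  and \<open>W\<close> is the number of columns, so that the cells \<open>0, \<dots>, N\<close> are left for the output.
  Register \<open>weight_reg j\<close> holds \<open>b ^ (d - j)\<close>. The remainder of the row index modulo the weights yields
  its digits without a division instruction.
\<close>

definition address :: "nat \<Rightarrow> nat \<Rightarrow> nat \<Rightarrow> instr list" where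
  "address i row col = [Mult i row rWidth, Add i i col, Add i i rBase]"

text \<open>One loop does two things: subtracting the weight until the remainder drops below it
  takes as many rounds as digit \<open>j\<close> has units, and round \<open>y\<close> visits the
  row reached by the move with parameter \<open>y\<close>. \<open>rPos\<close> follows that row by
  one subtraction and one addition per round.\<close>

definition low_part :: "nat \<Rightarrow> com" where
  "low_part j = Seq
     (block [Sub rPos rRow (weight_reg j), Sub rGuard rRem (weight_reg j), Add rGuard rGuard rOne])
     (While rGuard (block (address rA rPos rCol @
        [Load rX rA, Add rAcc rAcc rX, Sub rRem rRem (weight_reg j), Add rSum rSum rOne,
         Sub rPos rPos (weight_reg j), Add rPos rPos (weight_reg (Suc j)), Sub rGuard rGuard (weight_reg j)])))"

primrec low_parts :: "nat \<Rightarrow> com" where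
  "low_parts 0 = Skip"
| "low_parts (Suc j) = Seq (low_parts j) (low_part j)"

definition high_part :: com where
  "high_part = Seq (block [Add rK rRem rZero, Sub rTop rRow rRem])
     (While rK (Seq
        (block [Sub rK rK rOne, Add rFst rTop rK, Mult rFst rFst rWidth, Add rFst rFst rBase,
                Sub rQ rRem rK, Sub rQ rQ rOne, Add rE (weight_reg 0) rZero])
        (While rE (block ([Sub rE rE rOne, Add rA rFst rE, Load rX rA, Mult rA rE rBase, Add rA rA rQ]
           @ address rA rA rCol @ [Load rY rA, Mult rX rX rY, Add rAcc rAcc rX])))))"

text \<open>The machine tests only for positivity, so \<open>r = c * b\<close> is tested as
  \<open>1 - (r - c * b) ^ 2 > 0\<close>. For a proper target, the sum of the moves is discarded,
  since an exhausted level stops at once; for \<open>None\<close>, the completed reading adds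
  1.\<close>

definition base_part :: com where
  "base_part = Seq (block [Sub rGuard (weight_reg 0) rCol]) (Cond rGuard
     (Seq (block [Const rAcc 0, Mult rX rCol rBase, Sub rX rRow rX, Mult rX rX rX, Sub rX rOne rX])
        (Cond rX (block [Const rAcc 1]) Skip))
     (Cond rRow Skip (block [Add rAcc rAcc rOne])))"

text \<open>The moves are summed before the sum of the digits is known, since the same loops produce
  the digits; the result is discarded if the sum exceeds \<open>N\<close>.\<close>

definition entry :: "nat \<Rightarrow> com" where
  "entry d = Seq (block [Const rAcc 0, Const rSum 0, Add rRem rRow rZero])
     (Seq (low_parts d)
     (Seq (block [Add rSum rSum rRem, Sub rGuard rBase rSum])
     (Seq (Cond rGuard (Cond rRem high_part base_part) (block [Const rAcc 0]))
          (block (address rA rRow rCol @ [Store rA rAcc])))))"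

definition fill :: "nat \<Rightarrow> com" where
  "fill d = Seq (block [Const rRow 0, Mult rRows (weight_reg 0) rBase])
     (While rRows (Seq (block [Const rCol 0, Add rCols rWidth rZero])
        (Seq (While rCols (Seq (entry d) (block [Add rCol rCol rOne, Sub rCols rCols rOne])))
             (block [Add rRow rRow rOne, Sub rRows rRows rOne]))))"

definition output_part :: com where
  "output_part = Seq (block [Add rK rBase rZero])
     (While rK (block ([Sub rK rK rOne, Mult rX rK (weight_reg 0)] @ address rA rX (weight_reg 0) @
        [Load rY rA, Store rK rY])))"

primrec weights :: "nat \<Rightarrow> nat \<Rightarrow> com" where
  "weights d 0 = block [Const rOne 1, Const rZero 0, Add rBase rN rOne, Const (weight_reg d) 1]"
| "weights d (Suc k) = Seq (weights d k) (block [Mult (weight_reg (d - Suc k)) (weight_reg (d - k)) rBase])"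

definition program :: "nat \<Rightarrow> com" where
  "program d = Seq (weights d d) (Seq (block [Add rWidth (weight_reg 0) rOne]) (Seq (fill d) output_part))"

section \<open>Correctness, running time and value bounds of the program\<close>

definition filled :: "nat \<Rightarrow> nat \<Rightarrow> nat \<Rightarrow> nat \<Rightarrow> nat" where
  "filled N d n q = (if q < n then table N d (q div Suc (Suc N ^ d)) (q mod Suc (Suc N ^ d)) else 0)"

definition cells :: "nat \<Rightarrow> nat \<Rightarrow> loc set" where
  "cells d m = {Reg i | i. i < 31 + d} \<union> {Cell z | z. 0 \<le> z \<and> z < int m}"

text \<open>Origin of the summands below \<open>V\<close>: the first two cover addresses and
  counters, \<open>d * b * F\<close> the sum of the moves, \<open>b * P * (F * F)\<close> the
  convolution, \<open>F * F\<close> a single product, \<open>b * P * (b * P)\<close> the square in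
  the test for equality; 3 leaves room for small offsets.\<close>

locale counting =
  fixes N d b P W F :: nat and V :: int
  assumes b: "b = Suc N" and P: "P = b ^ d" and W: "W = Suc P"
    and V: "int (2 * (b * P * W) + 2 * b + d * b * F + b * P * (F * F) + F * F + b * P * (b * P) + 3) \<le> V"
    and F: "F \<ge> 1"
begin

sublocale bounded_machine "cells d (b + b * P * W)" V .

lemma int_le_V:
  "n \<le> 2 * (b * P * W) + 2 * b + d * b * F + b * P * (F * F) + F * F + b * P * (b * P) + 3 \<Longrightarrow> int n \<le> V"
  using V by linarith

lemma V_nonneg: "0 \<le> V"
  using int_le_V[of 0] by simp

lemma bP_le: "b * P \<le> b * P * W" "P \<le> b * P"
  by (simp_all add: b W)

lemma pos: "b > 0" "P > 0" "W > 0"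
  by (simp_all add: b P W)

lemma Reg_in_cells [simp]: "i < 30 \<Longrightarrow> Reg i \<in> cells d m" "j \<le> d \<Longrightarrow> Reg (weight_reg j) \<in> cells d m"
  by (auto simp: cells_def weight_reg_def)

definition setting :: "state \<Rightarrow> bool" where
  "setting s \<longleftrightarrow> s (Reg rN) = int N \<and> s (Reg rOne) = 1 \<and> s (Reg rBase) = int b \<and>
     s (Reg rWidth) = int W \<and> s (Reg rZero) = 0 \<and> (\<forall>j\<le>d. s (Reg (weight_reg j)) = int (b ^ (d - j)))"

definition mem :: "(nat \<Rightarrow> nat) \<Rightarrow> state \<Rightarrow> bool" where
  "mem f s \<longleftrightarrow> (\<forall>q<b * P * W. s (Cell (int q + int b)) = int (f q))"

lemma setting_Reg [simp]: "5 \<le> i \<Longrightarrow> i < 29 \<Longrightarrow> setting (s(Reg i := v)) = setting s"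
  by (auto simp: setting_def)

lemma setting_Cell [simp]: "setting (s(Cell z := v)) = setting s"
  by (auto simp: setting_def)

lemma mem_Reg [simp]: "mem f (s(Reg i := v)) = mem f s"
  by (auto simp: mem_def)

lemma settingD:
  assumes "setting s"
  shows "s (Reg rN) = int N" "s (Reg rOne) = 1" "s (Reg rBase) = int b" "s (Reg rWidth) = int W"
    "s (Reg rZero) = 0" "s (Reg (weight_reg 0)) = int P"
    "j \<le> d \<Longrightarrow> s (Reg (weight_reg j)) = int (b ^ (d - j))"
  using assms by (auto simp: setting_def P)

lemma row_col_less: "r < b * P \<Longrightarrow> c \<le> P \<Longrightarrow> r * W + c < b * P * W"
proof -
  assume "r < b * P" "c \<le> P"
  then have "r * W + c < Suc r * W" using W by simp
  also have "\<dots> \<le> b * P * W" using \<open>r < b * P\<close> by (intro mult_le_mono1) simp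
  finally show ?thesis .
qed

lemma address:
  assumes "r < b * P" "c \<le> P"
  shows "int r * int W \<le> V" "int r * int W + int c \<le> V" "int r * int W + int c + int b \<le> V"
    "Cell (int r * int W + int c + int b) \<in> cells d (b + b * P * W)"
    "mem f s \<Longrightarrow> s (Cell (int r * int W + int c + int b)) = int (f (r * W + c))"
proof -
  note less = row_col_less[OF assms]
  then have "int (r * W) \<le> V" "int (r * W + c) \<le> V" "int (r * W + c + b) \<le> V"
    by (intro int_le_V; linarith)+
  then show "int r * int W \<le> V" "int r * int W + int c \<le> V" "int r * int W + int c + int b \<le> V"
    by simp_all
  have "int (r * W + c) < int (b * P * W)" using less by linarith
  then show "Cell (int r * int W + int c + int b) \<in> cells d (b + b * P * W)"
    by (simp add: cells_def)
  show "mem f s \<Longrightarrow> s (Cell (int r * int W + int c + int b)) = int (f (r * W + c))"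
    using less unfolding mem_def by (metis of_nat_add of_nat_mult)
qed

definition digit :: "nat \<Rightarrow> nat \<Rightarrow> nat" where
  "digit r j = r div b ^ (d - j) mod b"

definition low_sum :: "(nat \<Rightarrow> nat) \<Rightarrow> nat \<Rightarrow> nat \<Rightarrow> nat \<Rightarrow> nat" where
  "low_sum f r c j = (\<Sum>i<j. \<Sum>y<digit r i. f ((r - Suc y * b ^ (d - i) + y * b ^ (d - Suc i)) * W + c))"

definition high_sum :: "(nat \<Rightarrow> nat) \<Rightarrow> nat \<Rightarrow> nat \<Rightarrow> nat" where
  "high_sum f r c = (\<Sum>k<r mod b. \<Sum>e<P. f ((r - r mod b + k) * W + e) * f ((e * b + (r mod b - Suc k)) * W + c))"

lemma digit_less: "digit r j < b"
  using pos by (simp add: digit_def)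

lemma low_sum_le:
  assumes "\<And>q. f q \<le> F"
  shows "low_sum f r c j \<le> j * b * F"
proof (induction j)
  case (Suc j)
  have "(\<Sum>y<digit r j. f ((r - Suc y * b ^ (d - j) + y * b ^ (d - Suc j)) * W + c)) \<le> digit r j * F"
    using sum_bounded_above[of "{..<digit r j}" _ F] assms by auto
  also have "\<dots> \<le> b * F" using digit_less[of r j] by (intro mult_le_mono1) simp
  finally show ?case using Suc by (simp add: low_sum_def algebra_simps)
qed (simp add: low_sum_def)

lemma digit_sum_le: "(\<Sum>i<j. digit r i) \<le> j * b"
  using sum_bounded_above[of "{..<j}" "digit r" b] digit_less[of r] by (auto simp: less_imp_le)

definition ready :: "(nat \<Rightarrow> nat) \<Rightarrow> nat \<Rightarrow> nat \<Rightarrow> int \<Rightarrow> int \<Rightarrow> state \<Rightarrow> bool" where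
  "ready f r c x y s \<longleftrightarrow> setting s \<and> mem f s \<and> s (Reg rRow) = int r \<and> s (Reg rCol) = int c
     \<and> s (Reg rRows) = x \<and> s (Reg rCols) = y"

lemma ready_Reg [simp]: "9 \<le> i \<Longrightarrow> i < 29 \<Longrightarrow> ready f r c x y (s(Reg i := v)) = ready f r c x y s"
  by (auto simp: ready_def)

lemma readyD:
  assumes "ready f r c x y s"
  shows "setting s" "mem f s" "s (Reg rRow) = int r" "s (Reg rCol) = int c"
  using assms by (auto simp: ready_def)

definition low_inv :: "(nat \<Rightarrow> nat) \<Rightarrow> nat \<Rightarrow> nat \<Rightarrow> int \<Rightarrow> int \<Rightarrow> nat \<Rightarrow> state \<Rightarrow> bool" where
  "low_inv f r c x y j s \<longleftrightarrow> ready f r c x y s \<and> s (Reg rRem) = int (r mod b ^ (Suc d - j)) \<and>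
     s (Reg rAcc) = int (low_sum f r c j) \<and> s (Reg rSum) = int (\<Sum>i<j. digit r i)"

text \<open>A digit is less than \<open>b\<close>, and each of its rounds costs ten instructions and
  a test; three initial instructions and the final test make up the 4.\<close>

lemma low_part:
  assumes r: "r < b * P" and c: "c \<le> P" and f: "\<And>q. f q \<le> F" and j: "j < d"
  shows "triple (low_inv f r c x y j) (low_part j) (11 * b + 4) (low_inv f r c x y (Suc j))"
proof -
  define w where "w = b ^ (d - j)"
  define w' where "w' = b ^ (d - Suc j)"
  define \<rho> where "\<rho> = r mod b ^ (Suc d - j)"
  define D where "D = digit r j"
  have w: "w = b * w'" using j by (simp add: w_def w'_def Suc_diff_Suc flip: power_Suc)
  have bw: "b ^ (Suc d - j) = b * w" using j by (simp add: w_def Suc_diff_le)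
  have w0: "w > 0" "w' > 0" using pos by (simp_all add: w_def w'_def)
  have D: "D = \<rho> div w" "\<rho> mod w = r mod w" "D < b"
    using pos w0 by (simp_all add: D_def digit_def \<rho>_def bw w_def[symmetric] mult.commute[of b] mod_mult2_eq)
  have \<rho>: "\<rho> \<le> r" by (simp add: \<rho>_def)
  have wP: "w \<le> P" using pos by (simp add: w_def P power_increasing)
  define A where "A = (\<lambda>k. low_sum f r c j + (\<Sum>y<k. f ((r - Suc y * w + y * w') * W + c)))"
  define S where "S = (\<Sum>i<j. digit r i)"
  have A_D: "A D = low_sum f r c (Suc j)"
    by (simp add: A_def low_sum_def D_def w_def w'_def)
  have djF: "Suc j * b * F \<le> d * b * F" using j by (intro mult_le_mono) auto
  have A_le: "int (A k) \<le> V" if "k \<le> D" for k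
  proof (rule int_le_V)
    have "A k \<le> A D" using that unfolding A_def by (intro add_left_mono sum_mono2) auto
    also have "\<dots> \<le> Suc j * b * F" using low_sum_le[of f r c "Suc j"] f A_D by simp
    finally show "A k \<le> 2 * (b * P * W) + 2 * b + d * b * F + b * P * (F * F) + F * F + b * P * (b * P) + 3"
      using djF by linarith
  qed
  have S_le: "int (S + D) \<le> V"
  proof (rule int_le_V)
    have "S + D \<le> Suc j * b" using digit_sum_le[of r "Suc j"] by (simp add: S_def D_def)
    also have "\<dots> \<le> Suc j * b * F" using F by simp
    finally show "S + D \<le> 2 * (b * P * W) + 2 * b + d * b * F + b * P * (F * F) + F * F + b * P * (b * P) + 3"
      using djF by linarith
  qed
  have rV: "int (r + P + 3 + b) \<le> V"
    using r bP_le by (intro int_le_V) linarith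
  \<comment> \<open>The equations are over the integers, since after the last round the position and
    the guard may be negative.\<close>
  define I where "I = (\<lambda>k s. ready f r c x y s \<and> s (Reg rRem) = int \<rho> - int k * int w \<and>
     s (Reg rAcc) = int (A k) \<and> s (Reg rSum) = int S + int k \<and>
     s (Reg rPos) = int r - (int k + 1) * int w + int k * int w' \<and>
     s (Reg rGuard) = int \<rho> - (int k + 1) * int w + 1)"
  let ?body = "address rA rPos rCol @
        [Load rX rA, Add rAcc rAcc rX, Sub rRem rRem (weight_reg j), Add rSum rSum rOne,
         Sub rPos rPos (weight_reg j), Add rPos rPos (weight_reg (Suc j)), Sub rGuard rGuard (weight_reg j)]"
  have step: "triple (I k) (block ?body) 10 (I (Suc k))" if k: "k < D" for k
  proof (rule triple_block)
    fix s assume I: "I k s"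
    then have at: "ready f r c x y s" by (simp add: I_def)
    note st = readyD[OF at] settingD[OF readyD(1)[OF at]]
    have wj: "s (Reg (weight_reg j)) = int w" "s (Reg (weight_reg (Suc j))) = int w'"
      using st(11)[of j] st(11)[of "Suc j"] j by (simp_all add: w_def w'_def)
    define p where "p = r - Suc k * w + k * w'"
    have kw: "Suc k * w \<le> \<rho>"
      using k w0 by (simp add: D less_eq_div_iff_mult_less_eq Suc_le_eq[symmetric])
    have kw': "k * w' \<le> k * w" using w pos by simp
    have p: "s (Reg rPos) = int p"
      using I kw \<rho> by (simp add: I_def p_def of_nat_diff algebra_simps)
    have "p < r" using kw kw' \<rho> w0 unfolding p_def mult_Suc by linarith
    then have "p < b * P" using r by simp
    note adr = address[OF this c]
    have A: "A (Suc k) = A k + f (p * W + c)" by (simp add: A_def p_def)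
    have regs: "s (Reg rRem) = int \<rho> - int k * int w" "s (Reg rAcc) = int (A k)" "s (Reg rSum) = int S + int k"
      "s (Reg rGuard) = int \<rho> - (int k + 1) * int w + 1"
      using I by (simp_all add: I_def)
    have p_eq: "int p = int r - (int k + 1) * int w + int k * int w'"
      using I p by (simp add: I_def)
    have "int (Suc k) * int w \<le> int \<rho>" using kw by (metis of_nat_le_iff of_nat_mult)
    then have kw_int: "0 \<le> int \<rho> - int k * int w - int w" by (simp add: algebra_simps)
    have kw_nn: "0 \<le> int k * int w" "int k * int w + int w = (int k + 1) * int w"
      by (simp_all add: algebra_simps)
    have w': "w' \<le> P" using wP w pos by (simp add: le_trans[of w' "b * w'" P])
    have AV: "int (A k) + int (f (p * W + c)) \<le> V" "int (f (p * W + c)) \<le> V"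
      using A_le[of "Suc k"] k by (simp_all add: A)
    have SV: "int S + int k + 1 \<le> V" using S_le k by simp
    have bnds: "\<bar>int \<rho> - int k * int w - int w\<bar> \<le> V" "\<bar>int p - int w\<bar> \<le> V" "\<bar>int p - int w + int w'\<bar> \<le> V"
      "\<bar>int \<rho> - (int k + 1) * int w + 1 - int w\<bar> \<le> V"
      using rV \<open>p < r\<close> wP w' kw_int kw_nn \<rho> by linarith+
    show "run_block ?body (I (Suc k)) s"
      using j
      by (simp add: address_def adr(1-4) adr(5)[OF st(2)] st(3-11) p wj regs AV SV bnds del: of_nat_add)
         (simp add: I_def A p_eq at algebra_simps)
  qed (simp add: address_def)
  show ?thesis unfolding low_part_def
  proof (rule triple_Seq)
    show "triple (low_inv f r c x y j) (block [Sub rPos rRow (weight_reg j), Sub rGuard rRem (weight_reg j), Add rGuard rGuard rOne])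
       3 (I 0)"
    proof (rule triple_block)
      fix s assume s: "low_inv f r c x y j s"
      then have at: "ready f r c x y s" by (simp add: low_inv_def)
      note st = readyD[OF at] settingD[OF readyD(1)[OF at]]
      have "s (Reg rRem) = int \<rho>" "s (Reg (weight_reg j)) = int w" "s (Reg rAcc) = int (A 0)" "s (Reg rSum) = int S"
        using s j st(11)[of j] by (simp_all add: low_inv_def \<rho>_def w_def A_def S_def)
      then show "run_block [Sub rPos rRow (weight_reg j), Sub rGuard rRem (weight_reg j), Add rGuard rGuard rOne] (I 0) s"
        using j st(3-10) at rV \<rho> wP by (simp add: I_def abs_le_iff)
    qed simp
    show "triple (I 0) (While rGuard (block ?body)) (D * Suc 10 + 1) (low_inv f r c x y (Suc j))"
    proof (rule triple_weaken[OF triple_While[where I = I and m = D and n = 10]])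
      fix k s assume k: "k \<le> D" "I k s"
      have "(Suc k * w \<le> \<rho>) \<longleftrightarrow> k < D"
        using w0 by (simp add: D less_eq_div_iff_mult_less_eq Suc_le_eq[symmetric])
      moreover have "Suc k * w \<le> \<rho> \<longleftrightarrow> int (Suc k) * int w \<le> int \<rho>"
        by (metis of_nat_le_iff of_nat_mult)
      ultimately show "s (Reg rGuard) > 0 \<longleftrightarrow> k < D"
        using k by (auto simp: I_def algebra_simps)
    next
      fix s assume s: "I D s"
      have "int \<rho> - int D * int w = int (r mod w)"
        unfolding D(2)[symmetric] D(1) by (simp add: minus_div_mult_eq_mod[symmetric] zdiv_int of_nat_diff)
      then show "low_inv f r c x y (Suc j) s"
        using s A_D j by (simp add: I_def low_inv_def w_def S_def D_def)
    qed (use V_nonneg step in auto)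
    show "3 + (D * Suc 10 + 1) \<le> 11 * b + 4" using D by simp
  qed
qed

lemma low_parts:
  assumes "r < b * P" "c \<le> P" "\<And>q. f q \<le> F" "j \<le> d"
  shows "triple (low_inv f r c x y 0) (low_parts j) (j * (11 * b + 4)) (low_inv f r c x y j)"
  using assms(4)
proof (induction j)
  case 0
  then show ?case by (auto intro: triple_Skip)
next
  case (Suc j)
  then show ?case
    unfolding low_parts.simps
    by (intro triple_Seq[OF Suc.IH low_part[OF assms(1-3)]]) auto
qed

definition acc_inv :: "(nat \<Rightarrow> nat) \<Rightarrow> nat \<Rightarrow> nat \<Rightarrow> int \<Rightarrow> int \<Rightarrow> nat \<Rightarrow> state \<Rightarrow> bool" where
  "acc_inv f r c x y z s \<longleftrightarrow> ready f r c x y s \<and> s (Reg rRem) = int (r mod b) \<and> s (Reg rAcc) = int z"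

lemma high_part:
  assumes r: "r < b * P" and c: "c \<le> P" and f: "\<And>q. f q \<le> F" and z: "z \<le> d * b * F"
  shows "triple (acc_inv f r c x y z) high_part (b * (12 * P + 9) + 3) (acc_inv f r c x y (z + high_sum f r c))"
proof -
  define h where "h = r mod b"
  define H where "H = (\<lambda>k e. f ((r - h + (h - Suc k)) * W + e) * f ((e * b + k) * W + c))"
  define A where "A = (\<lambda>k. z + (\<Sum>k'<k. \<Sum>e<P. H k' (P - Suc e)))"
  have h: "h < b" "h \<le> r" using pos by (simp_all add: h_def)
  \<comment> \<open>Both loops of the program run downwards; two reversals restore the order of
    \<open>high_sum\<close>.\<close>
  have "(\<Sum>k<h. \<Sum>e<P. H k (P - Suc e)) = (\<Sum>k<h. \<Sum>e<P. H k e)"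
    by (simp add: sum.nat_diff_reindex)
  also have "\<dots> = (\<Sum>k<h. \<Sum>e<P. H (h - Suc k) e)"
    by (rule sum.nat_diff_reindex[symmetric])
  also have "\<dots> = high_sum f r c"
    unfolding high_sum_def h_def[symmetric]
    by (intro sum.cong refl) (simp add: H_def)
  finally have A_h: "A h = z + high_sum f r c" by (simp add: A_def)
  define B where "B = (\<lambda>k e. A k + (\<Sum>e'<e. H k (P - Suc e')))"
  have B_P: "B k P = A (Suc k)" for k by (simp add: B_def A_def)
  have H_le: "H k e \<le> F * F" for k e unfolding H_def using f by (intro mult_le_mono) auto
  have B_le: "int (B k e) \<le> V" if "k < h" "e \<le> P" for k e
  proof (rule int_le_V)
    have "B k e \<le> B k P" using that unfolding B_def by (intro add_left_mono sum_mono2) auto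
    also have "\<dots> \<le> A h" unfolding B_P A_def using that by (intro add_left_mono sum_mono2) auto
    also have "(\<Sum>k'<h. \<Sum>e<P. H k' (P - Suc e)) \<le> (\<Sum>k'<h. \<Sum>e<P. F * F)"
      using H_le by (intro sum_mono) auto
    then have "A h \<le> d * b * F + h * (P * (F * F))" using z by (simp add: A_def)
    also have "h * (P * (F * F)) \<le> b * (P * (F * F))" using h by (intro mult_le_mono1) simp
    finally show "B k e \<le> 2 * (b * P * W) + 2 * b + d * b * F + b * P * (F * F) + F * F + b * P * (b * P) + 3"
      by (simp add: mult.assoc)
  qed
  have HV: "int (H k e) \<le> V" for k e
    using H_le[of k e] by (intro int_le_V) linarith
  have fV: "int (f q) \<le> V" for q
    using f[of q] le_square[of F] by (intro int_le_V) linarith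
  have rV: "int (r + P + b + 3) \<le> V" using r bP_le by (intro int_le_V) linarith
  define I where "I = (\<lambda>k s. ready f r c x y s \<and> s (Reg rRem) = int h \<and> s (Reg rTop) = int r - int h
     \<and> s (Reg rK) = int h - int k \<and> s (Reg rAcc) = int (A k))"
  define J where "J = (\<lambda>k e s. ready f r c x y s \<and> s (Reg rRem) = int h \<and> s (Reg rTop) = int r - int h
     \<and> s (Reg rK) = int h - int (Suc k) \<and> s (Reg rFst) = int (r - h + (h - Suc k)) * int W + int b
     \<and> s (Reg rQ) = int k \<and> s (Reg rE) = int P - int e \<and> s (Reg rAcc) = int (B k e))"
  let ?inner = "[Sub rE rE rOne, Add rA rFst rE, Load rX rA, Mult rA rE rBase, Add rA rA rQ]
           @ address rA rA rCol @ [Load rY rA, Mult rX rX rY, Add rAcc rAcc rX]"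
  let ?outer = "[Sub rK rK rOne, Add rFst rTop rK, Mult rFst rFst rWidth, Add rFst rFst rBase,
                Sub rQ rRem rK, Sub rQ rQ rOne, Add rE (weight_reg 0) rZero]"
  have inner: "triple (J k e) (block ?inner) 11 (J k (Suc e))" if k: "k < h" and e: "e < P" for k e
  proof (rule triple_block)
    fix s assume J: "J k e s"
    then have at: "ready f r c x y s" by (simp add: J_def)
    note st = readyD[OF at] settingD[OF readyD(1)[OF at]]
    define u where "u = P - Suc e"
    define r1 where "r1 = r - h + (h - Suc k)"
    have u: "int P - int e - 1 = int u" "u \<le> P" "u < P" using e by (simp_all add: u_def)
    have "u * b + k < Suc u * b" using k h by simp
    also have "\<dots> \<le> b * P" using u mult_le_mono1[of "Suc u" P b] by (simp add: mult.commute)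
    finally have r2: "u * b + k < b * P" .
    have r1: "r1 < b * P" using r h k by (simp add: r1_def)
    have eq: "int r1 * int W + int b + int u = int r1 * int W + int u + int b" by simp
    note adr1 = address[OF r1 u(2)]
    note adr2 = address[OF r2 c, unfolded of_nat_add of_nat_mult]
    have "int (u * b) \<le> V" "int (u * b + k) \<le> V"
      using r2 bP_le by (intro int_le_V; linarith)+
    then have uV: "int u * int b \<le> V" "int u * int b + int k \<le> V" by simp_all
    have uV': "int u \<le> V" using rV u by linarith
    have Heq: "int (f (r1 * W + u)) * int (f ((u * b + k) * W + c)) = int (H k u)"
      by (simp add: H_def r1_def)
    have BV: "int (B k e) + int (H k u) \<le> V" "B k (Suc e) = B k e + H k u"
      using B_le[of k "Suc e"] k e by (simp_all add: B_def u_def)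
    have regs: "s (Reg rE) = int P - int e" "s (Reg rFst) = int r1 * int W + int b" "s (Reg rQ) = int k"
       "s (Reg rAcc) = int (B k e)"
      using J by (simp_all add: J_def r1_def)
    show "run_block ?inner (J k (Suc e)) s"
      by (simp add: address_def regs u(1) eq adr1(1-4) adr1(5)[OF st(2)] adr2(1-4) adr2(5)[OF st(2)] st(3-10)
          uV uV' fV Heq HV BV(1) del: of_nat_add of_nat_mult)
         (use J in \<open>simp add: J_def BV(2) at u(1)[symmetric]\<close>)
  qed (simp add: address_def)
  show ?thesis unfolding high_part_def
  proof (rule triple_Seq)
    show "triple (acc_inv f r c x y z) (block [Add rK rRem rZero, Sub rTop rRow rRem]) 2 (I 0)"
    proof (rule triple_block)
      fix s assume s: "acc_inv f r c x y z s"
      then have at: "ready f r c x y s" by (simp add: acc_inv_def)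
      note st = readyD[OF at] settingD[OF readyD(1)[OF at]]
      show "run_block [Add rK rRem rZero, Sub rTop rRow rRem] (I 0) s"
        using s at rV h by (simp add: acc_inv_def I_def h_def[symmetric] st(3-10) A_def)
    qed simp
    show "triple (I 0) (While rK (Seq (block ?outer) (While rE (block ?inner)))) (h * Suc (12 * P + 8) + 1)
       (acc_inv f r c x y (z + high_sum f r c))"
    proof (rule triple_weaken[OF triple_While[where I = I and m = h and n = "12 * P + 8"]])
      fix k assume k: "k < h"
      show "triple (I k) (Seq (block ?outer) (While rE (block ?inner))) (12 * P + 8) (I (Suc k))"
      proof (rule triple_Seq)
        show "triple (I k) (block ?outer) 7 (J k 0)"
        proof (rule triple_block)
          fix s assume I: "I k s"
          then have at: "ready f r c x y s" by (simp add: I_def)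
          note st = readyD[OF at] settingD[OF readyD(1)[OF at]]
          define t where "t = r - h"
          define k' where "k' = h - Suc k"
          have k': "int h - int k - 1 = int k'" and t: "int r - int h = int t"
            using h k by (simp_all add: k'_def t_def of_nat_diff)
          have hk': "int h - int k' - 1 = int k" using k'[symmetric] by simp
          have r1: "t + k' < b * P" using r h k by (simp add: t_def k'_def)
          note adr = address[OF r1, of 0, simplified, unfolded of_nat_add]
          have rem: "int t + int k' \<le> V" "int k' \<le> V" "\<bar>int h - int k'\<bar> \<le> V" "int k \<le> V" "int P \<le> V"
            using rV h k by (simp_all add: t_def k'_def)
          have regs: "s (Reg rK) = int h - int k" "s (Reg rTop) = int t" "s (Reg rRem) = int h" "s (Reg rAcc) = int (A k)"
            using I t by (simp_all add: I_def)
          show "run_block ?outer (J k 0) s"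
            by (simp add: address_def st(3-10) regs k' hk' adr rem)
               (simp add: J_def at regs t B_def k'_def[symmetric] t_def[symmetric] k'[symmetric])
        qed simp
        show "triple (J k 0) (While rE (block ?inner)) (P * Suc 11 + 1) (I (Suc k))"
        proof (rule triple_weaken[OF triple_While[where I = "J k" and m = P and n = 11]])
          show "triple (J k e) (block ?inner) 11 (J k (Suc e))" if "e < P" for e using inner[OF k that] .
          show "0 < s (Reg rE) \<longleftrightarrow> e < P" if "e \<le> P" "J k e s" for e s using that by (simp add: J_def)
          show "I (Suc k) s" if "J k P s" for s using that by (simp add: I_def J_def B_P)
        qed (use V_nonneg in auto)
      qed simp
    next
      fix s assume "I h s"
      then show "acc_inv f r c x y (z + high_sum f r c) s" by (simp add: I_def acc_inv_def h_def[symmetric] A_h)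
    qed (use V_nonneg in \<open>auto simp: I_def\<close>)
    show "2 + (h * Suc (12 * P + 8) + 1) \<le> b * (12 * P + 9) + 3"
      using mult_le_mono1[of h b "12 * P + 9"] h by (simp add: add.commute)
  qed
qed

lemma base_part:
  assumes r: "r < b * P" and c: "c \<le> P" and z: "int z + 1 \<le> V"
  shows "triple (acc_inv f r c x y z) base_part 9
    (acc_inv f r c x y (if c < P then if r = c * b then 1 else 0 else z + (if r = 0 then 1 else 0)))"
proof -
  have rV: "int (r + P + b + 3) \<le> V" using r bP_le by (intro int_le_V) linarith
  have "b * P * (b * P) \<le> 2 * (b * P * W) + 2 * b + d * b * F + b * P * (F * F) + F * F + b * P * (b * P) + 3"
    by simp
  note sq_le = int_le_V[OF this]
  have "int (b * P + 3) \<le> V" using bP_le by (intro int_le_V) linarith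
  then have bPV: "int (b * P) + 3 \<le> V" by simp
  have cb: "c * b \<le> b * P" using c by simp
  define e where "e = int r - int c * int b"
  have "e = int r - int (c * b)" by (simp add: e_def)
  then have "\<bar>e\<bar> \<le> int (b * P)" using r cb by linarith
  moreover have "int (c * b) \<le> V" using bPV cb by linarith
  ultimately have e_abs: "\<bar>e\<bar> \<le> int (b * P)" "int c * int b \<le> V" by simp_all
  then have e_sq: "e * e \<le> int (b * P * (b * P))"
    using mult_mono[OF e_abs(1) e_abs(1)] by (simp add: abs_mult_self_eq)
  have eV: "\<bar>e\<bar> \<le> V" "e * e \<le> V" "\<bar>1 - e * e\<bar> \<le> V" "1 \<le> V"
    using e_abs e_sq sq_le bPV zero_le_square[of e] by linarith+
  have e_0: "e = 0 \<longleftrightarrow> r = c * b"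
    unfolding e_def by (metis eq_iff_diff_eq_0 of_nat_eq_iff of_nat_mult)
  have pos_iff: "e * e < 1 \<longleftrightarrow> e = 0"
  proof (cases "e = 0")
    case False
    then have "0 < e * e" by (auto simp: zero_less_mult_iff)
    with False show ?thesis by linarith
  qed simp
  define Q where "Q = (\<lambda>s. ready f r c x y s \<and> s (Reg rRem) = int (r mod b) \<and> s (Reg rAcc) = 0 \<and> s (Reg rX) = 1 - e * e)"
  show ?thesis unfolding base_part_def
  proof (rule triple_Seq)
    show "triple (acc_inv f r c x y z) (block [Sub rGuard (weight_reg 0) rCol]) 1
       (\<lambda>s. acc_inv f r c x y z s \<and> s (Reg rGuard) = int P - int c)"
    proof (rule triple_block)
      fix s assume s: "acc_inv f r c x y z s"
      then have at: "ready f r c x y s" by (simp add: acc_inv_def)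
      note st = readyD[OF at] settingD[OF readyD(1)[OF at]]
      show "run_block [Sub rGuard (weight_reg 0) rCol] (\<lambda>s. acc_inv f r c x y z s \<and> s (Reg rGuard) = int P - int c) s"
        using s rV c by (simp add: st(3-10) acc_inv_def)
    qed simp
    show "triple (\<lambda>s. acc_inv f r c x y z s \<and> s (Reg rGuard) = int P - int c)
      (Cond rGuard
        (Seq (block [Const rAcc 0, Mult rX rCol rBase, Sub rX rRow rX, Mult rX rX rX, Sub rX rOne rX])
          (Cond rX (block [Const rAcc 1]) Skip))
        (Cond rRow Skip (block [Add rAcc rAcc rOne]))) 8
      (acc_inv f r c x y (if c < P then if r = c * b then 1 else 0 else z + (if r = 0 then 1 else 0)))" (is "triple ?P _ _ ?Q")
    proof (rule triple_Cond[where n = 7])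
      show "triple (\<lambda>s. ?P s \<and> 0 < s (Reg rGuard))
       (Seq (block [Const rAcc 0, Mult rX rCol rBase, Sub rX rRow rX, Mult rX rX rX, Sub rX rOne rX])
          (Cond rX (block [Const rAcc 1]) Skip)) 7 ?Q"
      proof (cases "c < P")
        case True
        show ?thesis
        proof (rule triple_Seq)
          show "triple (\<lambda>s. ?P s \<and> 0 < s (Reg rGuard))
            (block [Const rAcc 0, Mult rX rCol rBase, Sub rX rRow rX, Mult rX rX rX, Sub rX rOne rX]) 5 Q"
          proof (rule triple_block)
            fix s assume s: "?P s \<and> 0 < s (Reg rGuard)"
            then have at: "ready f r c x y s" by (simp add: acc_inv_def)
            note st = readyD[OF at] settingD[OF readyD(1)[OF at]]
            show "run_block [Const rAcc 0, Mult rX rCol rBase, Sub rX rRow rX, Mult rX rX rX, Sub rX rOne rX] Q s"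
              using s by (simp add: st(3-10) acc_inv_def Q_def V_nonneg e_abs e_def[symmetric] eV)
          qed simp
          show "triple Q (Cond rX (block [Const rAcc 1]) Skip) 2 ?Q"
            using True eV(4) V_nonneg
            by (intro triple_Cond[where n = 1] triple_block triple_Skip)
               (auto simp: Q_def acc_inv_def pos_iff e_0[symmetric] not_less[symmetric])
        qed simp
      qed (auto simp: triple_def)
      show "triple (\<lambda>s. ?P s \<and> s (Reg rGuard) \<le> 0) (Cond rRow Skip (block [Add rAcc rAcc rOne])) 7 ?Q"
        using z c V_nonneg
        by (intro triple_Cond[where n = 1] triple_block triple_Skip)
           (auto simp: acc_inv_def dest: readyD settingD(2)[OF readyD(1)])
    qed (use V_nonneg in auto)
  qed simp
qed

definition entry_value :: "(nat \<Rightarrow> nat) \<Rightarrow> nat \<Rightarrow> nat \<Rightarrow> nat" where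
  "entry_value f r c =
    (if (\<Sum>i<d. digit r i) + r mod b \<le> N then
       if r mod b = 0 \<and> c < P then (if r = c * b then 1 else 0)
       else (if r = 0 then 1 else 0) + low_sum f r c d + high_sum f r c
     else 0)"

definition entry_time :: nat where
  "entry_time = d * (11 * b + 4) + b * (12 * P + 9) + 24"

lemma entry:
  assumes r: "r < b * P" and c: "c \<le> P" and f: "\<And>q. f q \<le> F"
  shows "triple (ready f r c x y) (entry d) entry_time
    (ready (f(r * W + c := entry_value f r c)) r c x y)"
proof -
  define S where "S = (\<Sum>i<d. digit r i)"
  define h where "h = r mod b"
  define z where "z = low_sum f r c d"
  have z: "z \<le> d * b * F" unfolding z_def using f by (rule low_sum_le)
  have zV: "int z + 1 \<le> V" using int_le_V[of "z + 1"] z by simp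
  have rV: "int (r + 3) \<le> V" using r bP_le by (intro int_le_V) linarith
  have h: "h < b" using pos by (simp add: h_def)
  have "S + h + b \<le> d * b + 2 * b" using digit_sum_le[of r d] h by (simp add: S_def)
  moreover have "d * b \<le> d * b * F" using F by simp
  ultimately have SV: "int (S + h + b) \<le> V" by (intro int_le_V) linarith
  define Q where "Q = (\<lambda>s. acc_inv f r c x y z s \<and> s (Reg rGuard) = int b - int (S + h))"
  define v where "v = entry_value f r c"
  define R where "R = acc_inv f r c x y v"
  \<comment> \<open>For \<open>h = 0\<close> the convolution is empty, and \<open>h > 0\<close>
    implies \<open>r > 0\<close>; this gives the value the shape of the branches of the
    program.\<close>
  have v_cases: "v = (if S + h \<le> N then if h = 0 then (if c < P then (if r = c * b then 1 else 0) else z + (if r = 0 then 1 else 0))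
      else z + high_sum f r c else 0)"
    by (auto simp: v_def entry_value_def S_def h_def z_def high_sum_def)
  have init: "triple (ready f r c x y) (block [Const rAcc 0, Const rSum 0, Add rRem rRow rZero]) 3 (low_inv f r c x y 0)"
  proof (rule triple_block)
    fix s assume at: "ready f r c x y s"
    note st = readyD[OF at] settingD[OF readyD(1)[OF at]]
    have "r mod (b * b ^ d) = r" using r by (simp add: P)
    then show "run_block [Const rAcc 0, Const rSum 0, Add rRem rRow rZero] (low_inv f r c x y 0) s"
      using at rV by (simp add: st(3-10) low_inv_def V_nonneg low_sum_def)
  qed simp
  have mid: "triple (low_inv f r c x y d) (block [Add rSum rSum rRem, Sub rGuard rBase rSum]) 2 Q"
  proof (rule triple_block)
    fix s assume s: "low_inv f r c x y d s"
    then have at: "ready f r c x y s" by (simp add: low_inv_def)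
    note st = readyD[OF at] settingD[OF readyD(1)[OF at]]
    have regs: "s (Reg rSum) = int S" "s (Reg rRem) = int h" "s (Reg rAcc) = int z"
      using s by (simp_all add: low_inv_def S_def h_def z_def)
    show "run_block [Add rSum rSum rRem, Sub rGuard rBase rSum] Q s"
      using at SV by (simp add: st(3-10) regs Q_def acc_inv_def h_def[symmetric] abs_le_iff)
  qed simp
  have main: "triple Q (Cond rGuard (Cond rRem high_part base_part) (block [Const rAcc 0])) (b * (12 * P + 9) + 13) R"
  proof (rule triple_Cond)
    show "triple (\<lambda>s. Q s \<and> 0 < s (Reg rGuard)) (Cond rRem high_part base_part) (b * (12 * P + 9) + 12) R"
    proof (cases "S + h \<le> N")
      case True
      show ?thesis
      proof (rule triple_Cond)
        show "triple (\<lambda>s. (Q s \<and> 0 < s (Reg rGuard)) \<and> 0 < s (Reg rRem)) high_part (b * (12 * P + 9) + 10) R"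
        proof (cases "h = 0")
          case False
          with True have "v = z + high_sum f r c" by (simp add: v_cases)
          then show ?thesis unfolding R_def
            by (intro triple_weaken[OF high_part[OF r c f z]]) (auto simp: Q_def)
        qed (auto simp: triple_def Q_def acc_inv_def h_def)
        show "triple (\<lambda>s. (Q s \<and> 0 < s (Reg rGuard)) \<and> s (Reg rRem) \<le> 0) base_part (b * (12 * P + 9) + 10) R"
        proof (cases "h = 0")
          case h0: True
          show ?thesis unfolding R_def v_cases using True h0
            by (intro triple_weaken[OF base_part[OF r c zV]]) (auto simp: Q_def)
        next
          case False
          then have "\<not> (\<exists>s. Q s \<and> s (Reg rRem) \<le> 0)" by (auto simp: Q_def acc_inv_def h_def)
          then show ?thesis unfolding triple_def by blast
        qed
      qed (use V_nonneg in auto)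
    next
      case False
      then have "\<not> (\<exists>s. Q s \<and> 0 < s (Reg rGuard))" using b by (auto simp: Q_def)
      then show ?thesis unfolding triple_def by blast
    qed
    show "triple (\<lambda>s. Q s \<and> s (Reg rGuard) \<le> 0) (block [Const rAcc 0]) (b * (12 * P + 9) + 12) R"
    proof (rule triple_block)
      fix s assume s: "Q s \<and> s (Reg rGuard) \<le> 0"
      then have "\<not> S + h \<le> N" using b by (auto simp: Q_def)
      then have "v = 0" by (simp add: v_cases)
      with s show "run_block [Const rAcc 0] R s"
        by (simp add: Q_def R_def acc_inv_def V_nonneg)
    qed simp
  qed (use V_nonneg in auto)
  have store: "triple R (block (address rA rRow rCol @ [Store rA rAcc])) 4 (ready (f(r * W + c := v)) r c x y)"
  proof (rule triple_block)
    fix s assume s: "R s" and bounded: "bounded s"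
    then have at: "ready f r c x y s" by (simp add: R_def acc_inv_def)
    note st = readyD[OF at] settingD[OF readyD(1)[OF at]]
    note adr = address[OF r c]
    have acc: "s (Reg rAcc) = int v" using s by (simp add: R_def acc_inv_def)
    \<comment> \<open>The bound for the new entry is read off the invariant, since the entry already
      sits in a register.\<close>
    have "Reg rAcc \<in> cells d (b + b * P * W)" by (rule Reg_in_cells) simp
    then have "\<bar>s (Reg rAcc)\<bar> \<le> V" using bounded unfolding bounded_def by blast
    then have "int v \<le> V" using acc by simp
    moreover have "mem (f(r * W + c := v)) (s(Reg i := w, Cell (int r * int W + int c + int b) := int v))" for i w
    proof -
      have "int q = int r * int W + int c \<longleftrightarrow> q = r * W + c" for q
        by (metis of_nat_add of_nat_eq_iff of_nat_mult)
      then show ?thesis using st(2) by (auto simp: mem_def)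
    qed
    ultimately show "run_block (address rA rRow rCol @ [Store rA rAcc]) (ready (f(r * W + c := v)) r c x y) s"
      using at by (simp add: address_def adr(1-4) st(3-10) acc ready_def)
  qed (simp add: address_def)
  show ?thesis unfolding entry_def v_def[symmetric]
    by (rule triple_Seq[OF init triple_Seq[OF low_parts[OF r c f order_refl] triple_Seq[OF mid triple_Seq[OF main store order_refl] order_refl] order_refl]])
       (simp add: entry_time_def)
qed

lemma filled_eq:
  assumes "c \<le> P"
  shows "filled N d n (r * W + c) = (if r * W + c < n then table N d r c else 0)"
proof -
  have "Suc (Suc N ^ d) = W" by (simp add: W P b)
  moreover have "c < W" using assms W by simp
  then have "(r * W + c) div W = r" "(r * W + c) mod W = c" by simp_all
  ultimately show ?thesis unfolding filled_def by simp
qed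

text \<open>Cells are filled row by row, so all rows before \<open>r\<close> are complete, which is
  what \<open>table_rec\<close> asks of the memory.\<close>

lemma entry_value_filled:
  assumes r: "r < b * P" and c: "c \<le> P"
  shows "entry_value (filled N d (r * W + c)) r c = table N d r c"
proof -
  let ?f = "\<lambda>r' c'. filled N d (r * W + c) (r' * W + c')"
  have less: "r' * W + c' < r * W + c" if "r' < r" "c' \<le> P" for r' c'
  proof -
    have "r' * W + c' < Suc r' * W" using that W by simp
    also have "\<dots> \<le> r * W" using that by (intro mult_le_mono1) simp
    finally show ?thesis by simp
  qed
  have dig: "digits b d (r div b) ! i = digit r i" if "i < d" for i
  proof -
    have "b * b ^ (d - Suc i) = b ^ (d - i)" using that by (simp flip: power_Suc add: Suc_diff_Suc)
    then show ?thesis using that by (simp add: digits_def digit_def flip: div_mult2_eq)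
  qed
  have sum: "sum_list (digits b d (r div b)) = (\<Sum>i<d. digit r i)"
    using dig by (simp add: sum_list_sum_nth atLeast0LessThan)
  have "table N d r c =
    (if sum_list (digits b d (r div b)) + r mod b \<le> N then
      if r mod b = 0 \<and> c < b ^ d then (if r = c * b then 1 else 0)
      else (if r = 0 then 1 else 0)
        + (\<Sum>i<d. \<Sum>y<digits b d (r div b) ! i. ?f (r - Suc y * b ^ (d - i) + y * b ^ (d - Suc i)) c)
        + (\<Sum>k<r mod b. \<Sum>e<b ^ d. ?f (r - r mod b + k) e * ?f (e * b + (r mod b - Suc k)) c)
     else 0)"
    unfolding b
  proof (rule table_rec)
    show "r < Suc N ^ Suc d" "c \<le> Suc N ^ d" using r c by (simp_all add: P b)
    show "?f m' c' = table N d m' c'" if "m' < r" "c' \<le> Suc N ^ d" for m' c'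
      using that less[of m' c'] filled_eq[of c'] by (simp add: P b)
  qed
  also have "(\<Sum>i<d. \<Sum>y<digits b d (r div b) ! i. ?f (r - Suc y * b ^ (d - i) + y * b ^ (d - Suc i)) c)
      = low_sum (filled N d (r * W + c)) r c d"
    unfolding low_sum_def by (intro sum.cong refl) (simp_all add: dig)
  finally show ?thesis
    unfolding entry_value_def high_sum_def sum by (simp only: P)
qed

lemma filled_le: "(\<And>r c. table N d r c \<le> F) \<Longrightarrow> filled N d n q \<le> F"
  by (simp add: filled_def)

lemma filled_Suc:
  assumes "c \<le> P"
  shows "(filled N d (r * W + c))(r * W + c := table N d r c) = filled N d (Suc (r * W + c))"
proof
  fix q
  have "filled N d (Suc (r * W + c)) (r * W + c) = table N d r c"
    using filled_eq[OF assms] by simp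
  then show "((filled N d (r * W + c))(r * W + c := table N d r c)) q = filled N d (Suc (r * W + c)) q"
    by (simp add: filled_def less_Suc_eq)
qed

definition fill_time :: nat where
  "fill_time = b * P * (W * (entry_time + 3) + 6) + 3"

lemma fill:
  assumes F: "\<And>r c. table N d r c \<le> F"
  shows "triple (\<lambda>s. setting s \<and> mem (\<lambda>_. 0) s) (fill d) fill_time
    (\<lambda>s. setting s \<and> mem (filled N d (b * P * W)) s)"
proof -
  have "int (b * P + 1 + W + 1) \<le> V" using bP_le W by (intro int_le_V) linarith
  then have bPV: "int b * int P + int W + 2 \<le> V" by simp
  have comm: "int P * int b = int b * int P" by simp
  define I where "I = (\<lambda>k s. setting s \<and> mem (filled N d (k * W)) s \<and> s (Reg rRow) = int k \<and>
     s (Reg rRows) = int b * int P - int k)"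
  define J where "J = (\<lambda>k c. ready (filled N d (k * W + c)) k c (int b * int P - int k) (int W - int c))"
  have init: "triple (\<lambda>s. setting s \<and> mem (\<lambda>_. 0) s) (block [Const rRow 0, Mult rRows (weight_reg 0) rBase]) 2 (I 0)"
  proof (rule triple_block)
    fix s assume s: "setting s \<and> mem (\<lambda>_. 0) s"
    note st = settingD[OF conjunct1[OF s]]
    have "filled N d 0 = (\<lambda>_. 0)" by (simp add: filled_def fun_eq_iff)
    then show "run_block [Const rRow 0, Mult rRows (weight_reg 0) rBase] (I 0) s"
      using s bPV by (simp add: I_def st(1-6) V_nonneg comm)
  qed simp
  have step: "triple (J k c) (Seq (entry d) (block [Add rCol rCol rOne, Sub rCols rCols rOne])) (entry_time + 2) (J k (Suc c))"
    if "k < b * P" "c < W" for k c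
  proof (rule triple_Seq)
    have c: "c \<le> P" using that W by simp
    have "triple (J k c) (entry d) entry_time
       (ready ((filled N d (k * W + c))(k * W + c := entry_value (filled N d (k * W + c)) k c)) k c
         (int b * int P - int k) (int W - int c))"
      unfolding J_def by (rule entry[OF that(1) c filled_le[OF F]])
    then show "triple (J k c) (entry d) entry_time
       (ready (filled N d (k * W + Suc c)) k c (int b * int P - int k) (int W - int c))"
      by (simp only: entry_value_filled[OF that(1) c] filled_Suc[OF c] add_Suc_right)
    show "triple (ready (filled N d (k * W + Suc c)) k c (int b * int P - int k) (int W - int c))
       (block [Add rCol rCol rOne, Sub rCols rCols rOne]) 2 (J k (Suc c))"
    proof (rule triple_block)
      fix s assume at: "ready (filled N d (k * W + Suc c)) k c (int b * int P - int k) (int W - int c) s"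
      note st = readyD[OF at] settingD[OF readyD(1)[OF at]]
      have "s (Reg rCols) = int W - int c" using at by (simp add: ready_def)
      moreover have "0 \<le> int b * int P" by simp
      then have "int c + 1 \<le> V" "\<bar>int W - int c - 1\<bar> \<le> V" using bPV that by linarith+
      ultimately show "run_block [Add rCol rCol rOne, Sub rCols rCols rOne] (J k (Suc c)) s"
        using at by (simp add: st(3-10) J_def ready_def)
    qed simp
  qed simp
  have row: "triple (I k) (Seq (block [Const rCol 0, Add rCols rWidth rZero])
        (Seq (While rCols (Seq (entry d) (block [Add rCol rCol rOne, Sub rCols rCols rOne])))
             (block [Add rRow rRow rOne, Sub rRows rRows rOne]))) (W * (entry_time + 3) + 5) (I (Suc k))"
    if k: "k < b * P" for k
  proof (rule triple_Seq)
    show "triple (I k) (block [Const rCol 0, Add rCols rWidth rZero]) 2 (J k 0)"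
    proof (rule triple_block)
      fix s assume s: "I k s"
      then have "setting s" by (simp add: I_def)
      note st = settingD[OF this]
      have "0 \<le> int b * int P" by simp
      then have "int W \<le> V" using bPV by linarith
      then show "run_block [Const rCol 0, Add rCols rWidth rZero] (J k 0) s"
        using s by (simp add: I_def J_def st(1-6) V_nonneg ready_def)
    qed simp
    show "triple (J k 0) (Seq (While rCols (Seq (entry d) (block [Add rCol rCol rOne, Sub rCols rCols rOne])))
             (block [Add rRow rRow rOne, Sub rRows rRows rOne])) (W * (entry_time + 3) + 3) (I (Suc k))"
    proof (rule triple_Seq)
      show "triple (J k 0) (While rCols (Seq (entry d) (block [Add rCol rCol rOne, Sub rCols rCols rOne])))
         (W * (entry_time + 3) + 1) (J k W)"
      proof (rule triple_While[where n = "entry_time + 2" and I = "J k"])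
        show "triple (J k c) (Seq (entry d) (block [Add rCol rCol rOne, Sub rCols rCols rOne])) (entry_time + 2) (J k (Suc c))"
          if "c < W" for c using step[OF k that] .
        show "W * Suc (entry_time + 2) + 1 \<le> W * (entry_time + 3) + 1" by (simp only: add_Suc_right[symmetric]) simp
      qed (auto simp: J_def ready_def V_nonneg)
      show "triple (J k W) (block [Add rRow rRow rOne, Sub rRows rRows rOne]) 2 (I (Suc k))"
      proof (rule triple_block)
        fix s assume s: "J k W s"
        then have at: "ready (filled N d (k * W + W)) k W (int b * int P - int k) (int W - int W) s"
          by (simp add: J_def)
        note st = readyD[OF at] settingD[OF readyD(1)[OF at]]
        have "s (Reg rRows) = int b * int P - int k" using at by (simp add: ready_def)
        moreover have "int k + 1 \<le> int (b * P)" using k by linarith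
        then have "int k + 1 \<le> V" "\<bar>int b * int P - int k - 1\<bar> \<le> V" using bPV by simp_all
        moreover have "k * W + W = W + k * W" by simp
        ultimately show "run_block [Add rRow rRow rOne, Sub rRows rRows rOne] (I (Suc k)) s"
          using at by (simp add: st(3-10) I_def add.commute) (simp add: ready_def)
      qed simp
    qed simp
  qed simp
  have "triple (I 0) (While rRows (Seq (block [Const rCol 0, Add rCols rWidth rZero])
        (Seq (While rCols (Seq (entry d) (block [Add rCol rCol rOne, Sub rCols rCols rOne])))
             (block [Add rRow rRow rOne, Sub rRows rRows rOne])))) (b * P * (W * (entry_time + 3) + 6) + 1) (I (b * P))"
  proof (rule triple_While[where n = "W * (entry_time + 3) + 5"])
    show "0 < s (Reg rRows) \<longleftrightarrow> k < b * P" if "k \<le> b * P" "I k s" for k s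
    proof -
      have "s (Reg rRows) = int (b * P) - int k" using that by (simp add: I_def)
      then show ?thesis by linarith
    qed
  qed (use row V_nonneg in auto)
  then have "triple (\<lambda>s. setting s \<and> mem (\<lambda>_. 0) s) (fill d) fill_time (I (b * P))"
    unfolding fill_def by (intro triple_Seq[OF init]) (auto simp: fill_time_def)
  then show ?thesis by (rule triple_weaken) (auto simp: I_def)
qed

lemma output_part:
  assumes F: "\<And>q. f q \<le> F"
  shows "triple (\<lambda>s. setting s \<and> mem f s) output_part (b * 8 + 2)
    (\<lambda>s. \<forall>n\<le>N. s (Cell (int n)) = int (f (n * P * W + P)))"
proof -
  define I where "I = (\<lambda>k s. setting s \<and> mem f s \<and> s (Reg rK) = int b - int k \<and>
    (\<forall>n. b \<le> n + k \<and> n < b \<longrightarrow> s (Cell (int n)) = int (f (n * P * W + P))))"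
  have "int b \<le> V" by (intro int_le_V) simp
  note bV = this
  let ?body = "[Sub rK rK rOne, Mult rX rK (weight_reg 0)] @ address rA rX (weight_reg 0) @ [Load rY rA, Store rK rY]"
  have init: "triple (\<lambda>s. setting s \<and> mem f s) (block [Add rK rBase rZero]) 1 (I 0)"
  proof (rule triple_block)
    fix s assume s: "setting s \<and> mem f s"
    note st = settingD[OF conjunct1[OF s]]
    show "run_block [Add rK rBase rZero] (I 0) s"
      using s bV by (simp add: I_def st(1-6))
  qed simp
  have step: "triple (I k) (block ?body) 7 (I (Suc k))" if k: "k < b" for k
  proof (rule triple_block)
    fix s assume I: "I k s"
    then have s: "setting s" "mem f s" by (auto simp: I_def)
    note st = settingD[OF s(1)]
    define n where "n = b - Suc k"
    have n: "int b - int k - 1 = int n" "n < b" using k by (simp_all add: n_def of_nat_diff)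
    have r: "n * P < b * P" using n pos by simp
    note adr = address[OF r order_refl, unfolded of_nat_mult]
    have "int (n * P) \<le> V" using r bP_le by (intro int_le_V) linarith
    then have nP: "int n * int P \<le> V" by simp
    have nV: "int n \<le> V" using n bV by linarith
    have fV: "int (f q) \<le> V" for q
      using F[of q] le_square[of F] by (intro int_le_V) linarith
    have cell: "Cell (int n) \<in> cells d (b + b * P * W)"
    proof -
      have "int n < int (b + b * P * W)" using n(2) by linarith
      then show ?thesis by (simp add: cells_def)
    qed
    have regs: "s (Reg rK) = int b - int k" using I by (simp add: I_def)
    \<comment> \<open>Output goes to cells below \<open>b\<close>, whereas the table occupies cells
      from \<open>b\<close> on, so later rounds still find it intact.\<close>
    have "mem f (s'(Cell (int n) := v))" if "mem f s'" for s' v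
      using that n by (auto simp: mem_def)
    moreover have "m = n \<or> b \<le> m + k" if "b \<le> Suc (m + k)" for m
      using that k by (auto simp: n_def)
    moreover have "int b - int k = int n + 1" using n by simp
    ultimately have "I (Suc k) (s(Reg rK := int n, Reg rX := v1, Reg rA := v2, Reg rY := int (f (n * P * W + P)), Cell (int n) := int (f (n * P * W + P))))" for v1 v2
      using I by (auto simp: I_def)
    then show "run_block ?body (I (Suc k)) s"
      by (simp add: address_def st(1-6) regs n(1) nP nV adr(1-4) adr(5)[OF s(2)] fV cell)
  qed (simp add: address_def)
  have "triple (I 0) (While rK (block ?body)) (b * 8 + 1) (I b)"
    by (rule triple_While[where n = 7]) (use step V_nonneg in \<open>auto simp: I_def\<close>)
  then have "triple (\<lambda>s. setting s \<and> mem f s) output_part (b * 8 + 2) (I b)"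
    unfolding output_part_def by (intro triple_Seq[OF init]) auto
  then show ?thesis by (rule triple_weaken) (auto simp: I_def b)
qed

lemma weights:
  assumes "k \<le> d"
  shows "triple (\<lambda>s. s (Reg rN) = int N \<and> mem (\<lambda>_. 0) s) (weights d k) (k + 4)
     (\<lambda>s. s (Reg rN) = int N \<and> s (Reg rOne) = 1 \<and> s (Reg rBase) = int b \<and> s (Reg rZero) = 0 \<and> mem (\<lambda>_. 0) s
        \<and> (\<forall>j\<le>d. d - k \<le> j \<longrightarrow> s (Reg (weight_reg j)) = int (b ^ (d - j))))"
  using assms
proof (induction k)
  case 0
  have "int b \<le> V" by (intro int_le_V) simp
  moreover have "int 1 \<le> V" by (intro int_le_V) simp
  moreover have "int N + 1 = int b" by (simp add: b)
  ultimately show ?case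
    unfolding weights.simps by (intro triple_block) (auto simp: V_nonneg)
next
  case (Suc k)
  let ?Q = "\<lambda>k s. s (Reg rN) = int N \<and> s (Reg rOne) = 1 \<and> s (Reg rBase) = int b \<and> s (Reg rZero) = 0 \<and> mem (\<lambda>_. 0) s
        \<and> (\<forall>j\<le>d. d - k \<le> j \<longrightarrow> s (Reg (weight_reg j)) = int (b ^ (d - j)))"
  have step: "triple (?Q k) (block [Mult (weight_reg (d - Suc k)) (weight_reg (d - k)) rBase]) 1 (?Q (Suc k))"
  proof (rule triple_block)
    fix s assume s: "?Q k s"
    have "b ^ k * b \<le> P"
      using power_increasing[of "Suc k" d b] pos Suc.prems by (simp add: P mult.commute)
    then have "int (b ^ k * b) \<le> V" using bP_le by (intro int_le_V) linarith
    then have pV: "int b ^ k * int b \<le> V" by simp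
    have wk: "s (Reg (weight_reg (d - k))) = int b ^ k"
      using s Suc.prems by simp
    have "s (Reg (weight_reg j)) = int b ^ (d - j)" if "j \<le> d" "d - Suc k \<le> j" "j \<noteq> d - Suc k" for j
      using s that by auto
    then show "run_block [Mult (weight_reg (d - Suc k)) (weight_reg (d - k)) rBase] (?Q (Suc k)) s"
      using s Suc.prems pV by (auto simp: wk)
  qed simp
  show ?case
    unfolding weights.simps using Suc by (intro triple_Seq[OF _ step]) auto
qed

lemma program:
  assumes F: "\<And>r c. table N d r c \<le> F"
  shows "triple (\<lambda>s. s (Reg rN) = int N \<and> mem (\<lambda>_. 0) s) (program d) (d + fill_time + b * 8 + 7)
    (\<lambda>s. \<forall>n\<le>N. s (Cell (int n)) = int (table N d (n * P) P))"
proof -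
  have width: "triple (\<lambda>s. s (Reg rN) = int N \<and> s (Reg rOne) = 1 \<and> s (Reg rBase) = int b \<and> s (Reg rZero) = 0 \<and> mem (\<lambda>_. 0) s
        \<and> (\<forall>j\<le>d. d - d \<le> j \<longrightarrow> s (Reg (weight_reg j)) = int (b ^ (d - j))))
     (block [Add rWidth (weight_reg 0) rOne]) 1 (\<lambda>s. setting s \<and> mem (\<lambda>_. 0) s)"
  proof (rule triple_block)
    have "int (P + 1) \<le> V" using bP_le by (intro int_le_V) linarith
    moreover have "int P + 1 = int W" by (simp add: W)
    ultimately show "run_block [Add rWidth (weight_reg 0) rOne] (\<lambda>s. setting s \<and> mem (\<lambda>_. 0) s) s"
      if "s (Reg rN) = int N \<and> s (Reg rOne) = 1 \<and> s (Reg rBase) = int b \<and> s (Reg rZero) = 0 \<and> mem (\<lambda>_. 0) s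
        \<and> (\<forall>j\<le>d. d - d \<le> j \<longrightarrow> s (Reg (weight_reg j)) = int (b ^ (d - j)))" for s
      using that by (simp add: setting_def P[symmetric] flip: of_nat_power)
  qed simp
  have written: "triple (\<lambda>s. setting s \<and> mem (filled N d (b * P * W)) s) output_part (b * 8 + 2)
    (\<lambda>s. \<forall>n\<le>N. s (Cell (int n)) = int (table N d (n * P) P))"
  proof (rule triple_weaken[OF output_part[OF filled_le[OF F]]])
    have "filled N d (b * P * W) (n * P * W + P) = table N d (n * P) P" if "n \<le> N" for n
    proof -
      have "n < b" using that by (simp add: b)
      then have "n * P < b * P" using pos by simp
      then show ?thesis using row_col_less[of "n * P" P] filled_eq[of P] by simp
    qed
    then show "\<forall>n\<le>N. s (Cell (int n)) = int (table N d (n * P) P)"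
      if "\<forall>n\<le>N. s (Cell (int n)) = int (filled N d (b * P * W) (n * P * W + P))" for s using that by simp
  qed auto
  show ?thesis unfolding program_def
    by (rule triple_Seq[OF weights[OF order_refl] triple_Seq[OF width triple_Seq[OF fill[OF F] written order_refl] order_refl]]) simp
qed

end

section \<open>Resources of a run\<close>

lemma exec_Nil_trace: "exec c s tr t \<Longrightarrow> tr = [] \<Longrightarrow> t = s"
  by (induction rule: exec.induct) auto

lemma bit_size_mono: "\<bar>x\<bar> \<le> v \<Longrightarrow> bit_size x \<le> bit_size v"
  unfolding bit_size_def by (intro Suc_le_mono[THEN iffD2] floorlog_mono nat_mono) auto

lemma used_locs_Cons: "used_locs ((i, s) # tr) = instr_locs i s \<union> used_locs tr"
  by (simp add: used_locs_def)

context bounded_machine begin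

text \<open>Admissibility puts all used locations into \<open>L\<close> and bounds their contents by
  \<open>V\<close>. An instruction other than a multiplication is charged for at most two integers,
  and linearity of \<open>M\<close> turns \<open>2 * bit_size V\<close> into at most
  \<open>2 / a * M (bit_size V)\<close>.\<close>

lemma resources:
  assumes tr: "tr \<noteq> []" "\<forall>x\<in>set tr. admissible x" and t: "bounded t" and L: "finite L"
  shows "stored_integers tr \<le> card L" "max_bit_size tr t \<le> bit_size V"
    "bit_storage tr t \<le> card L * bit_size V"
    "mono M \<Longrightarrow> 0 < a \<Longrightarrow> (\<And>b. a * real b \<le> M b) \<Longrightarrow>
      bit_complexity M tr \<le> real (length tr) * ((1 + 2 / a) * M (bit_size V))"
proof -
  have used: "used_locs tr \<subseteq> L"
    using tr(2) by (auto simp: used_locs_def admissible_def)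
  have fin: "finite (used_locs tr)" using used L finite_subset by blast
  have ne: "used_locs tr \<noteq> {}"
  proof -
    obtain i s tr' where "tr = (i, s) # tr'" using tr(1) by (cases tr) auto
    moreover have "instr_locs i s \<noteq> {}" by (cases i) auto
    ultimately show ?thesis by (simp add: used_locs_Cons)
  qed
  have vis: "bounded s" if "s \<in> visited_states tr t" for s
    using that tr(2) t by (auto simp: visited_states_def admissible_def)
  have fin_vis: "finite (visited_states tr t)" by (simp add: visited_states_def)
  have size: "bit_size (s l) \<le> bit_size V" if "bounded s" "l \<in> L" for s l
    using that by (intro bit_size_mono) (simp add: bounded_def)
  show "stored_integers tr \<le> card L"
    unfolding stored_integers_def using used L by (rule card_mono[rotated])
  show "max_bit_size tr t \<le> bit_size V"
    unfolding max_bit_size_def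
  proof (subst Max_le_iff)
    show "(\<lambda>(s, l). bit_size (s l)) ` (visited_states tr t \<times> used_locs tr) \<noteq> {}"
      using ne by (auto simp: visited_states_def)
  qed (use fin fin_vis vis size used in auto)
  show "bit_storage tr t \<le> card L * bit_size V"
    unfolding bit_storage_def
  proof (subst Max_le_iff)
    have "(\<Sum>l\<in>used_locs tr. bit_size (s l)) \<le> card L * bit_size V" if "s \<in> visited_states tr t" for s
    proof -
      have "(\<Sum>l\<in>used_locs tr. bit_size (s l)) \<le> of_nat (card (used_locs tr)) * bit_size V"
        using vis[OF that] size used by (intro sum_bounded_above) auto
      also have "\<dots> \<le> card L * bit_size V"
        using used L by (simp add: card_mono)
      finally show ?thesis .
    qed
    then show "\<forall>n\<in>(\<lambda>s. \<Sum>l\<in>used_locs tr. bit_size (s l)) ` visited_states tr t. n \<le> card L * bit_size V"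
      by auto
  qed (use fin_vis in \<open>auto simp: visited_states_def\<close>)
  assume M: "mono M" and a: "0 < a" "\<And>b. a * real b \<le> M b"
  let ?\<beta> = "bit_size V"
  have M_nonneg: "0 \<le> M b" for b using a(2)[of b] a(1) by (meson mult_nonneg_nonneg less_imp_le of_nat_0_le_iff order_trans)
  have lin: "2 * real ?\<beta> \<le> 2 / a * M ?\<beta>"
    using a by (simp add: field_simps)
  have cost: "instr_bit_cost M i s \<le> (1 + 2 / a) * M ?\<beta>" if "(i, s) \<in> set tr" for i s
  proof -
    have adm: "bounded s" "instr_locs i s \<subseteq> L" "\<bar>computed i s\<bar> \<le> V"
      using that tr(2) by (auto simp: admissible_def)
    have s: "bit_size (s l) \<le> ?\<beta>" if "l \<in> instr_locs i s" for l
      using size adm that by blast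
    have le: "2 * real ?\<beta> \<le> (1 + 2 / a) * M ?\<beta>" "M ?\<beta> \<le> (1 + 2 / a) * M ?\<beta>"
      using lin M_nonneg[of ?\<beta>] a(1) by (simp_all add: distrib_right)
    have one: "real m \<le> (1 + 2 / a) * M ?\<beta>" if "m \<le> ?\<beta>" for m
      using that le(1) by linarith
    have two: "real (m + n) \<le> (1 + 2 / a) * M ?\<beta>" if "m \<le> ?\<beta>" "n \<le> ?\<beta>" for m n
      using that le(1) by linarith
    show ?thesis
    proof (cases i)
      case (Mult j k l)
      then have "M (max (bit_size (s (Reg k))) (bit_size (s (Reg l)))) \<le> M ?\<beta>"
        using s by (intro monoD[OF M]) simp
      then show ?thesis using Mult le(2) by simp
    next
      case (Const j c)
      then have "bit_size c \<le> ?\<beta>" using adm by (intro bit_size_mono) simp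
      then show ?thesis using Const one by simp
    next
      case (Add j k l)
      show ?thesis unfolding Add instr_bit_cost.simps by (intro two s) (simp_all add: Add)
    next
      case (Sub j k l)
      show ?thesis unfolding Sub instr_bit_cost.simps by (intro two s) (simp_all add: Sub)
    next
      case (Load j k)
      show ?thesis unfolding Load instr_bit_cost.simps by (intro two s) (simp_all add: Load)
    next
      case (Store j k)
      show ?thesis unfolding Store instr_bit_cost.simps by (intro two s) (simp_all add: Store)
    next
      case (Test j)
      show ?thesis unfolding Test instr_bit_cost.simps by (intro one s) (simp add: Test)
    qed
  qed
  have "bit_complexity M tr' \<le> real (length tr') * ((1 + 2 / a) * M ?\<beta>)" if "set tr' \<subseteq> set tr" for tr'
    using that
  proof (induction tr')
    case (Cons x tr')
    obtain i s where x: "x = (i, s)" by (cases x)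
    have "bit_complexity M (x # tr') = instr_bit_cost M i s + bit_complexity M tr'"
      by (simp add: bit_complexity_def x)
    also have "\<dots> \<le> (1 + 2 / a) * M ?\<beta> + real (length tr') * ((1 + 2 / a) * M ?\<beta>)"
      using Cons x by (intro add_mono cost) auto
    also have "\<dots> = real (length (x # tr')) * ((1 + 2 / a) * M ?\<beta>)"
      by (simp only: length_Cons of_nat_Suc distrib_right mult_1)
    finally show ?case .
  qed (simp add: bit_complexity_def)
  then show "bit_complexity M tr \<le> real (length tr) * ((1 + 2 / a) * M ?\<beta>)" by simp
qed

end

lemma card_cells: "finite (cells d m)" "card (cells d m) \<le> 31 + d + m"
proof -
  have eq: "cells d m = Reg ` {..<31 + d} \<union> Cell ` {0..<int m}" by (auto simp: cells_def)
  then show "finite (cells d m)" by simp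
  have "card (Reg ` {..<31 + d}) \<le> 31 + d" "card (Cell ` {0..<int m}) \<le> m"
    using card_image_le[of "{..<31 + d}" Reg] card_image_le[of "{0..<int m}" Cell] by simp_all
  then show "card (cells d m) \<le> 31 + d + m"
    unfolding eq using card_Un_le[of "Reg ` {..<31 + d}" "Cell ` {0..<int m}"] by linarith
qed

definition value_bound :: "nat \<Rightarrow> nat \<Rightarrow> nat" where
  "value_bound d N = (let b = Suc N; P = b ^ d; W = Suc P; F = b ^ N in
     2 * (b * P * W) + 2 * b + d * b * F + b * P * (F * F) + F * F + b * P * (b * P) + 3)"

lemma counting_program:
  fixes d N :: nat
  assumes N: "N \<ge> 1" and table_bound: "\<And>r c. table N d r c \<le> Suc N ^ N"
    and Av: "\<And>n. n \<le> N \<Longrightarrow> card (Av n (beta d)) = table N d (n * Suc N ^ d) (Suc N ^ d)"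
  defines "b \<equiv> Suc N" and "v \<equiv> value_bound d N"
  shows "\<exists>tr t. exec (program d) (initial_state N) tr t \<and>
    (\<forall>n\<le>N. t (Cell (int n)) = int (card (Av n (beta d)))) \<and>
    length tr \<le> (31 * d + 120) * b ^ (3 * d + 2) \<and>
    stored_integers tr \<le> (34 + d) * b ^ (2 * d + 1) \<and>
    max_bit_size tr t \<le> bit_size (int v) \<and>
    bit_storage tr t \<le> (34 + d) * b ^ (2 * d + 1) * bit_size (int v) \<and>
    (\<forall>M a. mono M \<longrightarrow> 0 < a \<longrightarrow> (\<forall>b. a * real b \<le> M b) \<longrightarrow>
      bit_complexity M tr \<le> real (length tr) * ((1 + 2 / a) * M (bit_size (int v))))"
proof -
  define P where "P = b ^ d"
  define W where "W = Suc P"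
  define F' where "F' = b ^ N"
  define V where "V = int v"
  have pos: "b \<ge> 1" "P \<ge> 1" by (simp_all add: b_def P_def)
  interpret counting N d b P W F' V
    by unfold_locales
       (simp_all add: b_def P_def W_def F'_def V_def v_def value_bound_def Let_def)
  have bnd: "bounded (initial_state N)"
  proof -
    have "int N \<le> V" by (intro int_le_V) (simp add: b_def)
    then show ?thesis using V_nonneg by (auto simp: bounded_def initial_state_def)
  qed
  have init: "initial_state N (Reg 0) = int N \<and> mem (\<lambda>_. 0) (initial_state N)"
    by (simp add: initial_state_def mem_def)
  have F2: "table N d r c \<le> F'" for r c using table_bound by (simp add: F'_def b_def)
  obtain tr t where tr: "exec (program d) (initial_state N) tr t" "length tr \<le> d + fill_time + b * 8 + 7"
     "\<forall>x\<in>set tr. admissible x" "bounded t" "\<forall>n\<le>N. t (Cell (int n)) = int (table N d (n * P) P)"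
    using tripleD[OF program[OF F2] bnd init] by blast
  have out: "\<forall>n\<le>N. t (Cell (int n)) = int (card (Av n (beta d)))"
    using tr(5) Av by (simp add: P_def b_def)
  \<comment> \<open>The maximum over the used locations calls for a nonempty trace. Cell 0 starts
    with 0 and ends with 1, so some instruction was executed.\<close>
  have "Av 0 (beta d) = {[]}" by (auto simp: Av_def contains_pattern_def beta_def)
  then have "t (Cell 0) = 1" using out by (auto dest: spec[of _ 0])
  then have "t \<noteq> initial_state N" by (auto simp: initial_state_def)
  then have ne: "tr \<noteq> []" using exec_Nil_trace[OF tr(1)] by blast
  have bP: "1 \<le> b * P" "b \<le> b * P" "P \<le> b * P" using pos by simp_all
  \<comment> \<open>There are \<open>31 + d\<close> registers, \<open>b\<close> output cells and
    \<open>b * P * W\<close> table cells with \<open>W \<le> 2 * P\<close>; the constant is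
    \<open>(31 + d) + 1 + 2\<close>.\<close>
  have card: "card (cells d (b + b * P * W)) \<le> (34 + d) * b ^ (2 * d + 1)"
  proof -
    define Y where "Y = b ^ (2 * d + 1)"
    have Y: "b * (P * P) = Y" by (simp add: Y_def P_def mult_2 power_add)
    have "b * P * W \<le> b * P * (2 * P)" using pos by (intro mult_le_mono2) (simp add: W_def)
    also have "\<dots> = 2 * Y" by (simp add: Y[symmetric])
    finally have "b * P * W \<le> 2 * Y" .
    moreover have "b \<le> Y" using pos by (simp add: Y[symmetric])
    moreover have "31 + d \<le> (31 + d) * Y" using pos by (simp add: Y_def)
    moreover have "(34 + d) * Y = (31 + d) * Y + 3 * Y" by (simp add: distrib_right)
    ultimately show ?thesis using card_cells(2)[of d "b + b * P * W"] unfolding Y_def[symmetric] by linarith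
  qed
  \<comment> \<open>There are \<open>b * P\<close> rows and \<open>W\<close> columns, and for fixed
    \<open>d\<close> an entry takes a number of instructions of order \<open>b * P\<close>; the
    product is of order \<open>b ^ 2 * P ^ 3\<close>.\<close>
  have time: "fill_time + d + b * 8 + 7 \<le> (31 * d + 120) * b ^ (3 * d + 2)"
  proof -
    define X where "X = b * P"
    have X: "1 \<le> X" "b \<le> X" using bP by (simp_all add: X_def)
    have "d * (11 * b + 4) \<le> d * (15 * X)" using X by (intro mult_le_mono2) linarith
    moreover have "b * (12 * P + 9) \<le> 21 * X" using bP by (simp add: X_def distrib_left)
    ultimately have "entry_time + 3 \<le> d * (15 * X) + 48 * X"
      using X unfolding entry_time_def by linarith
    then have "entry_time + 3 \<le> (15 * d + 48) * X" by (simp add: algebra_simps)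
    then have "W * (entry_time + 3) \<le> (2 * P) * ((15 * d + 48) * X)"
      using pos by (intro mult_le_mono) (simp_all add: W_def)
    also have "\<dots> = (30 * d + 96) * (P * X)" by (simp add: algebra_simps)
    finally have "W * (entry_time + 3) \<le> (30 * d + 96) * (P * X)" .
    moreover have PX: "1 \<le> P * X" using X pos by simp
    moreover have "(30 * d + 102) * (P * X) = (30 * d + 96) * (P * X) + 6 * (P * X)"
      by (simp add: distrib_right)
    ultimately have "W * (entry_time + 3) + 6 \<le> (30 * d + 102) * (P * X)"
      by linarith
    then have "X * (W * (entry_time + 3) + 6) \<le> X * ((30 * d + 102) * (P * X))" by (rule mult_le_mono2)
    then have "fill_time \<le> (30 * d + 102) * (X * (P * X)) + 3"
      by (simp add: fill_time_def X_def mult_ac)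
    moreover have "X \<le> X * (P * X)" using PX by simp
    then have "1 \<le> X * (P * X)" "b \<le> X * (P * X)" using X by linarith+
    moreover from this have "d \<le> d * (X * (P * X))" by simp
    moreover have "(31 * d + 120) * (X * (P * X)) = (30 * d + 102) * (X * (P * X)) + d * (X * (P * X)) + 18 * (X * (P * X))"
      by (simp add: algebra_simps)
    ultimately have "fill_time + d + b * 8 + 7 \<le> (31 * d + 120) * (X * (P * X))" by linarith
    moreover have "X * (P * X) = b ^ (3 * d + 2)"
      by (simp add: X_def P_def power_add power_mult power2_eq_square power3_eq_cube mult_ac flip: power_mult_distrib)
    ultimately show ?thesis by simp
  qed
  then have len: "length tr \<le> (31 * d + 120) * b ^ (3 * d + 2)" using tr(2) by linarith
  note res = resources[OF ne tr(3,4) card_cells(1)]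
  have storage: "bit_storage tr t \<le> (34 + d) * b ^ (2 * d + 1) * bit_size (int v)"
    using order_trans[OF res(3) mult_le_mono1[OF card]] by (simp only: V_def)
  have stored: "stored_integers tr \<le> (34 + d) * b ^ (2 * d + 1)"
    using res(1) card by (rule order_trans)
  have "max_bit_size tr t \<le> bit_size (int v)" using res(2) by (simp only: V_def)
  moreover have "\<forall>M a. mono M \<longrightarrow> 0 < a \<longrightarrow> (\<forall>b. a * real b \<le> M b) \<longrightarrow>
      bit_complexity M tr \<le> real (length tr) * ((1 + 2 / a) * M (bit_size (int v)))"
    using res(4) unfolding V_def by blast
  ultimately show ?thesis using tr(1) out len storage stored by blast
qed

section \<open>Asymptotics\<close>

text \<open>The power on the right dominates each summand; their coefficients 4, 2, 1, 1, 1 and 3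
  add up to 12, and \<open>d\<close> comes from the sum of the moves.\<close>

lemma value_bound_le: "value_bound d N \<le> (d + 12) * Suc N ^ (2 * N + 2 * d + 3)"
proof -
  define b where "b = Suc N"
  define G where "G = b ^ (2 * N + 2 * d + 3)"
  have le: "b ^ k \<le> G" if "k \<le> 2 * N + 2 * d + 3" for k
    unfolding G_def using that by (intro power_increasing) (simp_all add: b_def)
  have W: "Suc (b ^ d) \<le> 2 * b ^ d" using one_le_power[of b d] by (simp add: b_def)
  have "b * b ^ d * Suc (b ^ d) \<le> b * b ^ d * (2 * b ^ d)" using W by (rule mult_le_mono2)
  also have "\<dots> = 2 * b ^ (2 * d + 1)" by (simp add: mult_2 power_add distrib_left mult.assoc)
  finally have "b * b ^ d * Suc (b ^ d) \<le> 2 * G" using le[of "2 * d + 1"] by simp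
  moreover have "b \<le> G" using le[of 1] by simp
  moreover have "d * b * b ^ N \<le> d * G" using le[of "N + 1"] by (simp add: mult.assoc)
  moreover have "b * b ^ d * (b ^ N * b ^ N) \<le> G"
  proof -
    have "b * b ^ d * (b ^ N * b ^ N) = b ^ (2 * N + d + 1)" by (simp add: mult_2 power_add)
    also have "\<dots> \<le> G" by (rule le) simp
    finally show ?thesis .
  qed
  moreover have "b ^ N * b ^ N \<le> G"
  proof -
    have "b ^ N * b ^ N = b ^ (2 * N)" by (simp add: mult_2 power_add)
    also have "\<dots> \<le> G" by (rule le) simp
    finally show ?thesis .
  qed
  moreover have "b * b ^ d * (b * b ^ d) \<le> G"
  proof -
    have "b * b ^ d * (b * b ^ d) = b ^ (2 * d + 2)" by (simp add: mult_2 power_add)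
    also have "\<dots> \<le> G" by (rule le) simp
    finally show ?thesis .
  qed
  moreover have "1 \<le> G" using le[of 0] by simp
  moreover have "(d + 12) * G = d * G + 12 * G" by (simp add: distrib_right)
  ultimately show ?thesis
    unfolding value_bound_def Let_def b_def[symmetric] G_def[symmetric] by linarith
qed

lemma log2_ge_1:
  assumes "N \<ge> 2"
  shows "1 \<le> log 2 (real N)"
  using log_mono[of 2 2 "real N"] assms by simp

lemma log2_le: "n \<ge> 1 \<Longrightarrow> log 2 (real n) \<le> real n"
  using log2_of_power_less[OF less_exp, of n] by simp

text \<open>From \<open>N = 2\<close> on, \<open>log 2 (N + 1) \<le> 2 * log 2 N\<close> and
  \<open>N * log 2 N \<ge> 1\<close>; both fail for \<open>N = 1\<close>. The constant is
  \<open>(d + 14) + 2 * (2 * d + 5)\<close>.\<close>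

lemma bit_size_value_bound:
  assumes N: "N \<ge> 2"
  shows "real (bit_size (int (value_bound d N))) \<le> real (5 * d + 24) * (real N * log 2 (real N))"
proof -
  define v where "v = value_bound d N"
  define l where "l = log 2 (real N)"
  define e where "e = 2 * N + 2 * d + 3"
  have l: "1 \<le> l" using N by (simp add: l_def log2_ge_1)
  have v: "v > 0" by (simp add: v_def value_bound_def Let_def)
  have "real (bit_size (int v)) \<le> log 2 (real v) + 2"
    using v by (simp add: bit_size_def floorlog_def)
  also have "log 2 (real v) \<le> log 2 (real ((d + 12) * Suc N ^ e))"
  proof (rule log_mono)
    show "real v \<le> real ((d + 12) * Suc N ^ e)"
      unfolding of_nat_le_iff v_def e_def by (rule value_bound_le)
  qed (use v in simp_all)
  also have "\<dots> = log 2 (real (d + 12)) + real e * log 2 (real (Suc N))"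
    by (simp add: log_mult log_nat_power del: of_nat_Suc)
  also have "log 2 (real (d + 12)) \<le> real (d + 12)" by (rule log2_le) simp
  also have "real e * log 2 (real (Suc N)) \<le> real e * (2 * l)"
  proof (intro mult_left_mono)
    have "Suc N \<le> N ^ 2" using N mult_le_mono1[of 2 N N] unfolding power2_eq_square by linarith
    then have "real (Suc N) \<le> real N ^ 2" by (metis of_nat_le_iff of_nat_power)
    then have "log 2 (real (Suc N)) \<le> log 2 (real N ^ 2)" by (intro log_mono) auto
    also have "\<dots> = 2 * l" using N by (simp add: log_nat_power l_def)
    finally show "log 2 (real (Suc N)) \<le> 2 * l" .
  qed simp
  finally have "real (bit_size (int v)) \<le> real (d + 12) + 2 + real e * (2 * l)" by simp
  moreover have "real (d + 12) + 2 \<le> real (d + 14) * (real N * l)"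
  proof -
    have "1 * 1 \<le> real N * l" using N l by (intro mult_mono) auto
    then have "real (d + 14) * 1 \<le> real (d + 14) * (real N * l)" by (intro mult_left_mono) auto
    moreover have "real (d + 14) * 1 = real (d + 12) + 2" by simp
    ultimately show ?thesis by linarith
  qed
  moreover have "real e * (2 * l) \<le> (real (2 * d + 5) * real N) * (2 * l)"
  proof (intro mult_right_mono)
    have "2 * d + 3 \<le> (2 * d + 3) * N" using N by simp
    then have "e \<le> (2 * d + 5) * N" unfolding e_def by (simp add: distrib_right)
    then show "real e \<le> real (2 * d + 5) * real N" by (metis of_nat_le_iff of_nat_mult)
  qed (use l in simp)
  moreover have "real (d + 14) * (real N * l) + (real (2 * d + 5) * real N) * (2 * l)
      = real (5 * d + 24) * (real N * l)"
    by (simp add: algebra_simps)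
  ultimately show ?thesis unfolding v_def[symmetric] l_def[symmetric] by linarith
qed

section \<open>Growth of the cost of multiplication\<close>

lemma multiplication_costD:
  assumes "multiplication_cost M"
  obtains a K where "mono M" "a > 0" "\<And>b. a * real b \<le> M b" "K \<ge> 1"
    "\<And>b j. M (2 ^ j * b) \<le> K ^ j * M b" "\<And>b. 0 \<le> M b"
proof -
  from assms obtain a K where M: "mono M" "a > 0" "\<And>b. a * real b \<le> M b" "\<And>b. M (2 * b) \<le> K * M b"
    unfolding multiplication_cost_def by blast
  have nonneg: "0 \<le> M b" for b
    using M(2) M(3)[of b] by (meson less_imp_le mult_nonneg_nonneg of_nat_0_le_iff order_trans)
  define K' where "K' = max K 1"
  have step: "M (2 * b) \<le> K' * M b" for b
  proof -
    have "K * M b \<le> K' * M b" using nonneg[of b] by (intro mult_right_mono) (simp_all add: K'_def)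
    with M(4)[of b] show ?thesis by linarith
  qed
  have "M (2 ^ j * b) \<le> K' ^ j * M b" for b j
  proof (induction j)
    case (Suc j)
    have "M (2 ^ Suc j * b) \<le> K' * M (2 ^ j * b)" using step[of "2 ^ j * b"] by (simp add: mult.assoc)
    also have "\<dots> \<le> K' * (K' ^ j * M b)" using Suc by (intro mult_left_mono) (simp_all add: K'_def)
    finally show ?case by (simp add: mult.assoc)
  qed simp
  then show thesis using that[of a K'] M nonneg by (simp add: K'_def)
qed

text \<open>Some \<open>2 ^ j\<close> lies between \<open>n\<close> and \<open>2 * n\<close>, so
  \<open>j\<close> doublings starting from 1 suffice; with \<open>K \<le> 2 ^ q\<close> their factor
  \<open>K ^ j\<close> is at most \<open>(2 ^ j) ^ q\<close>, a polynomial in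
  \<open>n\<close>.\<close>

lemma polynomial_of_doubling:
  fixes M :: "nat \<Rightarrow> real"
  assumes "mono M" "\<And>b j. M (2 ^ j * b) \<le> K ^ j * M b" "\<And>b. 0 \<le> M b" "K \<ge> 1"
  shows "\<exists>q. \<forall>n\<ge>1. M n \<le> (2 * real n) ^ q * M 1"
proof -
  define q where "q = nat \<lceil>K\<rceil>"
  have "K \<le> real q" using assms(4) by (simp add: q_def)
  also have "\<dots> \<le> 2 ^ q" using of_nat_less_two_power[of q] by (intro less_imp_le) auto
  finally have q: "K \<le> 2 ^ q" .
  have "M n \<le> (2 * real n) ^ q * M 1" if n: "n \<ge> 1" for n
  proof -
    obtain j where j: "n \<le> 2 ^ j" "2 ^ j \<le> 2 * n"
    proof -
      obtain k where "2 ^ k \<le> n" "n < 2 ^ Suc k"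
        using ex_power_ivl1[of 2 n] n by auto
      then show thesis using that[of "Suc k"] by auto
    qed
    have "M n \<le> M (2 ^ j * 1)" using j(1) assms(1) by (auto dest: monoD)
    also have "\<dots> \<le> K ^ j * M 1" by (rule assms(2))
    also have "K ^ j \<le> (2 ^ q) ^ j" using q assms(4) by (intro power_mono) auto
    also have "(2 ^ q) ^ j = (real (2 ^ j)) ^ q" by (simp flip: power_mult add: mult.commute)
    also have "\<dots> \<le> (2 * real n) ^ q"
    proof (intro power_mono)
      show "real (2 ^ j) \<le> 2 * real n" using j(2) by linarith
    qed simp
    finally show ?thesis using assms(3) by (simp add: mult_right_mono)
  qed
  then show ?thesis by blast
qed

lemma bit_complexity_nonneg:
  assumes "\<And>b. 0 \<le> M b"
  shows "0 \<le> bit_complexity M tr"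
proof -
  have "0 \<le> instr_bit_cost M i s" for i s using assms by (cases i) auto
  then show ?thesis unfolding bit_complexity_def by (intro sum_list_nonneg) auto
qed

lemma Suc_power_le: "N \<ge> 1 \<Longrightarrow> real (Suc N ^ k) \<le> 2 ^ k * real N ^ k"
proof -
  assume "N \<ge> 1"
  then have "real (Suc N) ^ k \<le> (2 * real N) ^ k" by (intro power_mono) auto
  then show ?thesis by (simp add: power_mult_distrib)
qed

theorem theorem1p1:
  fixes d :: nat
  assumes "d \<ge> 1"
  shows "\<exists>(p :: com) (tr :: nat \<Rightarrow> trace) (t :: nat \<Rightarrow> state).
      (\<forall>N\<ge>1. exec p (initial_state N) (tr N) (t N) \<and>
             (\<forall>n\<le>N. t N (Cell (int n)) = int (card (Av n (beta d))))) \<and>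
      (\<lambda>N. real (op_count (tr N))) \<in> O(\<lambda>N. real N ^ (3 * d + 2)) \<and>
      (\<lambda>N. real (stored_integers (tr N))) \<in> O(\<lambda>N. real N ^ (2 * d + 1)) \<and>
      (\<lambda>N. real (max_bit_size (tr N) (t N))) \<in> O(\<lambda>N. real N * log 2 (real N)) \<and>
      (\<forall>M. multiplication_cost M \<longrightarrow>
         (\<exists>k. (\<lambda>N. bit_complexity M (tr N)) \<in> O(\<lambda>N. real N ^ k)) \<and>
         (\<lambda>N. bit_complexity M (tr N))
           \<in> O(\<lambda>N. real N ^ (3 * d + 2) * M (nat \<lceil>real N * log 2 (real N)\<rceil>))) \<and>
      (\<lambda>N. real (bit_storage (tr N) (t N))) \<in> O(\<lambda>N. real N ^ (2 * d + 2) * log 2 (real N))"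
proof -
  define \<beta> where "\<beta> = (\<lambda>N. bit_size (int (value_bound d N)))"
  define Q where "Q = (\<lambda>N tr t. exec (program d) (initial_state N) tr t \<and>
    (\<forall>n\<le>N. t (Cell (int n)) = int (card (Av n (beta d)))) \<and>
    length tr \<le> (31 * d + 120) * Suc N ^ (3 * d + 2) \<and>
    stored_integers tr \<le> (34 + d) * Suc N ^ (2 * d + 1) \<and>
    max_bit_size tr t \<le> \<beta> N \<and>
    bit_storage tr t \<le> (34 + d) * Suc N ^ (2 * d + 1) * \<beta> N \<and>
    (\<forall>M a. mono M \<longrightarrow> 0 < a \<longrightarrow> (\<forall>b. a * real b \<le> M b) \<longrightarrow>
      bit_complexity M tr \<le> real (length tr) * ((1 + 2 / a) * M (\<beta> N))))"
  have "\<exists>tr t. Q N tr t" if "N \<ge> 1" for N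
    unfolding Q_def \<beta>_def by (rule counting_program[OF that table_le card_Av_beta_table])
  then obtain tr t where "\<And>N. N \<ge> 1 \<Longrightarrow> Q N (tr N) (t N)" by metis
  note run = this[unfolded Q_def]
  have run_time: "length (tr N) \<le> (31 * d + 120) * Suc N ^ (3 * d + 2)"
    and run_stored: "stored_integers (tr N) \<le> (34 + d) * Suc N ^ (2 * d + 1)"
    and run_bits: "max_bit_size (tr N) (t N) \<le> \<beta> N"
    and run_storage: "bit_storage (tr N) (t N) \<le> (34 + d) * Suc N ^ (2 * d + 1) * \<beta> N"
    and run_cost: "\<And>M a. mono M \<Longrightarrow> 0 < a \<Longrightarrow> (\<And>b. a * real b \<le> M b) \<Longrightarrow>
      bit_complexity M (tr N) \<le> real (length (tr N)) * ((1 + 2 / a) * M (\<beta> N))"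
    if "N \<ge> 1" for N
    using run[OF that] by blast+
  define A where "A = real (31 * d + 120) * 2 ^ (3 * d + 2)"
  define S where "S = real (34 + d) * 2 ^ (2 * d + 1)"
  \<comment> \<open>The estimates are made from \<open>N = 2\<close> on, because the logarithm
    vanishes at \<open>N = 1\<close>.\<close>
  have ev: "eventually (\<lambda>N :: nat. N \<ge> 2) at_top" by (rule eventually_ge_at_top)
  have len: "real (length (tr N)) \<le> A * real N ^ (3 * d + 2)" if "N \<ge> 1" for N
  proof -
    have "real (length (tr N)) \<le> real (31 * d + 120) * real (Suc N ^ (3 * d + 2))"
      using run_time[OF that] unfolding of_nat_mult[symmetric] of_nat_le_iff .
    also have "\<dots> \<le> real (31 * d + 120) * (2 ^ (3 * d + 2) * real N ^ (3 * d + 2))"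
      by (intro mult_left_mono Suc_power_le that) simp
    finally show ?thesis by (simp add: A_def mult.assoc)
  qed
  have cells: "real ((34 + d) * Suc N ^ (2 * d + 1)) \<le> S * real N ^ (2 * d + 1)" if "N \<ge> 1" for N
  proof -
    have "real (34 + d) * real (Suc N ^ (2 * d + 1)) \<le> real (34 + d) * (2 ^ (2 * d + 1) * real N ^ (2 * d + 1))"
      by (intro mult_left_mono Suc_power_le that) simp
    then show ?thesis by (simp only: S_def of_nat_mult mult.assoc)
  qed
  have \<beta>: "real (\<beta> N) \<le> real (5 * d + 24) * (real N * log 2 (real N))" if "N \<ge> 2" for N
    unfolding \<beta>_def using that by (rule bit_size_value_bound)
  have time: "(\<lambda>N. real (op_count (tr N))) \<in> O(\<lambda>N. real N ^ (3 * d + 2))"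
    by (rule bigoI[where c = A], rule eventually_mono[OF ev]) (use len in \<open>simp add: op_count_def\<close>)
  have stored: "(\<lambda>N. real (stored_integers (tr N))) \<in> O(\<lambda>N. real N ^ (2 * d + 1))"
  proof (rule bigoI[where c = S], rule eventually_mono[OF ev])
    fix N :: nat assume "N \<ge> 2"
    then have N: "N \<ge> 1" by simp
    have "real (stored_integers (tr N)) \<le> real ((34 + d) * Suc N ^ (2 * d + 1))"
      using run_stored[OF N] by (simp only: of_nat_le_iff)
    with cells[OF N] show "norm (real (stored_integers (tr N))) \<le> S * norm (real N ^ (2 * d + 1))"
      by simp
  qed
  have bits: "(\<lambda>N. real (max_bit_size (tr N) (t N))) \<in> O(\<lambda>N. real N * log 2 (real N))"
  proof (rule bigoI[where c = "real (5 * d + 24)"], rule eventually_mono[OF ev])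
    fix N :: nat assume N: "N \<ge> 2"
    have "real (max_bit_size (tr N) (t N)) \<le> real (\<beta> N)" using run_bits[of N] N by simp
    then show "norm (real (max_bit_size (tr N) (t N))) \<le> real (5 * d + 24) * norm (real N * log 2 (real N))"
      using \<beta>[OF N] log2_ge_1[OF N] by simp
  qed
  have storage: "(\<lambda>N. real (bit_storage (tr N) (t N))) \<in> O(\<lambda>N. real N ^ (2 * d + 2) * log 2 (real N))"
  proof (rule bigoI[where c = "S * real (5 * d + 24)"], rule eventually_mono[OF ev])
    fix N :: nat assume N: "N \<ge> 2"
    then have N1: "N \<ge> 1" by simp
    have "real (bit_storage (tr N) (t N)) \<le> real ((34 + d) * Suc N ^ (2 * d + 1)) * real (\<beta> N)"
      using run_storage[OF N1] unfolding of_nat_mult[symmetric] of_nat_le_iff .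
    also have "\<dots> \<le> (S * real N ^ (2 * d + 1)) * (real (5 * d + 24) * (real N * log 2 (real N)))"
      by (intro mult_mono cells[OF N1] \<beta>[OF N]) (simp_all add: S_def)
    also have "\<dots> = S * real (5 * d + 24) * (real N ^ (2 * d + 2) * log 2 (real N))"
      by (simp add: mult_ac)
    finally show "norm (real (bit_storage (tr N) (t N))) \<le> S * real (5 * d + 24) * norm (real N ^ (2 * d + 2) * log 2 (real N))"
      using log2_ge_1[OF N] by simp
  qed
  have complexity: "(\<exists>k. (\<lambda>N. bit_complexity M (tr N)) \<in> O(\<lambda>N. real N ^ k)) \<and>
         (\<lambda>N. bit_complexity M (tr N))
           \<in> O(\<lambda>N. real N ^ (3 * d + 2) * M (nat \<lceil>real N * log 2 (real N)\<rceil>))"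
    if mc: "multiplication_cost M" for M
  proof -
    obtain a K where M: "mono M" "a > 0" "\<And>b. a * real b \<le> M b" "K \<ge> 1"
      "\<And>b j. M (2 ^ j * b) \<le> K ^ j * M b" "\<And>b. 0 \<le> M b"
      using multiplication_costD[OF mc] by metis
    define X where "X = (\<lambda>N. nat \<lceil>real N * log 2 (real N)\<rceil>)"
    define e where "e = 5 * d + 24"
    define C where "C = A * ((1 + 2 / a) * K ^ e)"
    have C: "0 \<le> C" using M by (simp add: C_def A_def)
    have bound: "bit_complexity M (tr N) \<le> C * (real N ^ (3 * d + 2) * M (X N))" if N: "N \<ge> 2" for N
    proof -
      have "real (\<beta> N) \<le> real e * real (X N)"
      proof -
        have "real N * log 2 (real N) \<le> real (X N)" by (simp add: X_def) linarith
        then have "real e * (real N * log 2 (real N)) \<le> real e * real (X N)" by (intro mult_left_mono) auto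
        with \<beta>[OF N] show ?thesis unfolding e_def by (rule order_trans)
      qed
      then have "\<beta> N \<le> e * X N" by (metis of_nat_le_iff of_nat_mult)
      \<comment> \<open>Enlarged to a power of two, the constant costs \<open>e\<close> doublings,
        hence a factor \<open>K ^ e\<close>.\<close>
      also have "\<dots> \<le> 2 ^ e * X N" by (intro mult_le_mono1) (simp add: less_imp_le)
      finally have "M (\<beta> N) \<le> M (2 ^ e * X N)" using M(1) by (rule monoD[rotated])
      also have "\<dots> \<le> K ^ e * M (X N)" by (rule M(5))
      finally have "M (\<beta> N) \<le> K ^ e * M (X N)" .
      then have le: "(1 + 2 / a) * M (\<beta> N) \<le> (1 + 2 / a) * (K ^ e * M (X N))"
        using M(2) by (intro mult_left_mono) auto
      have "1 \<le> N" using N by simp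
      then have "real (length (tr N)) * ((1 + 2 / a) * M (\<beta> N))
         \<le> (A * real N ^ (3 * d + 2)) * ((1 + 2 / a) * (K ^ e * M (X N)))"
        using M(2,6) by (intro mult_mono[OF len le]) (simp_all add: A_def)
      moreover have "bit_complexity M (tr N) \<le> real (length (tr N)) * ((1 + 2 / a) * M (\<beta> N))"
        using run_cost[OF \<open>1 \<le> N\<close> M(1-3)] .
      ultimately show ?thesis by (simp add: C_def mult_ac)
    qed
    obtain q where q: "\<And>n. n \<ge> 1 \<Longrightarrow> M n \<le> (2 * real n) ^ q * M 1"
      using polynomial_of_doubling[OF M(1,5,6,4)] by blast
    have poly: "M (X N) \<le> 2 ^ q * M 1 * real N ^ (2 * q)" if N: "N \<ge> 2" for N
    proof -
      have "log 2 (real N) \<le> real N" using N by (intro log2_le) simp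
      then have "real N * log 2 (real N) \<le> real (N * N)" by (simp add: mult_left_mono)
      then have "X N \<le> N * N" unfolding X_def by (simp add: ceiling_le_iff nat_le_iff)
      then have "M (X N) \<le> M (N * N)" using M(1) by (auto dest: monoD)
      also have "\<dots> \<le> (2 * real (N * N)) ^ q * M 1" using N by (intro q) simp
      also have "\<dots> = 2 ^ q * M 1 * real N ^ (2 * q)"
        by (simp add: power_mult_distrib power_mult power2_eq_square)
      finally show ?thesis .
    qed
    have nonneg: "0 \<le> bit_complexity M (tr N)" for N using M(6) by (rule bit_complexity_nonneg)
    have "(\<lambda>N. bit_complexity M (tr N)) \<in> O(\<lambda>N. real N ^ (3 * d + 2 + 2 * q))"
    proof (rule bigoI[where c = "C * (2 ^ q * M 1)"], rule eventually_mono[OF ev])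
      fix N :: nat assume N: "N \<ge> 2"
      have "bit_complexity M (tr N) \<le> C * (real N ^ (3 * d + 2) * (2 ^ q * M 1 * real N ^ (2 * q)))"
        using C poly[OF N] by (intro order_trans[OF bound[OF N]] mult_left_mono) auto
      then show "norm (bit_complexity M (tr N)) \<le> C * (2 ^ q * M 1) * norm (real N ^ (3 * d + 2 + 2 * q))"
        using nonneg[of N] by (simp add: power_add mult_ac)
    qed
    moreover have "(\<lambda>N. bit_complexity M (tr N)) \<in> O(\<lambda>N. real N ^ (3 * d + 2) * M (X N))"
      by (rule bigoI[where c = C], rule eventually_mono[OF ev])
         (use bound nonneg M(6) in simp)
    ultimately show ?thesis unfolding X_def by blast
  qed
  have correct: "\<forall>N\<ge>1. exec (program d) (initial_state N) (tr N) (t N) \<and>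
      (\<forall>n\<le>N. t N (Cell (int n)) = int (card (Av n (beta d))))"
    using run by blast
  have all_complexity: "\<forall>M. multiplication_cost M \<longrightarrow>
      (\<exists>k. (\<lambda>N. bit_complexity M (tr N)) \<in> O(\<lambda>N. real N ^ k)) \<and>
      (\<lambda>N. bit_complexity M (tr N))
        \<in> O(\<lambda>N. real N ^ (3 * d + 2) * M (nat \<lceil>real N * log 2 (real N)\<rceil>))"
    by (intro allI impI, rule complexity)
  show ?thesis
    by (rule exI[of _ "program d"], rule exI[of _ tr], rule exI[of _ t],
        rule conjI[OF correct conjI[OF time conjI[OF stored conjI[OF bits conjI[OF all_complexity storage]]]]])
qed

end
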